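(* Let $n\ge1$, let $\boldsymbol W_n(t)=(W_1(t),\dots,W_n(t))$, $t\ge0$, be the standard $n$-dimensional Brownian motion and $\|\boldsymbol W_n(t)\|=\sqrt{\sum_{i=1}^nW_i^2(t)}$ the Bessel process of order $n$. Let $g(\cdot)$ be a nonnegative continuous function on $(0,1]$ such that $g(t)\uparrow\infty$ as $t\to0$. If $\int_0^1\frac1t(g(t))^{n/2}e^{-g(t)/2}dt<\infty$, then, as $u\to\infty$, $$\mathbb{P}\left(\sup_{t\in(0,1]}\left(\frac{\|\boldsymbol W_n(t)\|^2}{t}-g(t)\right)>u\right)\sim\frac{2^{-n/2}u^{n/2}e^{-u/2}}{\Gamma(n/2)}\int_0^1\frac1te^{-g(t)/2}\,dt.$$ If $\int_0^1\frac1t(g(t))^{n/2}e^{-g(t)/2}dt=\infty$, then $$\mathbb{P}\left(\sup_{t\in(0,1]}\left(\frac{\|\boldsymbol W_n(t)\|^2}{t}-g(t)\right)=\infty\right)=1.$$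
   Context: $\Gamma$ is the Euler Gamma function; $a(u)\sim b(u)$ means $a(u)/b(u)\to1$. $g(t)\uparrow\infty$ as $t\to0$ means that $g$ increases to infinity monotonically as $t$ decreases to $0$ (near $0$). *)

theory Defs
  imports "HOL-Probability.Probability" "HOL-Library.Landau_Symbols"
begin

unbundle asymp_equiv_syntax

text \<open>
  One-dimensional standard Brownian motion on the time set \<open>[0,\<infinity>)\<close>; values at negative times are
  irrelevant. All paths (not just almost all) are continuous, so that suprema over uncountable
  time sets are measurable without completing the probability space. Note that
  \<^const>\<open>normal_density\<close> takes the standard deviation, not the variance.
\<close>

locale brownian_motion = prob_space M for M :: "'a measure" +
  fixes B :: "real \<Rightarrow> 'a \<Rightarrow> real"
  assumes measurable_B: "\<And>t. 0 \<le> t \<Longrightarrow> B t \<in> borel_measurable M"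
    and starts_at_0: "AE \<omega> in M. B 0 \<omega> = 0"
    and continuous_paths: "\<And>\<omega>. \<omega> \<in> space M \<Longrightarrow> continuous_on {0..} (\<lambda>t. B t \<omega>)"
    and independent_increments:
      "\<And>(k::nat) (t :: nat \<Rightarrow> real). 0 \<le> t 0 \<Longrightarrow> (\<forall>i<k. t i \<le> t (Suc i)) \<Longrightarrow>
         indep_vars (\<lambda>_. borel) (\<lambda>i \<omega>. B (t (Suc i)) \<omega> - B (t i) \<omega>) {..<k}"
    and normal_increments:
      "\<And>s t. 0 \<le> s \<Longrightarrow> s < t \<Longrightarrow>
         distributed M lborel (\<lambda>\<omega>. B t \<omega> - B s \<omega>) (normal_density 0 (sqrt (t - s)))"

text \<open>
  The components are independent as processes, that is, as random elements of the product space
  \<open>\<real>\<^bsup>[0,\<infinity>)\<^esup>\<close>.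
\<close>

locale multi_brownian_motion = prob_space M for M :: "'a measure" +
  fixes W :: "real \<Rightarrow> 'a \<Rightarrow> real ^ 'n"
  assumes component_brownian_motion: "\<And>i. brownian_motion M (\<lambda>t \<omega>. W t \<omega> $ i)"
    and independent_components:
      "indep_vars (\<lambda>_. Pi\<^sub>M {0..} (\<lambda>_. borel)) (\<lambda>i \<omega>. \<lambda>t\<in>{0..}. W t \<omega> $ i) UNIV"

definition increases_to_infinity_at_0 :: "(real \<Rightarrow> real) \<Rightarrow> bool" where
  "increases_to_infinity_at_0 g \<longleftrightarrow>
     (\<exists>\<delta>>0. \<forall>s t. 0 < s \<longrightarrow> s \<le> t \<longrightarrow> t \<le> \<delta> \<longrightarrow> g t \<le> g s) \<and> filterlim g at_top (at_right 0)"

end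

(* Key idea: mix the laws of Brownian motion with constant drift \<theta> over all \<theta> with respect to Lebesgue
   measure. At time t this mixture has density (2 pi / t)^(n/2) exp(|W_t|^2 / (2 t)) with respect to the
   law of W, which on the boundary |W_t|^2 = t c(t) depends on t only. Changing measure at the first
   crossing time tau after a gives, for every continuous boundary c,
     (2 pi)^(n/2) P(no crossing at a, crossing in (a, b]) = int E_\<theta>[tau^(n/2) exp(- c(tau) / 2)] d\<theta>,
   the expectation being over paths that have not crossed at a and cross in (a, b].
   Convergent case: put c = g + u and \<theta> = sqrt u y; as u tends to infinity, tau tends to 1 / |y|^2, and
   dominated convergence and polar coordinates give the constant on [a, 1]. Near 0, c is replaced by
   constants on dyadic intervals. Divergent case: if g + u is not crossed with positive probability, then
   for large \<theta> the drifted path crosses, with probability bounded below, not before the time t at which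
   |\<theta>| sqrt t = sqrt (c t) - K; the right-hand side then dominates the divergent integral. *)

theory Submission
  imports Defs "HOL-Real_Asymp.Real_Asymp"
begin

section \<open>The Cameron-Martin formula on a finite grid\<close>

text \<open>The mixture density is space-time harmonic, and once |W_t|^2 / t is prescribed it
  depends on t alone; so a first crossing, where a continuous path meets the boundary exactly,
  carries a deterministic weight. Two obstacles shape the proof. The mixture has infinite mass; but
  not having crossed at a > 0 confines \<theta> to a ball of radius sqrt (c a / a) around - W_a / a,
  which is the source of the dominating functions. And no stopping theorem is used: the identity is
  proved on finite grids, where only Gaussian increments matter, and passes to the limit because
  strict crossings of a continuous boundary form an open set of times. Constants: Lebesgue measure
  is carried by y -> 1 / |y|^2 to v (n/2) t^(-n/2-1) dt, with v the volume of the unit ball; the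
  weight t^(n/2) leaves dt / t, and v (n/2) / (2 pi)^(n/2) = 2^(-n/2) / Gamma (n/2). In the
  divergent case the integrand c^(n/2) / t is the volume (c / t)^(n/2) of a shell of drifts times
  t^(n/2-1).\<close>

lemma PiM_density:
  fixes N :: "'i \<Rightarrow> 'b measure" and f :: "'i \<Rightarrow> 'b \<Rightarrow> ennreal"
  assumes I: "finite I"
    and f [measurable]: "\<And>i. i \<in> I \<Longrightarrow> f i \<in> borel_measurable (N i)"
    and N: "\<And>i. sigma_finite_measure (N i)"
    and fN: "\<And>i. i \<in> I \<Longrightarrow> sigma_finite_measure (density (N i) (f i))"
  shows "PiM I (\<lambda>i. density (N i) (f i)) = density (PiM I N) (\<lambda>x. \<Prod>i\<in>I. f i (x i))"
proof -
  \<comment> \<open>Off \<open>I\<close> the factor stays \<open>N i\<close>: the locale wants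
    sigma-finiteness at every index, and \<open>fN\<close> gives it on \<open>I\<close>
    only.\<close>
  let ?D = "\<lambda>i. if i \<in> I then density (N i) (f i) else N i"
  interpret N: product_sigma_finite N using N by (simp add: product_sigma_finite_def)
  interpret D: product_sigma_finite ?D
    using N fN by (auto simp: product_sigma_finite_def)
  have *: "PiM I ?D = density (PiM I N) (\<lambda>x. \<Prod>i\<in>I. f i (x i))"
  proof (rule D.PiM_eqI[symmetric, OF I])
    have "sets (PiM I ?D) = sets (PiM I N)"
      by (rule sets_PiM_cong) auto
    then show "sets (density (PiM I N) (\<lambda>x. \<Prod>i\<in>I. f i (x i))) = sets (PiM I ?D)" by simp
  next
    fix A assume A: "\<And>i. i \<in> I \<Longrightarrow> A i \<in> sets (?D i)"
    have A' [measurable]: "A i \<in> sets (N i)" if "i \<in> I" for i using A[OF that] that by simp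
    have meas [measurable]: "(\<lambda>x. \<Prod>i\<in>I. f i (x i)) \<in> borel_measurable (PiM I N)"
      by (intro borel_measurable_prod_ennreal) measurable
    have AP: "Pi\<^sub>E I A \<in> sets (PiM I N)" using A' I by (intro sets_PiM_I_finite) auto
    have "emeasure (density (PiM I N) (\<lambda>x. \<Prod>i\<in>I. f i (x i))) (Pi\<^sub>E I A)
        = (\<integral>\<^sup>+x. (\<Prod>i\<in>I. f i (x i)) * indicator (Pi\<^sub>E I A) x \<partial>PiM I N)"
      by (rule emeasure_density[OF meas AP])
    also have "\<dots> = (\<integral>\<^sup>+x. (\<Prod>i\<in>I. f i (x i) * indicator (A i) (x i)) \<partial>PiM I N)"
    proof (rule nn_integral_cong)
      fix x assume "x \<in> space (PiM I N)"
      then have ext: "x \<in> extensional I" by (auto simp: space_PiM PiE_def)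
      have "indicator (Pi\<^sub>E I A) x = (\<Prod>i\<in>I. indicator (A i) (x i) :: ennreal)"
        using I ext
        by (auto simp: indicator_def PiE_def Pi_def prod_zero_iff intro!: prod.neutral)
      then show "(\<Prod>i\<in>I. f i (x i)) * indicator (Pi\<^sub>E I A) x = (\<Prod>i\<in>I. f i (x i) * indicator (A i) (x i))"
        by (simp add: prod.distrib)
    qed
    also have "\<dots> = (\<Prod>i\<in>I. (\<integral>\<^sup>+x. f i x * indicator (A i) x \<partial>N i))"
      by (rule N.product_nn_integral_prod[OF I]) measurable
    also have "\<dots> = (\<Prod>i\<in>I. emeasure (?D i) (A i))"
      by (intro prod.cong refl) (simp add: emeasure_density A')
    finally show "emeasure (density (PiM I N) (\<lambda>x. \<Prod>i\<in>I. f i (x i))) (Pi\<^sub>E I A)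
      = (\<Prod>i\<in>I. emeasure (?D i) (A i))" .
  qed
  have "PiM I ?D = PiM I (\<lambda>i. density (N i) (f i))" by (rule PiM_cong) auto
  with * show ?thesis by simp
qed

text \<open>Completing the square. The mean is written m * s so that the exponent is the
  Cameron-Martin exponent of one increment over a time s; these exponents add up along a
  grid.\<close>

lemma normal_density_shift:
  assumes "0 < s"
  shows "normal_density (m * s) (sqrt s) x = normal_density 0 (sqrt s) x * exp (m * x - m\<^sup>2 * s / 2)"
proof -
  have "- (x - m * s)\<^sup>2 / (2 * (sqrt s)\<^sup>2) = - (x - 0)\<^sup>2 / (2 * (sqrt s)\<^sup>2) + (m * x - m\<^sup>2 * s / 2)"
    using assms by (simp add: field_simps power2_eq_square)
  then have "exp (- (x - m * s)\<^sup>2 / (2 * (sqrt s)\<^sup>2)) = exp (- (x - 0)\<^sup>2 / (2 * (sqrt s)\<^sup>2)) * exp (m * x - m\<^sup>2 * s / 2)"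
    by (simp add: exp_add[symmetric])
  then show ?thesis unfolding normal_density_def by simp
qed

lemma density_normal_shift:
  assumes "0 < s"
  shows "density lborel (normal_density (m * s) (sqrt s)) =
    density (density lborel (normal_density 0 (sqrt s))) (\<lambda>x. ennreal (exp (m * x - m\<^sup>2 * s / 2)))"
  by (subst density_density_eq)
     (auto simp: normal_density_shift[OF assms] ennreal_mult'[symmetric] intro!: density_cong)

lemma measurable_vec_lambda:
  assumes "\<And>j::'n::finite. f j \<in> borel_measurable M"
  shows "(\<lambda>x. (\<chi> j. f j x) :: real ^ 'n) \<in> borel_measurable M"
proof -
  have "(\<lambda>x. (\<chi> j. f j x) :: real ^ 'n) = (\<lambda>x. \<Sum>j\<in>UNIV. f j x *\<^sub>R axis j 1)"
    by (rule ext) (simp add: vec_eq_iff axis_def if_distrib cong: if_cong)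
  then show ?thesis using assms by simp
qed

context multi_brownian_motion
begin

lemma random_variable_component: "0 \<le> s \<Longrightarrow> (\<lambda>\<omega>. W s \<omega> $ j) \<in> borel_measurable M"
  using brownian_motion.measurable_B[OF component_brownian_motion[of j]] .

lemma random_variable_W [measurable]: "0 \<le> s \<Longrightarrow> W s \<in> borel_measurable M"
  using measurable_vec_lambda[of "\<lambda>j \<omega>. W s \<omega> $ j" M] random_variable_component by simp

lemma AE_W_0: "AE \<omega> in M. W 0 \<omega> = 0"
proof -
  have "AE \<omega> in M. \<forall>j\<in>UNIV. W 0 \<omega> $ j = 0"
    by (rule AE_finite_allI)
       (auto intro: brownian_motion.starts_at_0[OF component_brownian_motion])
  then show ?thesis by (auto simp: vec_eq_iff)
qed

lemma continuous_paths_W: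
  assumes "\<omega> \<in> space M" shows "continuous_on {0..} (\<lambda>t. W t \<omega>)"
proof -
  have "continuous_on {0..} (\<lambda>t. \<chi> j. W t \<omega> $ j)"
    by (intro continuous_on_vec_lambda brownian_motion.continuous_paths[OF component_brownian_motion] assms)
  then show ?thesis by simp
qed

context
  fixes t :: "nat \<Rightarrow> real" and k :: nat
  assumes t0: "t 0 = 0" and t_less: "\<And>i. i < k \<Longrightarrow> t i < t (Suc i)" and k: "0 < k"
begin

text \<open>Components come first and increments second because independence is assumed on two
  levels: between the components as whole processes, and between the increments of one
  component.\<close>

definition drift_increments :: "real ^ 'n \<Rightarrow> 'a \<Rightarrow> 'n \<Rightarrow> nat \<Rightarrow> real" where
  "drift_increments \<theta> \<omega> = (\<lambda>j\<in>UNIV. \<lambda>i\<in>{..<k}.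
     \<theta> $ j * (t (Suc i) - t i) + (W (t (Suc i)) \<omega> $ j - W (t i) \<omega> $ j))"

definition increments_law :: "real ^ 'n \<Rightarrow> ('n \<Rightarrow> nat \<Rightarrow> real) measure" where
  "increments_law \<theta> = PiM UNIV (\<lambda>j. PiM {..<k} (\<lambda>i.
     density lborel (normal_density (\<theta> $ j * (t (Suc i) - t i)) (sqrt (t (Suc i) - t i)))))"

lemma grid_nonneg: "i \<le> k \<Longrightarrow> 0 \<le> t i"
proof (induction i)
  case (Suc i) then show ?case using t_less[of i] by simp
qed (simp add: t0)

lemma distr_drift_increments_component:
  "distr M (PiM {..<k} (\<lambda>_. borel)) (\<lambda>\<omega>. \<lambda>i\<in>{..<k}.
     \<theta> $ j * (t (Suc i) - t i) + (W (t (Suc i)) \<omega> $ j - W (t i) \<omega> $ j)) =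
   PiM {..<k} (\<lambda>i. density lborel (normal_density (\<theta> $ j * (t (Suc i) - t i)) (sqrt (t (Suc i) - t i))))"
proof -
  interpret B: brownian_motion M "\<lambda>t \<omega>. W t \<omega> $ j" by (rule component_brownian_motion)
  let ?X = "\<lambda>i \<omega>. \<theta> $ j * (t (Suc i) - t i) + (W (t (Suc i)) \<omega> $ j - W (t i) \<omega> $ j)"
  have dist: "distributed M lborel (?X i) (normal_density (\<theta> $ j * (t (Suc i) - t i)) (sqrt (t (Suc i) - t i)))"
    if "i < k" for i
    using normal_density_affine[OF B.normal_increments[of "t i" "t (Suc i)"], of 1 "\<theta> $ j * (t (Suc i) - t i)"]
      grid_nonneg[of i] t_less[OF that] that by simp
  have "indep_vars (\<lambda>_. borel) (\<lambda>i \<omega>. W (t (Suc i)) \<omega> $ j - W (t i) \<omega> $ j) {..<k}"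
    using B.independent_increments[of t k] t0 t_less by (auto intro: less_imp_le)
  then have "indep_vars (\<lambda>_. borel) ?X {..<k}"
    by (rule indep_vars_compose2[where Y="\<lambda>i x. \<theta> $ j * (t (Suc i) - t i) + x"]) measurable
  moreover have "random_variable borel (?X i)" if "i \<in> {..<k}" for i
    using grid_nonneg[of i] grid_nonneg[of "Suc i"] that
    by (intro borel_measurable_add borel_measurable_diff random_variable_component) auto
  ultimately have "distr M (PiM {..<k} (\<lambda>_. borel)) (\<lambda>\<omega>. \<lambda>i\<in>{..<k}. ?X i \<omega>) = PiM {..<k} (\<lambda>i. distr M borel (?X i))"
    using k by (subst (asm) indep_vars_iff_distr_eq_PiM') auto
  also have "\<dots> = PiM {..<k} (\<lambda>i. density lborel (normal_density (\<theta> $ j * (t (Suc i) - t i)) (sqrt (t (Suc i) - t i))))"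
  proof (rule PiM_cong)
    fix i assume "i \<in> {..<k}"
    then have "distr M lborel (?X i) = density lborel (normal_density (\<theta> $ j * (t (Suc i) - t i)) (sqrt (t (Suc i) - t i)))"
      by (intro distributed_distr_eq_density dist) auto
    moreover have "distr M lborel (?X i) = distr M borel (?X i)" by (rule distr_cong) auto
    ultimately show "distr M borel (?X i) = density lborel (normal_density (\<theta> $ j * (t (Suc i) - t i)) (sqrt (t (Suc i) - t i)))"
      by simp
  qed simp
  finally show ?thesis .
qed

lemma sets_increments_law: "sets (increments_law \<theta>) = sets (PiM UNIV (\<lambda>_. PiM {..<k} (\<lambda>_. borel)))"
  unfolding increments_law_def by (intro sets_PiM_cong) auto

lemma measurable_drift_increments:
  "drift_increments \<theta> \<in> measurable M (PiM UNIV (\<lambda>_. PiM {..<k} (\<lambda>_. borel)))"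
  unfolding drift_increments_def
  using grid_nonneg
  by (intro measurable_restrict borel_measurable_add borel_measurable_diff random_variable_component) auto

text \<open>The increments of a component are a measurable function of its whole path, so
  independence of the component processes passes to the blocks of increments; inside a block the
  product form is already known.\<close>

lemma distr_drift_increments:
  "distr M (PiM UNIV (\<lambda>_. PiM {..<k} (\<lambda>_. borel))) (drift_increments \<theta>) = increments_law \<theta>"
proof -
  let ?Y = "\<lambda>j p. \<lambda>i\<in>{..<k}. \<theta> $ j * (t (Suc i) - t i) + (p (t (Suc i)) - p (t i)) :: real"
  let ?X = "\<lambda>j \<omega>. \<lambda>i\<in>{..<k}. \<theta> $ j * (t (Suc i) - t i) + (W (t (Suc i)) \<omega> $ j - W (t i) \<omega> $ j)"
  have "indep_vars (\<lambda>_. PiM {..<k} (\<lambda>_. borel)) (\<lambda>j \<omega>. ?Y j (\<lambda>t\<in>{0..}. W t \<omega> $ j)) UNIV"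
  proof (rule indep_vars_compose2[OF independent_components])
    fix j :: 'n
    show "?Y j \<in> measurable (PiM {0..} (\<lambda>_. borel)) (PiM {..<k} (\<lambda>_. borel))"
      using grid_nonneg
      by (intro measurable_restrict borel_measurable_add borel_measurable_diff measurable_component_singleton borel_measurable_const) auto
  qed
  also have "(\<lambda>j \<omega>. ?Y j (\<lambda>t\<in>{0..}. W t \<omega> $ j)) = ?X"
    using grid_nonneg by (auto simp: fun_eq_iff restrict_def)
  finally have ind: "indep_vars (\<lambda>_. PiM {..<k} (\<lambda>_. borel)) ?X UNIV" .
  have rv: "random_variable (PiM {..<k} (\<lambda>_. borel)) (?X j)" for j
    using grid_nonneg
    by (intro measurable_restrict borel_measurable_add borel_measurable_diff random_variable_component) auto
  have "distr M (PiM UNIV (\<lambda>_. PiM {..<k} (\<lambda>_. borel))) (\<lambda>\<omega>. \<lambda>j\<in>UNIV. ?X j \<omega>) =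
      PiM UNIV (\<lambda>j. distr M (PiM {..<k} (\<lambda>_. borel)) (?X j))"
    using ind rv by (subst (asm) indep_vars_iff_distr_eq_PiM) auto
  then show ?thesis
    unfolding increments_law_def drift_increments_def distr_drift_increments_component .
qed

text \<open>\<open>PiM_density\<close> is applied twice, over the increments of each component and
  then over the components.\<close>

lemma increments_law_density:
  "increments_law \<theta> = density (increments_law 0)
     (\<lambda>d. \<Prod>j\<in>UNIV. \<Prod>i<k. ennreal (exp (\<theta> $ j * d j i - (\<theta> $ j)\<^sup>2 * (t (Suc i) - t i) / 2)))"
proof -
  \<comment> \<open>Indices beyond the grid get length 1, so that every factor is a probability
    measure; only indices below \<open>k\<close> enter the products.\<close>
  let ?\<delta> = "\<lambda>i. if i < k then t (Suc i) - t i else 1"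
  let ?N = "\<lambda>m i. density lborel (normal_density (m * ?\<delta> i) (sqrt (?\<delta> i)))"
  let ?f = "\<lambda>m i x. ennreal (exp (m * x - m\<^sup>2 * ?\<delta> i / 2))"
  have pos: "0 < ?\<delta> i" for i using t_less by simp
  have ps: "prob_space (?N m i)" for m i
    using prob_space_normal_density[of "sqrt (?\<delta> i)"] pos[of i] by simp
  note sf = prob_space_imp_sigma_finite[OF ps]
  have N: "?N m i = density (?N 0 i) (?f m i)" for m i
    using density_normal_shift[OF pos, of m i] by simp
  let ?P = "\<lambda>m. PiM {..<k} (?N m)"
  have psP: "prob_space (?P m)" for m by (intro prob_space_PiM ps)
  have P: "?P m = density (?P 0) (\<lambda>x. \<Prod>i<k. ?f m i (x i))" for m
  proof -
    have "?P m = PiM {..<k} (\<lambda>i. density (?N 0 i) (?f m i))" by (intro PiM_cong refl N)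
    also have "\<dots> = density (?P 0) (\<lambda>x. \<Prod>i<k. ?f m i (x i))"
      using sf by (intro PiM_density) (simp_all only: N[symmetric], simp_all)
    finally show ?thesis .
  qed
  have law: "increments_law \<theta> = PiM UNIV (\<lambda>j. ?P (\<theta> $ j))" for \<theta> :: "real ^ 'n"
    unfolding increments_law_def by (intro PiM_cong) auto
  have "increments_law \<theta> = PiM UNIV (\<lambda>j. density (?P 0) (\<lambda>x. \<Prod>i<k. ?f (\<theta> $ j) i (x i)))"
    unfolding law by (intro PiM_cong refl P)
  also have "\<dots> = density (PiM UNIV (\<lambda>_. ?P 0)) (\<lambda>d. \<Prod>j\<in>UNIV. (\<Prod>i<k. ?f (\<theta> $ j) i (d j i)))"
    by (intro PiM_density) (simp_all only: P[symmetric] prob_space_imp_sigma_finite[OF psP], simp_all)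
  also have "PiM UNIV (\<lambda>_. ?P 0) = increments_law 0"
    unfolding law by (intro PiM_cong) auto
  finally show ?thesis by simp
qed

text \<open>Adding the drift shifts the mean of every increment. In the product of the increment
  densities the linear terms telescope to the inner product of \<theta> with W at the last time and
  the quadratic ones to |\<theta>|^2 \<open>t k\<close> / 2, so the density depends on the end point
  only.\<close>

lemma cameron_martin_grid:
  fixes F :: "(nat \<Rightarrow> real ^ 'n) \<Rightarrow> ennreal"
  assumes F [measurable]: "F \<in> borel_measurable (PiM {..k} (\<lambda>_. borel))"
  shows "(\<integral>\<^sup>+\<omega>. F (\<lambda>i\<in>{..k}. W (t i) \<omega> + t i *\<^sub>R \<theta>) \<partial>M) =
    (\<integral>\<^sup>+\<omega>. F (\<lambda>i\<in>{..k}. W (t i) \<omega>) * ennreal (exp (\<theta> \<bullet> W (t k) \<omega> - (norm \<theta>)\<^sup>2 * t k / 2)) \<partial>M)"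
proof -
  let ?B = "PiM UNIV (\<lambda>_::'n. PiM {..<k} (\<lambda>_::nat. borel :: real measure))"
  \<comment> \<open>\<open>R\<close> rebuilds the grid values from the increments by partial sums.
    It returns W itself only when \<open>W 0 \<omega> = 0\<close>, which holds almost
    surely.\<close>
  define R where "R d = (\<lambda>i\<in>{..k}. (\<chi> j. \<Sum>l<i. d j l) :: real ^ 'n)" for d :: "'n \<Rightarrow> nat \<Rightarrow> real"
  have comp [measurable]: "(\<lambda>d. d j l) \<in> borel_measurable ?B" if "l < k" for j l
  proof -
    have "(\<lambda>d. d j) \<in> measurable ?B (PiM {..<k} (\<lambda>_::nat. borel :: real measure))"
      by (rule measurable_component_singleton) auto
    moreover have "(\<lambda>p. p l) \<in> measurable (PiM {..<k} (\<lambda>_::nat. borel :: real measure)) borel"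
      by (rule measurable_component_singleton) (use that in auto)
    ultimately show ?thesis by (rule measurable_compose)
  qed
  have R [measurable]: "R \<in> measurable ?B (PiM {..k} (\<lambda>_. borel))"
    unfolding R_def by (intro measurable_restrict measurable_vec_lambda borel_measurable_sum comp) auto
  have FR: "(\<lambda>d. F (R d)) \<in> borel_measurable ?B" by measurable
  have FR': "(\<lambda>d. F (R d)) \<in> borel_measurable (increments_law \<theta>)" for \<theta>
    by (subst measurable_cong_sets[OF sets_increments_law refl]) (rule FR)
  have rec: "R (drift_increments \<theta> \<omega>) = (\<lambda>i\<in>{..k}. W (t i) \<omega> + t i *\<^sub>R \<theta>)" if "W 0 \<omega> = 0" for \<theta> \<omega>
  proof -
    have "(\<Sum>l<i. drift_increments \<theta> \<omega> j l) = (W (t i) \<omega> + t i *\<^sub>R \<theta>) $ j" if "i \<le> k" for i j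
      using that
    proof (induction i)
      case 0 then show ?case using \<open>W 0 \<omega> = 0\<close> by (simp add: t0)
    next
      case (Suc i)
      then show ?case by (simp add: drift_increments_def algebra_simps)
    qed
    then show ?thesis by (auto simp: R_def restrict_def fun_eq_iff vec_eq_iff)
  qed
  have law: "(\<integral>\<^sup>+\<omega>. G (drift_increments \<theta> \<omega>) \<partial>M) = (\<integral>\<^sup>+d. G d \<partial>increments_law \<theta>)"
    if "G \<in> borel_measurable ?B" for G \<theta>
    unfolding distr_drift_increments[symmetric]
    by (rule nn_integral_distr[OF measurable_drift_increments, symmetric]) (use that in simp)
  have Z: "(\<Prod>j\<in>UNIV. \<Prod>i<k. ennreal (exp (\<theta> $ j * d j i - (\<theta> $ j)\<^sup>2 * (t (Suc i) - t i) / 2)))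
      = ennreal (exp (\<theta> \<bullet> R d k - (norm \<theta>)\<^sup>2 * t k / 2))" for d
  proof -
    have "(\<Sum>j\<in>UNIV. \<Sum>i<k. \<theta> $ j * d j i - (\<theta> $ j)\<^sup>2 * (t (Suc i) - t i) / 2)
        = (\<Sum>j\<in>UNIV. \<theta> $ j * (\<Sum>i<k. d j i) - (\<theta> $ j)\<^sup>2 * t k / 2)"
    proof (rule sum.cong)
      fix j :: 'n
      have "(\<Sum>i<k. (\<theta> $ j)\<^sup>2 * (t (Suc i) - t i) / 2) = (\<theta> $ j)\<^sup>2 * t k / 2"
        using sum_lessThan_telescope[of t k] t0
        by (simp add: sum_distrib_left[symmetric] sum_divide_distrib[symmetric])
      then show "(\<Sum>i<k. \<theta> $ j * d j i - (\<theta> $ j)\<^sup>2 * (t (Suc i) - t i) / 2)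
          = \<theta> $ j * (\<Sum>i<k. d j i) - (\<theta> $ j)\<^sup>2 * t k / 2"
        by (simp add: sum_subtractf sum_distrib_left)
    qed simp
    also have "\<dots> = \<theta> \<bullet> R d k - (norm \<theta>)\<^sup>2 * t k / 2"
    proof -
      have "(norm \<theta>)\<^sup>2 = (\<Sum>j\<in>UNIV. (\<theta> $ j)\<^sup>2)"
        unfolding power2_norm_eq_inner by (simp add: inner_vec_def power2_eq_square)
      then show ?thesis
        by (simp add: R_def inner_vec_def sum_subtractf sum_distrib_right sum_divide_distrib)
    qed
    finally show ?thesis
      by (simp add: prod_ennreal exp_sum[symmetric] prod_nonneg)
  qed
  have "(\<integral>\<^sup>+\<omega>. F (\<lambda>i\<in>{..k}. W (t i) \<omega> + t i *\<^sub>R \<theta>) \<partial>M) = (\<integral>\<^sup>+\<omega>. F (R (drift_increments \<theta> \<omega>)) \<partial>M)"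
    using AE_W_0 by (intro nn_integral_cong_AE) (auto simp: rec)
  also have "\<dots> = (\<integral>\<^sup>+d. F (R d) \<partial>increments_law \<theta>)" by (rule law[OF FR])
  also have "\<dots> = (\<integral>\<^sup>+d. (\<Prod>j\<in>UNIV. \<Prod>i<k. ennreal (exp (\<theta> $ j * d j i - (\<theta> $ j)\<^sup>2 * (t (Suc i) - t i) / 2))) * F (R d) \<partial>increments_law 0)"
  proof (subst increments_law_density, rule nn_integral_density)
    show "(\<lambda>d. \<Prod>j\<in>UNIV. \<Prod>i<k. ennreal (exp (\<theta> $ j * d j i - (\<theta> $ j)\<^sup>2 * (t (Suc i) - t i) / 2)))
        \<in> borel_measurable (increments_law 0)"
      unfolding measurable_cong_sets[OF sets_increments_law refl]
      using comp by (intro borel_measurable_prod_ennreal) auto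
  qed (rule FR')
  also have "\<dots> = (\<integral>\<^sup>+d. F (R d) * ennreal (exp (\<theta> \<bullet> R d k - (norm \<theta>)\<^sup>2 * t k / 2)) \<partial>increments_law 0)"
    unfolding Z by (simp add: mult.commute)
  also have "\<dots> = (\<integral>\<^sup>+\<omega>. F (R (drift_increments 0 \<omega>)) * ennreal (exp (\<theta> \<bullet> R (drift_increments 0 \<omega>) k - (norm \<theta>)\<^sup>2 * t k / 2)) \<partial>M)"
  proof (rule law[symmetric])
    have "(\<lambda>d. R d k) \<in> borel_measurable ?B"
      using measurable_compose[OF R measurable_component_singleton[of k "{..k}"]] by simp
    then show "(\<lambda>d. F (R d) * ennreal (exp (\<theta> \<bullet> R d k - (norm \<theta>)\<^sup>2 * t k / 2))) \<in> borel_measurable ?B"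
      using FR by measurable
  qed
  also have "\<dots> = (\<integral>\<^sup>+\<omega>. F (\<lambda>i\<in>{..k}. W (t i) \<omega>) * ennreal (exp (\<theta> \<bullet> W (t k) \<omega> - (norm \<theta>)\<^sup>2 * t k / 2)) \<partial>M)"
    using AE_W_0 by (intro nn_integral_cong_AE) (auto simp: rec)
  finally show ?thesis .
qed

end

end

section \<open>The Lebesgue mixture of constant drifts\<close>

text \<open>Up to the constant on the right, the integrand is the normal density with mean v / t and
  standard deviation 1 / sqrt t.\<close>

lemma nn_integral_exp_linear_minus_square:
  fixes v t :: real
  assumes "0 < t"
  shows "(\<integral>\<^sup>+x. ennreal (exp (x * v - t * x\<^sup>2 / 2)) \<partial>lborel) = ennreal (sqrt (2 * pi / t) * exp (v\<^sup>2 / (2 * t)))"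
proof -
  let ?nd = "normal_density (v / t) (1 / sqrt t)"
  have eq: "exp (x * v - t * x\<^sup>2 / 2) = sqrt (2 * pi / t) * exp (v\<^sup>2 / (2 * t)) * ?nd x" for x
  proof -
    have "x * v - t * x\<^sup>2 / 2 = v\<^sup>2 / (2 * t) + - (x - v / t)\<^sup>2 / (2 * (1 / sqrt t)\<^sup>2)"
      using assms by (simp add: field_simps power2_eq_square)
    then have e: "exp (x * v - t * x\<^sup>2 / 2) = exp (v\<^sup>2 / (2 * t)) * exp (- (x - v / t)\<^sup>2 / (2 * (1 / sqrt t)\<^sup>2))"
      by (simp only: exp_add)
    have K: "sqrt (2 * pi / t) * (1 / sqrt (2 * pi * (1 / sqrt t)\<^sup>2)) = 1"
      using assms by (simp add: power_divide)
    have "sqrt (2 * pi / t) * exp (v\<^sup>2 / (2 * t)) * ?nd x =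
        (sqrt (2 * pi / t) * (1 / sqrt (2 * pi * (1 / sqrt t)\<^sup>2))) *
        (exp (v\<^sup>2 / (2 * t)) * exp (- (x - v / t)\<^sup>2 / (2 * (1 / sqrt t)\<^sup>2)))"
      unfolding normal_density_def by (simp only: mult_ac)
    then show ?thesis unfolding K e by simp
  qed
  have "(\<integral>\<^sup>+x. ennreal (exp (x * v - t * x\<^sup>2 / 2)) \<partial>lborel)
      = (\<integral>\<^sup>+x. ennreal (sqrt (2 * pi / t) * exp (v\<^sup>2 / (2 * t))) * ennreal (?nd x) \<partial>lborel)"
    using assms by (simp add: eq ennreal_mult)
  also have "\<dots> = ennreal (sqrt (2 * pi / t) * exp (v\<^sup>2 / (2 * t))) * (\<integral>\<^sup>+x. ennreal (?nd x) \<partial>lborel)"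
    by (rule nn_integral_cmult) simp
  also have "(\<integral>\<^sup>+x. ennreal (?nd x) \<partial>lborel) = 1"
    using assms by (subst nn_integral_eq_integral) auto
  finally show ?thesis by simp
qed

lemma sqrt_power_eq_powr:
  assumes "0 < x" shows "sqrt x ^ n = x powr (real n / 2)"
proof -
  have "sqrt x ^ n = (x powr (1 / 2)) powr real n"
    using assms by (simp add: powr_half_sqrt powr_realpow)
  then show ?thesis by (simp add: powr_powr)
qed

text \<open>The integral factorizes over the coordinates. For w = W_t the integrand is the
  Cameron-Martin density of the drift \<theta>, hence the value is the density of the whole mixture
  at time t.\<close>

lemma gaussian_nn_integral:
  fixes w :: "'v::euclidean_space"
  assumes "0 < t"
  shows "(\<integral>\<^sup>+\<theta>. ennreal (exp (\<theta> \<bullet> w - t * (norm \<theta>)\<^sup>2 / 2)) \<partial>lborel) =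
    ennreal ((2 * pi / t) powr (real DIM('v) / 2) * exp ((norm w)\<^sup>2 / (2 * t)))"
proof -
  have "exp (\<theta> \<bullet> w - t * (norm \<theta>)\<^sup>2 / 2) = (\<Prod>b\<in>Basis. exp ((\<theta> \<bullet> b) * (w \<bullet> b) - t * (\<theta> \<bullet> b)\<^sup>2 / 2))" for \<theta> :: 'v
    unfolding exp_sum[OF finite_Basis, symmetric] euclidean_inner[of \<theta> w] norm_eq_sqrt_inner euclidean_inner[of \<theta> \<theta>]
    by (simp add: sum_nonneg sum_subtractf sum_distrib_left sum_divide_distrib power2_eq_square)
  then have "(\<integral>\<^sup>+\<theta>. ennreal (exp (\<theta> \<bullet> w - t * (norm \<theta>)\<^sup>2 / 2)) \<partial>lborel)
      = (\<integral>\<^sup>+\<theta>. (\<Prod>b\<in>Basis. ennreal (exp ((\<theta> \<bullet> b) * (w \<bullet> b) - t * (\<theta> \<bullet> b)\<^sup>2 / 2))) \<partial>(lborel :: 'v measure))"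
    by (simp add: prod_ennreal)
  also have "\<dots> = (\<Prod>b\<in>Basis. \<integral>\<^sup>+x. ennreal (exp (x * (w \<bullet> b) - t * x\<^sup>2 / 2)) \<partial>lborel)"
    by (rule nn_integral_lborel_prod) auto
  also have "\<dots> = ennreal (\<Prod>b\<in>Basis. sqrt (2 * pi / t) * exp ((w \<bullet> b)\<^sup>2 / (2 * t)))"
    using assms by (simp add: nn_integral_exp_linear_minus_square prod_ennreal)
  also have "(\<Prod>b\<in>Basis. sqrt (2 * pi / t) * exp ((w \<bullet> b)\<^sup>2 / (2 * t)))
      = sqrt (2 * pi / t) ^ DIM('v) * exp (\<Sum>b\<in>Basis. (w \<bullet> b)\<^sup>2 / (2 * t))"
    by (simp only: prod.distrib exp_sum[OF finite_Basis] prod_constant)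
  also have "(\<Sum>b\<in>Basis. (w \<bullet> b)\<^sup>2 / (2 * t)) = (norm w)\<^sup>2 / (2 * t)"
    unfolding norm_eq_sqrt_inner euclidean_inner[of w w]
    by (simp add: sum_nonneg sum_divide_distrib power2_eq_square)
  also have "sqrt (2 * pi / t) ^ DIM('v) = (2 * pi / t) powr (real DIM('v) / 2)"
    using assms by (intro sqrt_power_eq_powr) auto
  finally show ?thesis .
qed

section \<open>Dyadic grids and the first hitting of an open set of times\<close>

definition dyadic_grid :: "real \<Rightarrow> real \<Rightarrow> nat \<Rightarrow> nat \<Rightarrow> real" where
  "dyadic_grid a b N k = a + (b - a) * real k / 2 ^ N"

lemma dyadic_grid_0 [simp]: "dyadic_grid a b N 0 = a"
  by (simp add: dyadic_grid_def)

lemma dyadic_grid_less: "a < b \<Longrightarrow> dyadic_grid a b N k < dyadic_grid a b N (Suc k)"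
  by (simp add: dyadic_grid_def divide_strict_right_mono)

lemma dyadic_grid_mono: "a < b \<Longrightarrow> i \<le> j \<Longrightarrow> dyadic_grid a b N i \<le> dyadic_grid a b N j"
  by (simp add: dyadic_grid_def divide_right_mono)

lemma dyadic_grid_in: "a < b \<Longrightarrow> k \<le> 2 ^ N \<Longrightarrow> dyadic_grid a b N k \<in> {a..b}"
proof -
  assume *: "a < b" "k \<le> 2 ^ N"
  have "dyadic_grid a b N (2 ^ N) = b" by (simp add: dyadic_grid_def)
  then show ?thesis using dyadic_grid_mono[OF *(1) *(2), of N] dyadic_grid_mono[OF *(1), of 0 k N] by auto
qed

lemma dyadic_grid_below:
  assumes "a < b" "s \<in> {a..b}"
  obtains k where "k \<le> 2 ^ N" "dyadic_grid a b N k \<le> s" "s - dyadic_grid a b N k < (b - a) / 2 ^ N"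
proof
  define y where "y = (s - a) / (b - a) * 2 ^ N"
  let ?k = "nat \<lfloor>y\<rfloor>"
  have y: "0 \<le> y" "y \<le> 2 ^ N" using assms by (auto simp: y_def divide_simps)
  have k: "real ?k \<le> y" "y < real ?k + 1" using y by linarith+
  have s: "s = a + (b - a) * y / 2 ^ N" using assms by (simp add: y_def)
  have "real ?k \<le> real (2 ^ N)" using k(1) y(2) unfolding of_nat_power of_nat_numeral by (rule order_trans)
  then show "?k \<le> 2 ^ N" using of_nat_le_iff by blast
  show "dyadic_grid a b N ?k \<le> s"
    unfolding s dyadic_grid_def using k(1) assms(1) by (simp add: divide_right_mono)
  have "s - dyadic_grid a b N ?k = (b - a) * (y - real ?k) / 2 ^ N"
    unfolding s dyadic_grid_def by (simp add: field_simps)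
  also have "\<dots> < (b - a) * 1 / 2 ^ N"
    using k(2) assms(1) by (intro divide_strict_right_mono mult_strict_left_mono) auto
  finally show "s - dyadic_grid a b N ?k < (b - a) / 2 ^ N" by simp
qed

text \<open>At most one index qualifies, so a sum weighted by \<open>of_bool (first_at C k)\<close>
  evaluates its summand at the first hit, or vanishes.\<close>

definition first_at :: "(nat \<Rightarrow> bool) \<Rightarrow> nat \<Rightarrow> bool" where
  "first_at C k \<longleftrightarrow> (\<forall>i<k. \<not> C i) \<and> C k"

lemma first_at_unique: "first_at C j \<Longrightarrow> first_at C k \<longleftrightarrow> k = j"
  unfolding first_at_def by (metis linorder_neqE_nat)

text \<open>The first grid points in a relatively open set decrease to the infimum of that set, because
  every neighbourhood of a point of the set contains points of all fine grids.\<close>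

lemma first_dyadic_crossing_limit:
  fixes C :: "real \<Rightarrow> bool" and h :: "real \<Rightarrow> real"
  assumes ab: "a < b"
    and op: "\<And>s. s \<in> {a..b} \<Longrightarrow> C s \<Longrightarrow> \<exists>e>0. \<forall>t\<in>{a..b}. \<bar>t - s\<bar> < e \<longrightarrow> C t"
    and h: "continuous_on {a..b} h"
  shows "(\<lambda>N. \<Sum>k\<in>{1..2 ^ N}. of_bool (first_at (\<lambda>k. C (dyadic_grid a b N k)) k) * h (dyadic_grid a b N k))
    \<longlonglongrightarrow> (if \<not> C a \<and> (\<exists>t\<in>{a..b}. C t) then h (Inf {t\<in>{a..b}. C t}) else 0)"
proof (cases "\<not> C a \<and> (\<exists>t\<in>{a..b}. C t)")
  case False
  have zero: "(\<Sum>k\<in>{1..2 ^ N}. of_bool (first_at (\<lambda>k. C (dyadic_grid a b N k)) k) * h (dyadic_grid a b N k)) = 0" for N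
  proof (rule sum.neutral, rule ballI)
    fix k :: nat assume k: "k \<in> {1..2 ^ N}"
    \<comment> \<open>If the set is empty, no index is hit; if it contains a, index 0 is hit, and
      the sum, which starts at 1, misses the first hit.\<close>
    have "\<not> first_at (\<lambda>k. C (dyadic_grid a b N k)) k"
      using False dyadic_grid_in[OF ab, of k N] k unfolding first_at_def
      by (metis atLeastAtMost_iff dyadic_grid_0 less_numeral_extra(1) order_less_le_trans)
    then show "of_bool (first_at (\<lambda>k. C (dyadic_grid a b N k)) k) * h (dyadic_grid a b N k) = 0" by simp
  qed
  show ?thesis unfolding zero if_not_P[OF False] by (rule tendsto_const)
next
  case True
  let ?U = "{t\<in>{a..b}. C t}"
  define \<tau> where "\<tau> = Inf ?U"
  have ne: "?U \<noteq> {}" and bdd: "bdd_below ?U" using True by (auto intro!: bdd_belowI[of _ a])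
  have low: "\<tau> \<le> t" if "t \<in> ?U" for t unfolding \<tau>_def by (rule cInf_lower[OF that bdd])
  have \<tau>: "\<tau> \<in> {a..b}"
    using ne low unfolding \<tau>_def by (auto intro!: cInf_greatest intro: order_trans)
  have "(\<lambda>N. \<Sum>k\<in>{1..2 ^ N}. of_bool (first_at (\<lambda>k. C (dyadic_grid a b N k)) k) * h (dyadic_grid a b N k)) \<longlonglongrightarrow> h \<tau>"
  proof (rule LIMSEQ_I)
    fix \<epsilon> :: real assume "0 < \<epsilon>"
    then obtain \<eta> where \<eta>: "0 < \<eta>" "\<And>t. t \<in> {a..b} \<Longrightarrow> \<bar>t - \<tau>\<bar> < \<eta> \<Longrightarrow> \<bar>h t - h \<tau>\<bar> < \<epsilon>"
      using h \<tau> unfolding continuous_on_iff dist_real_def by metis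
    \<comment> \<open>A member of the set close to \<open>\<tau>\<close>. Once the mesh is below the
      radius \<open>e\<close> of a neighbourhood of \<open>s\<close>, a grid point just before or at
      \<open>s\<close> is hit, which traps the first grid hit between \<open>\<tau>\<close> and
      \<open>s\<close>.\<close>
    obtain s where s: "s \<in> ?U" "s < \<tau> + \<eta>"
      using cInf_lessD[OF ne, of "\<tau> + \<eta>"] \<eta>(1) unfolding \<tau>_def by auto
    obtain e where e: "0 < e" "\<And>t. t \<in> {a..b} \<Longrightarrow> \<bar>t - s\<bar> < e \<Longrightarrow> C t"
      using op[of s] s by auto
    have "(\<lambda>N. (b - a) / 2 ^ N) \<longlonglongrightarrow> 0"
      using LIMSEQ_divide_realpow_zero[of 2 "b - a"] by simp
    from order_tendstoD(2)[OF this e(1)]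
    obtain N0 where N0: "\<And>N. N \<ge> N0 \<Longrightarrow> (b - a) / 2 ^ N < e"
      unfolding eventually_sequentially by blast
    show "\<exists>N0. \<forall>N\<ge>N0. norm ((\<Sum>k\<in>{1..2 ^ N}. of_bool (first_at (\<lambda>k. C (dyadic_grid a b N k)) k) * h (dyadic_grid a b N k)) - h \<tau>) < \<epsilon>"
    proof (intro exI allI impI)
      fix N assume "N0 \<le> N"
      let ?C = "\<lambda>k. C (dyadic_grid a b N k)"
      obtain k where k: "k \<le> 2 ^ N" "dyadic_grid a b N k \<le> s" "s - dyadic_grid a b N k < (b - a) / 2 ^ N"
        using dyadic_grid_below[OF ab, of s N] s by auto
      have "?C k" using k N0[OF \<open>N0 \<le> N\<close>] by (intro e(2) dyadic_grid_in ab) auto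
      then obtain j where j: "first_at ?C j" "j \<le> k"
        unfolding first_at_def using exists_least_lemma[of ?C] LeastI[of ?C k] Least_le[of ?C k] not_less_Least[of _ ?C]
        by blast
      have "j \<noteq> 0"
      proof
        assume "j = 0"
        then show False using j True by (simp add: first_at_def)
      qed
      then have jN: "j \<in> {1..2 ^ N}" using j(2) k(1) by auto
      have jU: "dyadic_grid a b N j \<in> ?U" using j jN dyadic_grid_in[OF ab, of j N] by (auto simp: first_at_def)
      have "dyadic_grid a b N j \<le> s" using dyadic_grid_mono[OF ab j(2), of N] k(2) by simp
      then have "\<bar>h (dyadic_grid a b N j) - h \<tau>\<bar> < \<epsilon>"
        using low[OF jU] s(2) jU by (intro \<eta>(2)) auto
      moreover have "(\<Sum>k\<in>{1..2 ^ N}. of_bool (first_at ?C k) * h (dyadic_grid a b N k)) = h (dyadic_grid a b N j)"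
      proof -
        have "(\<Sum>k\<in>{1..2 ^ N}. of_bool (first_at ?C k) * h (dyadic_grid a b N k))
            = (\<Sum>k\<in>{1..2 ^ N}. if k = j then h (dyadic_grid a b N k) else 0)"
          by (intro sum.cong) (auto simp: first_at_unique[OF j(1)])
        then show ?thesis using jN by simp
      qed
      ultimately show "norm ((\<Sum>k\<in>{1..2 ^ N}. of_bool (first_at ?C k) * h (dyadic_grid a b N k)) - h \<tau>) < \<epsilon>"
        by simp
    qed
  qed
  then show ?thesis using True by (simp add: \<tau>_def)
qed

section \<open>The mixture identity on a grid and Gaussian moments\<close>

context multi_brownian_motion
begin

text \<open>After Cameron-Martin the integral over \<theta> acts on the exponential alone and gives
  the mixture density at \<open>t k\<close>. The weight is the reciprocal of that density up to the
  factor (2 pi)^(n/2), so the two cancel for any nonnegative measurable functional \<open>F\<close>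
  of the grid values.\<close>

lemma mixture_identity_grid:
  fixes F :: "(nat \<Rightarrow> real ^ 'n) \<Rightarrow> ennreal"
  assumes t: "t 0 = 0" "\<And>i. i < k \<Longrightarrow> t i < t (Suc i)" "0 < k"
    and F [measurable]: "F \<in> borel_measurable (PiM {..k} (\<lambda>_. borel))"
  shows "(\<integral>\<^sup>+\<theta>. \<integral>\<^sup>+\<omega>. F (\<lambda>i\<in>{..k}. W (t i) \<omega> + t i *\<^sub>R \<theta>) *
      ennreal (t k powr (CARD('n) / 2) * exp (- (norm (W (t k) \<omega> + t k *\<^sub>R \<theta>))\<^sup>2 / (2 * t k))) \<partial>M \<partial>lborel) =
    ennreal ((2 * pi) powr (CARD('n) / 2)) * (\<integral>\<^sup>+\<omega>. F (\<lambda>i\<in>{..k}. W (t i) \<omega>) \<partial>M)"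
proof -
  interpret P: pair_sigma_finite lborel M ..
  have pos: "0 \<le> t i" if "i \<le> k" for i using grid_nonneg[OF t that] .
  have tk: "0 < t k" using pos[of "k - 1"] t(2)[of "k - 1"] t(3) by simp
  have FW [measurable]: "(\<lambda>\<omega>. F (\<lambda>i\<in>{..k}. W (t i) \<omega>)) \<in> borel_measurable M"
    by (rule measurable_compose[OF _ F]) (use pos in \<open>intro measurable_restrict random_variable_W, auto\<close>)
  have Wk [measurable]: "W (t k) \<in> borel_measurable M" using tk by simp
  let ?h = "\<lambda>w::real^'n. ennreal (t k powr (CARD('n) / 2) * exp (- (norm w)\<^sup>2 / (2 * t k)))"
  have "(\<integral>\<^sup>+\<omega>. F (\<lambda>i\<in>{..k}. W (t i) \<omega> + t i *\<^sub>R \<theta>) * ?h (W (t k) \<omega> + t k *\<^sub>R \<theta>) \<partial>M)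
      = (\<integral>\<^sup>+\<omega>. F (\<lambda>i\<in>{..k}. W (t i) \<omega>) * ?h (W (t k) \<omega>) * ennreal (exp (\<theta> \<bullet> W (t k) \<omega> - t k * (norm \<theta>)\<^sup>2 / 2)) \<partial>M)" for \<theta>
  proof -
    have "(\<lambda>p. F p * ?h (p k)) \<in> borel_measurable (PiM {..k} (\<lambda>_. borel))" by measurable
    from cameron_martin_grid[OF t this, of \<theta>] show ?thesis by (simp add: mult.commute[of "t k"])
  qed
  then have "(\<integral>\<^sup>+\<theta>. \<integral>\<^sup>+\<omega>. F (\<lambda>i\<in>{..k}. W (t i) \<omega> + t i *\<^sub>R \<theta>) * ?h (W (t k) \<omega> + t k *\<^sub>R \<theta>) \<partial>M \<partial>lborel)
    = (\<integral>\<^sup>+\<theta>. \<integral>\<^sup>+\<omega>. F (\<lambda>i\<in>{..k}. W (t i) \<omega>) * ?h (W (t k) \<omega>) * ennreal (exp (\<theta> \<bullet> W (t k) \<omega> - t k * (norm \<theta>)\<^sup>2 / 2)) \<partial>M \<partial>lborel)"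
    by simp
  also have "\<dots> = (\<integral>\<^sup>+\<omega>. \<integral>\<^sup>+\<theta>. F (\<lambda>i\<in>{..k}. W (t i) \<omega>) * ?h (W (t k) \<omega>) * ennreal (exp (\<theta> \<bullet> W (t k) \<omega> - t k * (norm \<theta>)\<^sup>2 / 2)) \<partial>lborel \<partial>M)"
    by (rule P.Fubini'[symmetric]) measurable
  also have "\<dots> = (\<integral>\<^sup>+\<omega>. ennreal ((2 * pi) powr (CARD('n) / 2)) * F (\<lambda>i\<in>{..k}. W (t i) \<omega>) \<partial>M)"
  proof (rule nn_integral_cong)
    fix \<omega>
    have "(\<integral>\<^sup>+\<theta>. F (\<lambda>i\<in>{..k}. W (t i) \<omega>) * ?h (W (t k) \<omega>) * ennreal (exp (\<theta> \<bullet> W (t k) \<omega> - t k * (norm \<theta>)\<^sup>2 / 2)) \<partial>lborel)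
      = F (\<lambda>i\<in>{..k}. W (t i) \<omega>) * (?h (W (t k) \<omega>) * ennreal ((2 * pi / t k) powr (CARD('n) / 2) * exp ((norm (W (t k) \<omega>))\<^sup>2 / (2 * t k))))"
      by (subst nn_integral_cmult) (simp_all add: gaussian_nn_integral[OF tk] mult.assoc)
    also have "?h (W (t k) \<omega>) * ennreal ((2 * pi / t k) powr (CARD('n) / 2) * exp ((norm (W (t k) \<omega>))\<^sup>2 / (2 * t k)))
        = ennreal ((2 * pi) powr (CARD('n) / 2))"
    proof -
      have "t k powr (CARD('n) / 2) * exp (- (norm (W (t k) \<omega>))\<^sup>2 / (2 * t k)) *
          ((2 * pi / t k) powr (CARD('n) / 2) * exp ((norm (W (t k) \<omega>))\<^sup>2 / (2 * t k)))
          = (t k powr (CARD('n) / 2) * (2 * pi / t k) powr (CARD('n) / 2)) *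
            (exp (- (norm (W (t k) \<omega>))\<^sup>2 / (2 * t k)) * exp ((norm (W (t k) \<omega>))\<^sup>2 / (2 * t k)))"
        by (simp only: mult_ac)
      also have "\<dots> = (2 * pi) powr (CARD('n) / 2)"
        using tk by (simp add: powr_mult[symmetric] exp_add[symmetric])
      finally show ?thesis by (subst ennreal_mult[symmetric]) auto
    qed
    finally show "(\<integral>\<^sup>+\<theta>. F (\<lambda>i\<in>{..k}. W (t i) \<omega>) * ?h (W (t k) \<omega>) * ennreal (exp (\<theta> \<bullet> W (t k) \<omega> - t k * (norm \<theta>)\<^sup>2 / 2)) \<partial>lborel)
      = ennreal ((2 * pi) powr (CARD('n) / 2)) * F (\<lambda>i\<in>{..k}. W (t i) \<omega>)" by (simp only: mult.commute)
  qed
  also have "\<dots> = ennreal ((2 * pi) powr (CARD('n) / 2)) * (\<integral>\<^sup>+\<omega>. F (\<lambda>i\<in>{..k}. W (t i) \<omega>) \<partial>M)"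
    by (rule nn_integral_cmult) measurable
  finally show ?thesis .
qed

text \<open>The changed measure has total mass one: this is Cameron-Martin on the grid {0, a} with
  \<open>F\<close> equal to 1.\<close>

lemma nn_integral_exp_inner:
  assumes "0 < a"
  shows "(\<integral>\<^sup>+\<omega>. ennreal (exp (\<theta> \<bullet> W a \<omega>)) \<partial>M) = ennreal (exp (a * (norm \<theta>)\<^sup>2 / 2))"
proof -
  let ?t = "\<lambda>i::nat. if i = 0 then 0 else a"
  have [measurable]: "W a \<in> borel_measurable M" using assms by simp
  have "1 = (\<integral>\<^sup>+\<omega>. ennreal (exp (\<theta> \<bullet> W a \<omega> - (norm \<theta>)\<^sup>2 * a / 2)) \<partial>M)"
    using cameron_martin_grid[of ?t 1 "\<lambda>_. 1" \<theta>] assms by (simp add: emeasure_space_1)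
  also have "\<dots> = (\<integral>\<^sup>+\<omega>. ennreal (exp (- (a * (norm \<theta>)\<^sup>2 / 2))) * ennreal (exp (\<theta> \<bullet> W a \<omega>)) \<partial>M)"
    by (simp add: ennreal_mult[symmetric] exp_add[symmetric] mult.commute)
  also have "\<dots> = ennreal (exp (- (a * (norm \<theta>)\<^sup>2 / 2))) * (\<integral>\<^sup>+\<omega>. ennreal (exp (\<theta> \<bullet> W a \<omega>)) \<partial>M)"
    by (rule nn_integral_cmult) measurable
  finally have "ennreal (exp (a * (norm \<theta>)\<^sup>2 / 2)) * 1 =
      ennreal (exp (a * (norm \<theta>)\<^sup>2 / 2)) * (ennreal (exp (- (a * (norm \<theta>)\<^sup>2 / 2))) * (\<integral>\<^sup>+\<omega>. ennreal (exp (\<theta> \<bullet> W a \<omega>)) \<partial>M))"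
    by simp
  also have "\<dots> = (\<integral>\<^sup>+\<omega>. ennreal (exp (\<theta> \<bullet> W a \<omega>)) \<partial>M)"
    by (subst mult.assoc[symmetric], subst ennreal_mult[symmetric]) (simp_all add: exp_add[symmetric])
  finally show ?thesis by simp
qed

text \<open>The square is linearized: exp (|w|^2 / (2 \<kappa>)) is a multiple of a Gaussian
  integral over \<theta> of exponentials linear in w. After Fubini a Gaussian integral with \<kappa>
  - a in place of \<kappa> remains, which is where a < \<kappa> enters.\<close>

lemma nn_integral_exp_square:
  assumes "0 < a" "a < \<kappa>"
  shows "(\<integral>\<^sup>+\<omega>. ennreal (exp ((norm (W a \<omega>))\<^sup>2 / (2 * \<kappa>))) \<partial>M) = ennreal ((\<kappa> / (\<kappa> - a)) powr (CARD('n) / 2))"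
proof -
  interpret P: pair_sigma_finite lborel M ..
  have [measurable]: "W a \<in> borel_measurable M" using assms by simp
  let ?c = "(2 * pi / \<kappa>) powr (CARD('n) / 2)"
  have c: "0 < ?c" using assms by simp
  have "ennreal ?c * (\<integral>\<^sup>+\<omega>. ennreal (exp ((norm (W a \<omega>))\<^sup>2 / (2 * \<kappa>))) \<partial>M)
      = (\<integral>\<^sup>+\<omega>. \<integral>\<^sup>+\<theta>. ennreal (exp (\<theta> \<bullet> W a \<omega> - \<kappa> * (norm \<theta>)\<^sup>2 / 2)) \<partial>lborel \<partial>M)"
    using assms by (simp add: gaussian_nn_integral ennreal_mult nn_integral_cmult)
  also have "\<dots> = (\<integral>\<^sup>+\<theta>. \<integral>\<^sup>+\<omega>. ennreal (exp (\<theta> \<bullet> W a \<omega> - \<kappa> * (norm \<theta>)\<^sup>2 / 2)) \<partial>M \<partial>lborel)"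
    by (rule P.Fubini') measurable
  also have "\<dots> = (\<integral>\<^sup>+\<theta>. ennreal (exp (\<theta> \<bullet> (0::real^'n) - (\<kappa> - a) * (norm \<theta>)\<^sup>2 / 2)) \<partial>lborel)"
  proof (rule nn_integral_cong)
    fix \<theta> :: "real ^ 'n"
    have "(\<integral>\<^sup>+\<omega>. ennreal (exp (\<theta> \<bullet> W a \<omega> - \<kappa> * (norm \<theta>)\<^sup>2 / 2)) \<partial>M)
      = (\<integral>\<^sup>+\<omega>. ennreal (exp (- \<kappa> * (norm \<theta>)\<^sup>2 / 2)) * ennreal (exp (\<theta> \<bullet> W a \<omega>)) \<partial>M)"
      by (simp add: ennreal_mult[symmetric] exp_add[symmetric])
    also have "\<dots> = ennreal (exp (- \<kappa> * (norm \<theta>)\<^sup>2 / 2)) * ennreal (exp (a * (norm \<theta>)\<^sup>2 / 2))"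
      by (subst nn_integral_cmult) (simp_all add: nn_integral_exp_inner[OF assms(1)])
    also have "\<dots> = ennreal (exp (\<theta> \<bullet> 0 - (\<kappa> - a) * (norm \<theta>)\<^sup>2 / 2))"
      by (simp add: ennreal_mult[symmetric] exp_add[symmetric] field_simps)
    finally show "(\<integral>\<^sup>+\<omega>. ennreal (exp (\<theta> \<bullet> W a \<omega> - \<kappa> * (norm \<theta>)\<^sup>2 / 2)) \<partial>M) = ennreal (exp (\<theta> \<bullet> 0 - (\<kappa> - a) * (norm \<theta>)\<^sup>2 / 2))" .
  qed
  also have "\<dots> = ennreal ((2 * pi / (\<kappa> - a)) powr (CARD('n) / 2))"
    using assms by (subst gaussian_nn_integral) auto
  also have "(2 * pi / (\<kappa> - a)) powr (CARD('n) / 2) = ?c * (\<kappa> / (\<kappa> - a)) powr (CARD('n) / 2)"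
    using assms by (simp add: powr_mult[symmetric])
  finally have "ennreal ?c * (\<integral>\<^sup>+\<omega>. ennreal (exp ((norm (W a \<omega>))\<^sup>2 / (2 * \<kappa>))) \<partial>M)
      = ennreal ?c * ennreal ((\<kappa> / (\<kappa> - a)) powr (CARD('n) / 2))" by (simp add: ennreal_mult)
  then show ?thesis using c by (simp add: ennreal_mult_cancel_left)
qed

lemma chi_square_tail:
  assumes "0 < a" "1 < c"
  shows "measure M {\<omega>\<in>space M. a * c < (norm (W a \<omega>))\<^sup>2} \<le> exp (1 / 2) * c powr (CARD('n) / 2) * exp (- c / 2)"
proof -
  have [measurable]: "W a \<in> borel_measurable M" using assms by simp
  \<comment> \<open>With this \<kappa> the exponential moment is exactly c^(n/2) and the threshold
    in Markov's inequality is exp ((c - 1) / 2), which yields the order c^(n/2) exp (- c / 2). The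
    condition 1 < c makes \<kappa> positive.\<close>
  define \<kappa> where "\<kappa> = a / (1 - 1 / c)"
  have \<kappa>: "a < \<kappa>" "0 < \<kappa>" using assms by (auto simp: \<kappa>_def field_simps)
  let ?A = "{\<omega>\<in>space M. a * c < (norm (W a \<omega>))\<^sup>2}"
  have "ennreal (exp ((c - 1) / 2)) * emeasure M ?A = (\<integral>\<^sup>+\<omega>. ennreal (exp ((c - 1) / 2)) * indicator ?A \<omega> \<partial>M)"
    by (subst nn_integral_cmult_indicator) auto
  also have "\<dots> \<le> (\<integral>\<^sup>+\<omega>. ennreal (exp ((norm (W a \<omega>))\<^sup>2 / (2 * \<kappa>))) \<partial>M)"
  proof (rule nn_integral_mono)
    fix \<omega>
    have "(c - 1) / 2 \<le> (norm (W a \<omega>))\<^sup>2 / (2 * \<kappa>)" if "a * c < (norm (W a \<omega>))\<^sup>2"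
    proof -
      have "(c - 1) / 2 = (a * c) / (2 * \<kappa>)" using assms by (simp add: \<kappa>_def field_simps)
      also have "\<dots> \<le> (norm (W a \<omega>))\<^sup>2 / (2 * \<kappa>)" using that \<kappa> by (intro divide_right_mono) auto
      finally show ?thesis .
    qed
    then show "ennreal (exp ((c - 1) / 2)) * indicator ?A \<omega> \<le> ennreal (exp ((norm (W a \<omega>))\<^sup>2 / (2 * \<kappa>)))"
      by (auto simp: indicator_def intro!: ennreal_leI)
  qed
  also have "\<dots> = ennreal ((\<kappa> / (\<kappa> - a)) powr (CARD('n) / 2))" using nn_integral_exp_square assms \<kappa> by simp
  also have "\<kappa> / (\<kappa> - a) = c"
    using assms \<kappa> by (simp add: \<kappa>_def field_simps)
  finally have "ennreal (exp ((c - 1) / 2) * measure M ?A) \<le> ennreal (c powr (CARD('n) / 2))"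
    by (simp add: emeasure_eq_measure ennreal_mult)
  then have "exp ((c - 1) / 2) * measure M ?A \<le> c powr (CARD('n) / 2)" by (simp add: ennreal_le_iff)
  then have "measure M ?A \<le> c powr (CARD('n) / 2) * exp (- ((c - 1) / 2))"
    by (simp add: exp_minus field_simps)
  also have "exp (- ((c - 1) / 2)) = exp (1 / 2) * exp (- c / 2)"
    by (simp add: exp_add[symmetric] field_simps)
  finally show ?thesis by (simp add: mult_ac)
qed

end

section \<open>First crossings of a continuous boundary\<close>

text \<open>For t > 0 this is c t < |x t|^2 / t, cleared of the division. Strictness makes the
  crossing times of a continuous path relatively open, on which the grid approximation
  relies.\<close>

definition crosses :: "(real \<Rightarrow> real) \<Rightarrow> (real \<Rightarrow> 'v::real_normed_vector) \<Rightarrow> real \<Rightarrow> bool" where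
  "crosses c x t \<longleftrightarrow> t * c t < (norm (x t))\<^sup>2"

text \<open>At the first crossing \<tau> one has |x \<tau>|^2 = \<tau> c(\<tau>), so for p = n/2
  this is the reciprocal of the mixture density at \<tau>, up to (2 pi)^(n/2). Paths already across
  at a get weight 0, since for them the equality at \<tau> = a fails.\<close>

definition crossing_weight :: "(real \<Rightarrow> real) \<Rightarrow> real \<Rightarrow> real \<Rightarrow> real \<Rightarrow> (real \<Rightarrow> 'v::real_normed_vector) \<Rightarrow> real" where
  "crossing_weight c p a b x =
     (if \<not> crosses c x a \<and> (\<exists>t\<in>{a..b}. crosses c x t)
      then Inf {t\<in>{a..b}. crosses c x t} powr p * exp (- c (Inf {t\<in>{a..b}. crosses c x t}) / 2) else 0)"

lemma crosses_open:
  assumes x: "continuous_on {a..b} x" and c: "continuous_on {a..b} c"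
    and s: "s \<in> {a..b}" "crosses c x s"
  shows "\<exists>e>0. \<forall>t\<in>{a..b}. \<bar>t - s\<bar> < e \<longrightarrow> crosses c x t"
proof -
  have d: "continuous_on {a..b} (\<lambda>t. (norm (x t))\<^sup>2 - t * c t)" by (intro continuous_intros x c)
  have "0 < (norm (x s))\<^sup>2 - s * c s" using s by (simp add: crosses_def)
  then obtain e where "0 < e" "\<And>t. t \<in> {a..b} \<Longrightarrow> \<bar>t - s\<bar> < e \<Longrightarrow>
      \<bar>((norm (x t))\<^sup>2 - t * c t) - ((norm (x s))\<^sup>2 - s * c s)\<bar> < (norm (x s))\<^sup>2 - s * c s"
    using d s(1) unfolding continuous_on_iff dist_real_def by metis
  then show ?thesis unfolding crosses_def by (intro exI[of _ e]) fastforce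
qed

lemma first_crossing_in:
  fixes C :: "real \<Rightarrow> bool"
  assumes "\<exists>t\<in>{a..b}. C t"
  shows "Inf {t\<in>{a..b}. C t} \<in> {a..b}"
proof -
  have ne: "{t\<in>{a..b}. C t} \<noteq> {}" and bdd: "bdd_below {t\<in>{a..b}. C t}"
    using assms by (auto intro!: bdd_belowI[of _ a])
  then show ?thesis using cInf_lower[OF _ bdd]
    by (auto intro!: cInf_greatest intro: order_trans)
qed

text \<open>A strict excess at \<tau> would by openness produce an earlier crossing, as \<tau> then
  differs from a. A strict deficit would exclude crossings shortly after \<tau>, although \<tau> is
  the infimum of the crossing times.\<close>

lemma norm_square_first_crossing:
  assumes x: "continuous_on {a..b} x" and c: "continuous_on {a..b} c"
    and na: "\<not> crosses c x a" and ex: "\<exists>t\<in>{a..b}. crosses c x t"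
  defines "\<tau> \<equiv> Inf {t\<in>{a..b}. crosses c x t}"
  shows "(norm (x \<tau>))\<^sup>2 = \<tau> * c \<tau>"
proof -
  let ?U = "{t\<in>{a..b}. crosses c x t}"
  have ne: "?U \<noteq> {}" and bdd: "bdd_below ?U" using ex by (auto intro!: bdd_belowI[of _ a])
  have \<tau>: "\<tau> \<in> {a..b}" unfolding \<tau>_def by (rule first_crossing_in[OF ex])
  have low: "\<tau> \<le> t" if "t \<in> ?U" for t unfolding \<tau>_def by (rule cInf_lower[OF that bdd])
  have d: "continuous_on {a..b} (\<lambda>t. (norm (x t))\<^sup>2 - t * c t)" by (intro continuous_intros x c)
  show ?thesis
  proof (rule antisym)
    show "(norm (x \<tau>))\<^sup>2 \<le> \<tau> * c \<tau>"
    proof (rule ccontr)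
      assume "\<not> ?thesis"
      then have cr: "crosses c x \<tau>" by (simp add: crosses_def)
      then have "a < \<tau>" using na \<tau> by (cases "\<tau> = a") auto
      obtain e where e: "0 < e" "\<And>t. t \<in> {a..b} \<Longrightarrow> \<bar>t - \<tau>\<bar> < e \<Longrightarrow> crosses c x t"
        using crosses_open[OF x c \<tau> cr] by blast
      define t where "t = max a (\<tau> - e / 2)"
      have "t \<in> {a..b}" "\<bar>t - \<tau>\<bar> < e" "t < \<tau>" using \<open>a < \<tau>\<close> \<tau> e(1) by (auto simp: t_def)
      then show False using e(2)[of t] low[of t] by auto
    qed
    show "\<tau> * c \<tau> \<le> (norm (x \<tau>))\<^sup>2"
    proof (rule ccontr)
      assume "\<not> ?thesis"
      then have neg: "(norm (x \<tau>))\<^sup>2 - \<tau> * c \<tau> < 0" by simp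
      then obtain e where e: "0 < e" "\<And>t. t \<in> {a..b} \<Longrightarrow> \<bar>t - \<tau>\<bar> < e \<Longrightarrow>
          \<bar>((norm (x t))\<^sup>2 - t * c t) - ((norm (x \<tau>))\<^sup>2 - \<tau> * c \<tau>)\<bar> < - ((norm (x \<tau>))\<^sup>2 - \<tau> * c \<tau>)"
        using d \<tau> unfolding continuous_on_iff dist_real_def by (metis neg_0_less_iff_less)
      obtain s where s: "s \<in> ?U" "s < \<tau> + e"
        using cInf_lessD[OF ne, of "\<tau> + e"] e(1) unfolding \<tau>_def by auto
      then have "\<bar>((norm (x s))\<^sup>2 - s * c s) - ((norm (x \<tau>))\<^sup>2 - \<tau> * c \<tau>)\<bar> < - ((norm (x \<tau>))\<^sup>2 - \<tau> * c \<tau>)"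
        using low[OF s(1)] by (intro e(2)) auto
      then show False using s(1) by (auto simp: crosses_def)
    qed
  qed
qed

lemma crossing_weight_nonneg: "0 \<le> crossing_weight c p a b x"
  by (simp add: crossing_weight_def)

text \<open>At its first grid crossing the path may overshoot the boundary, so the grid sums carry
  |x t|^2 / t, as the change of measure produces it, instead of c t. Both agree at the true first
  crossing, to which the grid crossings converge.\<close>

lemma crossing_weight_limit:
  assumes ab: "0 < a" "a < b" and x: "continuous_on {a..b} x" and c: "continuous_on {a..b} c"
  shows "(\<lambda>N. \<Sum>k\<in>{1..2 ^ N}. of_bool (first_at (\<lambda>k. crosses c x (dyadic_grid a b N k)) k) *
      (dyadic_grid a b N k powr p * exp (- (norm (x (dyadic_grid a b N k)))\<^sup>2 / (2 * dyadic_grid a b N k))))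
    \<longlonglongrightarrow> crossing_weight c p a b x"
proof -
  have h: "continuous_on {a..b} (\<lambda>t. t powr p * exp (- (norm (x t))\<^sup>2 / (2 * t)))"
    using ab(1) by (intro continuous_intros x) auto
  have "crossing_weight c p a b x = (if \<not> crosses c x a \<and> (\<exists>t\<in>{a..b}. crosses c x t)
      then (\<lambda>t. t powr p * exp (- (norm (x t))\<^sup>2 / (2 * t))) (Inf {t\<in>{a..b}. crosses c x t}) else 0)"
  proof (cases "\<not> crosses c x a \<and> (\<exists>t\<in>{a..b}. crosses c x t)")
    case True
    then have "0 < Inf {t\<in>{a..b}. crosses c x t}"
      using first_crossing_in[of a b "crosses c x"] ab by auto
    then show ?thesis
      using True norm_square_first_crossing[OF x c] by (simp add: crossing_weight_def)
  qed (simp only: crossing_weight_def if_not_P if_False)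
  then show ?thesis
    using first_dyadic_crossing_limit[OF ab(2) crosses_open[OF x c] h] by simp
qed

lemma sum_first_at_le:
  assumes "\<And>k. k \<in> A \<Longrightarrow> h k \<le> (B::real)" "0 \<le> B" "finite A"
  shows "(\<Sum>k\<in>A. of_bool (first_at C k) * h k) \<le> B"
proof (cases "\<exists>k\<in>A. first_at C k")
  case True
  then obtain j where j: "j \<in> A" "first_at C j" by auto
  have "(\<Sum>k\<in>A. of_bool (first_at C k) * h k) = (\<Sum>k\<in>A. if k = j then h k else 0)"
    by (intro sum.cong) (auto simp: first_at_unique[OF j(2)])
  then show ?thesis using assms j by simp
next
  case False
  then have "(\<Sum>k\<in>A. of_bool (first_at C k) * h k) = 0" by (intro sum.neutral) auto
  then show ?thesis using assms by simp
qed

text \<open>This turns the search over uncountably many times into a countable one, which makes the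
  crossing events measurable and approximable by grid events.\<close>

lemma exists_crossing_dyadic:
  assumes ab: "a < b" and x: "continuous_on {a..b} x" and c: "continuous_on {a..b} c"
  shows "(\<exists>t\<in>{a..b}. crosses c x t) \<longleftrightarrow> (\<exists>N. \<exists>k\<le>2 ^ N. crosses c x (dyadic_grid a b N k))"
proof
  assume "\<exists>t\<in>{a..b}. crosses c x t"
  then obtain s where s: "s \<in> {a..b}" "crosses c x s" by auto
  obtain e where e: "0 < e" "\<And>t. t \<in> {a..b} \<Longrightarrow> \<bar>t - s\<bar> < e \<Longrightarrow> crosses c x t"
    using crosses_open[OF x c s] by blast
  have "(\<lambda>N. (b - a) / 2 ^ N) \<longlonglongrightarrow> 0"
    using LIMSEQ_divide_realpow_zero[of 2 "b - a"] by simp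
  from order_tendstoD(2)[OF this e(1)]
  obtain N where N: "(b - a) / 2 ^ N < e" unfolding eventually_sequentially by blast
  obtain k where k: "k \<le> 2 ^ N" "dyadic_grid a b N k \<le> s" "s - dyadic_grid a b N k < (b - a) / 2 ^ N"
    using dyadic_grid_below[OF ab s(1), of N] by auto
  have "crosses c x (dyadic_grid a b N k)"
    using k N by (intro e(2) dyadic_grid_in ab) auto
  with k(1) show "\<exists>N. \<exists>k\<le>2 ^ N. crosses c x (dyadic_grid a b N k)" by blast
qed (use dyadic_grid_in[OF ab] in blast)

context multi_brownian_motion
begin

definition drifted :: "real ^ 'n \<Rightarrow> 'a \<Rightarrow> real \<Rightarrow> real ^ 'n" where
  "drifted \<theta> \<omega> = (\<lambda>t. W t \<omega> + t *\<^sub>R \<theta>)"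

lemma continuous_on_drifted:
  assumes "\<omega> \<in> space M" "0 \<le> a" shows "continuous_on {a..b} (drifted \<theta> \<omega>)"
  unfolding drifted_def using assms
  by (intro continuous_intros continuous_on_subset[OF continuous_paths_W]) auto

lemma measurable_drifted_pair [measurable]:
  assumes "0 \<le> t" shows "(\<lambda>z. drifted (fst z) (snd z) t) \<in> borel_measurable (lborel \<Otimes>\<^sub>M M)"
proof -
  have [measurable]: "W t \<in> borel_measurable M" using assms by simp
  show ?thesis unfolding drifted_def by measurable
qed

lemma measurable_drifted [measurable]:
  assumes "0 \<le> t" shows "(\<lambda>\<omega>. drifted \<theta> \<omega> t) \<in> borel_measurable M"
proof -
  have [measurable]: "W t \<in> borel_measurable M" using assms by simp
  show ?thesis unfolding drifted_def by measurable
qed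

lemma pred_crosses_pair [measurable]:
  "0 \<le> t \<Longrightarrow> Measurable.pred (lborel \<Otimes>\<^sub>M M) (\<lambda>z. crosses c (drifted (fst z) (snd z)) t)"
  unfolding crosses_def by measurable

lemma pred_crosses [measurable]:
  "0 \<le> t \<Longrightarrow> Measurable.pred M (\<lambda>\<omega>. crosses c (drifted \<theta> \<omega>) t)"
  unfolding crosses_def by measurable

lemma dyadic_grid_nonneg: "0 \<le> a \<Longrightarrow> a < b \<Longrightarrow> 0 \<le> dyadic_grid a b N k"
  using dyadic_grid_mono[of a b 0 k N] by simp

lemma pred_exists_crossing:
  assumes "0 \<le> a" "a \<le> b" "continuous_on {a..b} c"
  shows "Measurable.pred M (\<lambda>\<omega>. \<exists>t\<in>{a..b}. crosses c (drifted \<theta> \<omega>) t)"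
proof (cases "a = b")
  case True then show ?thesis using assms by simp
next
  case False
  then have ab: "a < b" using assms by simp
  have "Measurable.pred M (\<lambda>\<omega>. \<exists>N. \<exists>k\<in>{..2 ^ N}. crosses c (drifted \<theta> \<omega>) (dyadic_grid a b N k))"
    using dyadic_grid_nonneg[OF assms(1) ab] by measurable
  then show ?thesis
  proof (rule measurable_cong[THEN iffD1, rotated])
    fix \<omega> assume "\<omega> \<in> space M"
    from exists_crossing_dyadic[OF ab continuous_on_drifted[OF this assms(1)] assms(3), of \<theta>]
    show "(\<exists>N. \<exists>k\<in>{..2 ^ N}. crosses c (drifted \<theta> \<omega>) (dyadic_grid a b N k)) \<longleftrightarrow> (\<exists>t\<in>{a..b}. crosses c (drifted \<theta> \<omega>) t)"
      by (simp only: Bex_def atMost_iff)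
  qed
qed

lemma pred_first_at_pair:
  assumes "0 \<le> a" "a < b"
  shows "Measurable.pred (lborel \<Otimes>\<^sub>M M) (\<lambda>z. first_at (\<lambda>k. crosses c (drifted (fst z) (snd z)) (dyadic_grid a b N k)) k)"
  unfolding first_at_def using dyadic_grid_nonneg[OF assms] by measurable

lemma pred_first_at:
  assumes "0 \<le> a" "a < b"
  shows "Measurable.pred M (\<lambda>\<omega>. first_at (\<lambda>k. crosses c (drifted \<theta> \<omega>) (dyadic_grid a b N k)) k)"
  unfolding first_at_def using dyadic_grid_nonneg[OF assms] by measurable

text \<open>The mixture has infinite mass, but here |W_a + a \<theta>|^2 is at most a c(a), so for
  fixed \<omega> the admissible \<theta> lie in a ball around - W_a / a whose volume does not depend
  on \<omega>. The \<open>max 0\<close> covers a negative boundary value.\<close>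

lemma nn_integral_not_crosses_start:
  assumes "0 < a"
  shows "(\<integral>\<^sup>+z. indicator {z. \<not> crosses c (drifted (fst z) (snd z)) a} z \<partial>(lborel \<Otimes>\<^sub>M M))
    \<le> ennreal (unit_ball_vol CARD('n) * (max 0 (c a) / a) powr (CARD('n) / 2))"
proof -
  interpret P: pair_sigma_finite lborel M ..
  define r where "r = sqrt (max 0 (c a) / a)"
  have r: "0 \<le> r" using assms by (simp add: r_def)
  have [measurable]: "W a \<in> borel_measurable M" using assms by simp
  have [measurable]: "Measurable.pred (lborel \<Otimes>\<^sub>M M) (\<lambda>z. crosses c (drifted (fst z) (snd z)) a)"
    using assms by simp
  have "(\<integral>\<^sup>+z. indicator {z. \<not> crosses c (drifted (fst z) (snd z)) a} z \<partial>(lborel \<Otimes>\<^sub>M M))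
      = (\<integral>\<^sup>+\<omega>. \<integral>\<^sup>+\<theta>. indicator {z. \<not> crosses c (drifted (fst z) (snd z)) a} (\<theta>, \<omega>) \<partial>lborel \<partial>M)"
    by (rule P.nn_integral_snd[symmetric]) measurable
  also have "\<dots> \<le> (\<integral>\<^sup>+\<omega>. \<integral>\<^sup>+\<theta>. indicator (cball (- (1 / a) *\<^sub>R W a \<omega>) r) \<theta> \<partial>lborel \<partial>M)"
  proof (intro nn_integral_mono)
    fix \<omega> \<theta>
    have "dist (- (1 / a) *\<^sub>R W a \<omega>) \<theta> \<le> r" if "\<not> crosses c (drifted \<theta> \<omega>) a"
    proof -
      have "dist (- (1 / a) *\<^sub>R W a \<omega>) \<theta> = norm ((1 / a) *\<^sub>R drifted \<theta> \<omega> a)"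
      proof -
        have "(1 / a) *\<^sub>R drifted \<theta> \<omega> a = \<theta> - (- (1 / a) *\<^sub>R W a \<omega>)"
          using assms by (simp add: drifted_def scaleR_add_right)
        then show ?thesis by (simp only: dist_norm norm_minus_commute)
      qed
      also have "\<dots> = norm (drifted \<theta> \<omega> a) / a" using assms by simp
      finally have "(dist (- (1 / a) *\<^sub>R W a \<omega>) \<theta>)\<^sup>2 = (norm (drifted \<theta> \<omega> a))\<^sup>2 / a\<^sup>2" by (simp add: power_divide)
      also have "\<dots> \<le> a * c a / a\<^sup>2" using that by (intro divide_right_mono) (auto simp: crosses_def)
      also have "\<dots> \<le> max 0 (c a) / a" using assms by (auto simp: power2_eq_square divide_right_mono)
      finally show ?thesis unfolding r_def by (rule real_le_rsqrt)
    qed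
    then show "(indicator {z. \<not> crosses c (drifted (fst z) (snd z)) a} (\<theta>, \<omega>) :: ennreal)
      \<le> indicator (cball (- (1 / a) *\<^sub>R W a \<omega>) r) \<theta>"
      by (auto simp: indicator_def)
  qed
  also have "\<dots> = (\<integral>\<^sup>+\<omega>. ennreal (unit_ball_vol CARD('n) * r ^ CARD('n)) \<partial>M)"
    using emeasure_cball[OF r, where 'a = "real ^ 'n"] by simp
  also have "\<dots> = ennreal (unit_ball_vol CARD('n) * r ^ CARD('n))"
    by (simp add: emeasure_space_1)
  also have "r ^ CARD('n) = (max 0 (c a) / a) powr (CARD('n) / 2)"
  proof (cases "max 0 (c a) / a = 0")
    case False then show ?thesis unfolding r_def using assms by (intro sqrt_power_eq_powr) (simp add: less_le)
  next
    case True
    then have "r = 0" unfolding r_def by (simp only: real_sqrt_zero)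
    then show ?thesis unfolding True by simp
  qed
  finally show ?thesis .
qed

text \<open>The infimum over uncountably many times is never treated directly: the weight is a
  pointwise limit of measurable grid sums.\<close>

lemma measurable_crossing_weight_pair:
  assumes ab: "0 < a" "a < b" and c: "continuous_on {a..b} c"
  shows "(\<lambda>z. crossing_weight c p a b (drifted (fst z) (snd z))) \<in> borel_measurable (lborel \<Otimes>\<^sub>M M)"
proof (rule borel_measurable_LIMSEQ_real)
  fix z :: "(real ^ 'n) \<times> 'a" assume "z \<in> space (lborel \<Otimes>\<^sub>M M)"
  then have "snd z \<in> space M" by (auto simp: space_pair_measure)
  from crossing_weight_limit[OF ab continuous_on_drifted[OF this] c, where p=p and \<theta>1="fst z"]
  show "(\<lambda>N. \<Sum>k\<in>{1..2 ^ N}. of_bool (first_at (\<lambda>k. crosses c (drifted (fst z) (snd z)) (dyadic_grid a b N k)) k) *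
      (dyadic_grid a b N k powr p * exp (- (norm (drifted (fst z) (snd z) (dyadic_grid a b N k)))\<^sup>2 / (2 * dyadic_grid a b N k))))
    \<longlonglongrightarrow> crossing_weight c p a b (drifted (fst z) (snd z))" using ab by simp
next
  fix N
  have [measurable]: "Measurable.pred (lborel \<Otimes>\<^sub>M M) (\<lambda>z. first_at (\<lambda>k. crosses c (drifted (fst z) (snd z)) (dyadic_grid a b N k)) k)" for k
    using ab by (intro pred_first_at_pair) auto
  have [measurable]: "(\<lambda>z. drifted (fst z) (snd z) (dyadic_grid a b N k)) \<in> borel_measurable (lborel \<Otimes>\<^sub>M M)" for k
    using ab by (intro measurable_drifted_pair dyadic_grid_nonneg) auto
  show "(\<lambda>z. \<Sum>k\<in>{1..2 ^ N}. of_bool (first_at (\<lambda>k. crosses c (drifted (fst z) (snd z)) (dyadic_grid a b N k)) k) *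
      (dyadic_grid a b N k powr p * exp (- (norm (drifted (fst z) (snd z) (dyadic_grid a b N k)))\<^sup>2 / (2 * dyadic_grid a b N k))))
    \<in> borel_measurable (lborel \<Otimes>\<^sub>M M)" by measurable
qed

lemma mixture_identity_first_at:
  fixes N k :: nat
  assumes ab: "0 < a" "a < b"
  defines "g \<equiv> dyadic_grid a b N"
  shows "(\<integral>\<^sup>+z. ennreal (of_bool (first_at (\<lambda>k. crosses c (drifted (fst z) (snd z)) (g k)) k) *
      (g k powr (CARD('n) / 2) * exp (- (norm (drifted (fst z) (snd z) (g k)))\<^sup>2 / (2 * g k)))) \<partial>(lborel \<Otimes>\<^sub>M M))
    = ennreal ((2 * pi) powr (CARD('n) / 2)) * (\<integral>\<^sup>+\<omega>. ennreal (of_bool (first_at (\<lambda>k. crosses c (drifted 0 \<omega>) (g k)) k)) \<partial>M)"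
proof -
  interpret P: pair_sigma_finite lborel M ..
  \<comment> \<open>Change-of-measure grids start at time 0, so 0 is put in front of the grid on
    [a, b]. This is why \<open>F\<close> reads the coordinate \<open>Suc i\<close>; the boundary is
    never tested at time 0.\<close>
  define t where "t i = (case i of 0 \<Rightarrow> 0 | Suc i \<Rightarrow> g i)" for i
  have t: "t 0 = 0" "\<And>i. i < Suc k \<Longrightarrow> t i < t (Suc i)" "0 < Suc k"
    using ab dyadic_grid_less[OF ab(2)] by (auto simp: t_def g_def split: nat.split)
  define F where "F p = (of_bool (first_at (\<lambda>i. g i * c (g i) < (norm (p (Suc i)))\<^sup>2) k) :: ennreal)" for p :: "nat \<Rightarrow> real ^ 'n"
  have F: "F \<in> borel_measurable (PiM {..Suc k} (\<lambda>_. borel))"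
  proof -
    have [measurable]: "(\<lambda>p. p (Suc i)) \<in> borel_measurable (PiM {..Suc k} (\<lambda>_. borel :: (real ^ 'n) measure))" if "i \<le> k" for i
      by (rule measurable_component_singleton) (use that in auto)
    show ?thesis unfolding F_def first_at_def by measurable
  qed
  have Fx: "F (\<lambda>i\<in>{..Suc k}. W (t i) \<omega> + t i *\<^sub>R \<theta>) = of_bool (first_at (\<lambda>k. crosses c (drifted \<theta> \<omega>) (g k)) k)" for \<theta> \<omega>
    unfolding F_def first_at_def crosses_def drifted_def by (auto simp: t_def)
  have [measurable]: "Measurable.pred (lborel \<Otimes>\<^sub>M M) (\<lambda>z. first_at (\<lambda>k. crosses c (drifted (fst z) (snd z)) (g k)) k)"
    unfolding g_def using ab by (intro pred_first_at_pair) auto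
  have [measurable]: "(\<lambda>z. drifted (fst z) (snd z) (g k)) \<in> borel_measurable (lborel \<Otimes>\<^sub>M M)"
    unfolding g_def using ab by (intro measurable_drifted_pair dyadic_grid_nonneg) auto
  have "(\<integral>\<^sup>+z. ennreal (of_bool (first_at (\<lambda>k. crosses c (drifted (fst z) (snd z)) (g k)) k) *
      (g k powr (CARD('n) / 2) * exp (- (norm (drifted (fst z) (snd z) (g k)))\<^sup>2 / (2 * g k)))) \<partial>(lborel \<Otimes>\<^sub>M M))
    = (\<integral>\<^sup>+\<theta>. \<integral>\<^sup>+\<omega>. ennreal (of_bool (first_at (\<lambda>k. crosses c (drifted \<theta> \<omega>) (g k)) k) *
      (g k powr (CARD('n) / 2) * exp (- (norm (drifted \<theta> \<omega> (g k)))\<^sup>2 / (2 * g k)))) \<partial>M \<partial>lborel)"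
    by (subst nn_integral_fst[symmetric]) auto
  also have "\<dots> = (\<integral>\<^sup>+\<theta>. \<integral>\<^sup>+\<omega>. F (\<lambda>i\<in>{..Suc k}. W (t i) \<omega> + t i *\<^sub>R \<theta>) *
      ennreal (t (Suc k) powr (CARD('n) / 2) * exp (- (norm (W (t (Suc k)) \<omega> + t (Suc k) *\<^sub>R \<theta>))\<^sup>2 / (2 * t (Suc k)))) \<partial>M \<partial>lborel)"
    unfolding Fx by (intro nn_integral_cong) (auto simp: t_def drifted_def)
  also have "\<dots> = ennreal ((2 * pi) powr (CARD('n) / 2)) * (\<integral>\<^sup>+\<omega>. F (\<lambda>i\<in>{..Suc k}. W (t i) \<omega>) \<partial>M)"
    by (rule mixture_identity_grid[OF t F])
  also have "(\<lambda>\<omega>. F (\<lambda>i\<in>{..Suc k}. W (t i) \<omega>)) = (\<lambda>\<omega>. ennreal (of_bool (first_at (\<lambda>k. crosses c (drifted 0 \<omega>) (g k)) k)))"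
    using Fx[of _ 0] by (auto simp: fun_eq_iff)
  finally show ?thesis .
qed

text \<open>The grid identity is summed over the index of the first crossing and the mesh is
  refined, with dominated convergence on both sides. The index runs from 1, which is where the
  condition of not crossing at a comes from.\<close>

lemma crossing_probability_eq:
  assumes ab: "0 < a" "a < b" and c: "continuous_on {a..b} c"
  shows "(\<integral>\<^sup>+z. ennreal (crossing_weight c (CARD('n) / 2) a b (drifted (fst z) (snd z))) \<partial>(lborel \<Otimes>\<^sub>M M)) =
    ennreal ((2 * pi) powr (CARD('n) / 2) *
      measure M {\<omega>\<in>space M. \<not> crosses c (drifted 0 \<omega>) a \<and> (\<exists>t\<in>{a..b}. crosses c (drifted 0 \<omega>) t)})"
    (is "?L = ennreal (?K * measure M ?E)")
proof -
  let ?g = "dyadic_grid a b"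
  let ?I = "\<lambda>N k (z :: (real ^ 'n) \<times> 'a). of_bool (first_at (\<lambda>k. crosses c (drifted (fst z) (snd z)) (?g N k)) k) :: real"
  let ?h = "\<lambda>N k (z :: (real ^ 'n) \<times> 'a). ?g N k powr (CARD('n) / 2) * exp (- (norm (drifted (fst z) (snd z) (?g N k)))\<^sup>2 / (2 * ?g N k))"
  let ?S = "\<lambda>N z. \<Sum>k\<in>{1..2 ^ N}. ?I N k z * ?h N k z"
  let ?T = "\<lambda>N \<omega>. \<Sum>k\<in>{1..2 ^ N}. of_bool (first_at (\<lambda>k. crosses c (drifted 0 \<omega>) (?g N k)) k) * (1::real)"
  \<comment> \<open>Dominates every grid sum: a first crossing with index at least 1 excludes a
    crossing at a, grid times are at most b, and the exponential is at most 1 whatever the sign of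
    c. Its integral is finite by \<open>nn_integral_not_crosses_start\<close>.\<close>
  let ?b = "\<lambda>z :: (real ^ 'n) \<times> 'a. ennreal (b powr (CARD('n) / 2)) * indicator {z. \<not> crosses c (drifted (fst z) (snd z)) a} z"
  have m1 [measurable]: "Measurable.pred (lborel \<Otimes>\<^sub>M M) (\<lambda>z. first_at (\<lambda>k. crosses c (drifted (fst z) (snd z)) (?g N k)) k)" for N k
    using ab by (intro pred_first_at_pair) auto
  have m2 [measurable]: "(\<lambda>z. drifted (fst z) (snd z) (?g N k)) \<in> borel_measurable (lborel \<Otimes>\<^sub>M M)" for N k
    using ab by (intro measurable_drifted_pair dyadic_grid_nonneg) auto
  have m3 [measurable]: "Measurable.pred M (\<lambda>\<omega>. first_at (\<lambda>k. crosses c (drifted \<theta> \<omega>) (?g N k)) k)" for N k \<theta>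
    using ab by (intro pred_first_at) auto
  have m4 [measurable]: "Measurable.pred (lborel \<Otimes>\<^sub>M M) (\<lambda>z. crosses c (drifted (fst z) (snd z)) a)"
    using ab by simp
  have m5 [measurable]: "Measurable.pred M (\<lambda>\<omega>. crosses c (drifted \<theta> \<omega>) a)" for \<theta> using ab by simp
  have m6 [measurable]: "Measurable.pred M (\<lambda>\<omega>. \<exists>t\<in>{a..b}. crosses c (drifted \<theta> \<omega>) t)" for \<theta>
    using ab c by (intro pred_exists_crossing) auto
  have eq: "(\<integral>\<^sup>+z. ennreal (?S N z) \<partial>(lborel \<Otimes>\<^sub>M M)) = ennreal ?K * (\<integral>\<^sup>+\<omega>. ennreal (?T N \<omega>) \<partial>M)" for N
  proof -
    have "(\<integral>\<^sup>+z. ennreal (?S N z) \<partial>(lborel \<Otimes>\<^sub>M M)) = (\<Sum>k\<in>{1..2 ^ N}. \<integral>\<^sup>+z. ennreal (?I N k z * ?h N k z) \<partial>(lborel \<Otimes>\<^sub>M M))"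
      by (subst nn_integral_sum[symmetric]) (auto intro!: nn_integral_cong simp del: of_bool_eq_0_iff)
    also have "\<dots> = (\<Sum>k\<in>{1..2 ^ N}. ennreal ?K * (\<integral>\<^sup>+\<omega>. ennreal (of_bool (first_at (\<lambda>k. crosses c (drifted 0 \<omega>) (?g N k)) k)) \<partial>M))"
      by (intro sum.cong mixture_identity_first_at ab refl)
    also have "\<dots> = ennreal ?K * (\<integral>\<^sup>+\<omega>. (\<Sum>k\<in>{1..2 ^ N}. ennreal (of_bool (first_at (\<lambda>k. crosses c (drifted 0 \<omega>) (?g N k)) k))) \<partial>M)"
      by (subst nn_integral_sum) (auto simp: sum_distrib_left)
    also have "(\<lambda>\<omega>. \<Sum>k\<in>{1..2 ^ N}. ennreal (of_bool (first_at (\<lambda>k. crosses c (drifted 0 \<omega>) (?g N k)) k))) = (\<lambda>\<omega>. ennreal (?T N \<omega>))"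
      by (subst sum_ennreal) auto
    finally show ?thesis .
  qed
  have "(\<lambda>N. \<integral>\<^sup>+z. ennreal (?S N z) \<partial>(lborel \<Otimes>\<^sub>M M)) \<longlonglongrightarrow> ?L"
  proof (rule nn_integral_dominated_convergence[where w="?b"])
    show "(\<lambda>z. ennreal (crossing_weight c (CARD('n) / 2) a b (drifted (fst z) (snd z)))) \<in> borel_measurable (lborel \<Otimes>\<^sub>M M)"
      using measurable_crossing_weight_pair[OF ab c] by measurable
    show "AE z in lborel \<Otimes>\<^sub>M M. ennreal (?S N z) \<le> ?b z" for N
    proof (rule AE_I2)
      fix z :: "(real ^ 'n) \<times> 'a"
      show "ennreal (?S N z) \<le> ?b z"
      proof (cases "crosses c (drifted (fst z) (snd z)) a")
        case True
        have "?S N z = 0"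
        proof (rule sum.neutral, rule ballI)
          fix k :: nat assume "k \<in> {1..2 ^ N}"
          then have "\<not> first_at (\<lambda>k. crosses c (drifted (fst z) (snd z)) (?g N k)) k"
            using True by (auto simp: first_at_def intro!: exI[of _ 0])
          then show "?I N k z * ?h N k z = 0" by simp
        qed
        then show ?thesis by simp
      next
        case False
        have "?S N z \<le> b powr (CARD('n) / 2)"
        proof (rule sum_first_at_le)
          fix k :: nat assume "k \<in> {1..2 ^ N}"
          then have g: "?g N k \<in> {a..b}" by (intro dyadic_grid_in ab) auto
          have "?h N k z \<le> b powr (CARD('n) / 2) * 1"
            using g ab by (intro mult_mono powr_mono2) auto
          then show "?h N k z \<le> b powr (CARD('n) / 2)" by simp
        qed auto
        then show ?thesis using False by (simp add: ennreal_leI)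
      qed
    qed
    have "(\<integral>\<^sup>+z. ?b z \<partial>(lborel \<Otimes>\<^sub>M M)) = ennreal (b powr (CARD('n) / 2)) * (\<integral>\<^sup>+z. indicator {z. \<not> crosses c (drifted (fst z) (snd z)) a} z \<partial>(lborel \<Otimes>\<^sub>M M))"
      by (rule nn_integral_cmult) measurable
    also have "\<dots> \<le> ennreal (b powr (CARD('n) / 2)) * ennreal (unit_ball_vol CARD('n) * (max 0 (c a) / a) powr (CARD('n) / 2))"
      by (intro mult_left_mono nn_integral_not_crosses_start ab) auto
    also have "\<dots> < \<infinity>" by (simp add: ennreal_mult_less_top)
    finally show "(\<integral>\<^sup>+z. ?b z \<partial>(lborel \<Otimes>\<^sub>M M)) < \<infinity>" .
    show "AE z in lborel \<Otimes>\<^sub>M M. (\<lambda>N. ennreal (?S N z)) \<longlonglongrightarrow> ennreal (crossing_weight c (CARD('n) / 2) a b (drifted (fst z) (snd z)))"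
    proof (rule AE_I2)
      fix z :: "(real ^ 'n) \<times> 'a" assume "z \<in> space (lborel \<Otimes>\<^sub>M M)"
      then have "snd z \<in> space M" by (auto simp: space_pair_measure)
      then show "(\<lambda>N. ennreal (?S N z)) \<longlonglongrightarrow> ennreal (crossing_weight c (CARD('n) / 2) a b (drifted (fst z) (snd z)))"
        using ab by (intro tendsto_ennrealI crossing_weight_limit continuous_on_drifted c) auto
    qed
  qed measurable
  moreover have "(\<lambda>N. \<integral>\<^sup>+z. ennreal (?S N z) \<partial>(lborel \<Otimes>\<^sub>M M)) \<longlonglongrightarrow> ennreal ?K * (\<integral>\<^sup>+\<omega>. indicator ?E \<omega> \<partial>M)"
    unfolding eq
  proof (intro ennreal_tendsto_cmult nn_integral_dominated_convergence[where w="\<lambda>_. 1"])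
    show "AE \<omega> in M. ennreal (?T N \<omega>) \<le> 1" for N
    proof (rule AE_I2)
      fix \<omega>
      have "?T N \<omega> \<le> 1" by (rule sum_first_at_le) auto
      from ennreal_leI[OF this] show "ennreal (?T N \<omega>) \<le> 1" by (simp only: ennreal_1)
    qed
    show "(\<integral>\<^sup>+\<omega>. 1 \<partial>M) < \<infinity>" by (simp add: emeasure_space_1)
    show "AE \<omega> in M. (\<lambda>N. ennreal (?T N \<omega>)) \<longlonglongrightarrow> indicator ?E \<omega>"
    proof (rule AE_I2)
      fix \<omega> assume \<omega>: "\<omega> \<in> space M"
      have "(\<lambda>N. ?T N \<omega>) \<longlonglongrightarrow> (if \<not> crosses c (drifted 0 \<omega>) a \<and> (\<exists>t\<in>{a..b}. crosses c (drifted 0 \<omega>) t) then 1 else 0)"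
        using ab by (intro first_dyadic_crossing_limit[where h="\<lambda>_. 1"] crosses_open continuous_on_drifted \<omega> c) auto
      note tendsto_ennrealI[OF this]
      also have "ennreal (if \<not> crosses c (drifted 0 \<omega>) a \<and> (\<exists>t\<in>{a..b}. crosses c (drifted 0 \<omega>) t) then 1 else 0) = indicator ?E \<omega>"
        using \<omega> by (auto simp: indicator_def)
      finally show "(\<lambda>N. ennreal (?T N \<omega>)) \<longlonglongrightarrow> indicator ?E \<omega>" .
    qed
  qed (simp, measurable)
  ultimately have "?L = ennreal ?K * (\<integral>\<^sup>+\<omega>. indicator ?E \<omega> \<partial>M)" by (rule LIMSEQ_unique)
  also have "(\<integral>\<^sup>+\<omega>. indicator ?E \<omega> \<partial>M) = emeasure M ?E" by (rule nn_integral_indicator) measurable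
  finally show ?thesis by (simp add: emeasure_eq_measure ennreal_mult)
qed

text \<open>Either the path is across at a, a chi-square tail, or it crosses later and the identity
  applies: the weight is at most b^(n/2) exp (- k / 2), on a set of drifts whose volume is at most
  that of a ball of radius sqrt (k / a). Both parts have the same order in k. This estimate controls
  the noise in the divergent and in the convergent case.\<close>

lemma crossing_probability_le:
  assumes ab: "0 < a" "a \<le> b" and k: "1 < k"
  shows "measure M {\<omega>\<in>space M. \<exists>t\<in>{a..b}. crosses (\<lambda>_. k) (drifted 0 \<omega>) t}
    \<le> (exp (1 / 2) + unit_ball_vol CARD('n) / (2 * pi) powr (CARD('n) / 2)) *
       (b / a) powr (CARD('n) / 2) * k powr (CARD('n) / 2) * exp (- k / 2)"
proof -
  let ?c = "\<lambda>_. k" and ?K = "(2 * pi) powr (CARD('n) / 2)" and ?p = "CARD('n) / 2"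
  let ?A = "{\<omega>\<in>space M. a * k < (norm (W a \<omega>))\<^sup>2}"
  let ?E = "{\<omega>\<in>space M. \<not> crosses ?c (drifted 0 \<omega>) a \<and> (\<exists>t\<in>{a..b}. crosses ?c (drifted 0 \<omega>) t)}"
  have [measurable]: "W a \<in> borel_measurable M" using ab by simp
  have [measurable]: "Measurable.pred M (\<lambda>\<omega>. crosses ?c (drifted 0 \<omega>) a)" using ab by simp
  have [measurable]: "Measurable.pred M (\<lambda>\<omega>. \<exists>t\<in>{a..b}. crosses ?c (drifted 0 \<omega>) t)"
    using ab by (intro pred_exists_crossing) auto
  have ba: "1 \<le> (b / a) powr ?p" using ab by (intro ge_one_powr_ge_zero) auto
  have E: "measure M ?E \<le> unit_ball_vol CARD('n) / ?K * (b / a) powr ?p * k powr ?p * exp (- k / 2)"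
  proof (cases "a = b")
    case True
    then have "?E = {}" by auto
    then show ?thesis by (simp only: measure_empty) simp
  next
    case False
    then have less: "a < b" using ab by simp
    let ?w = "b powr ?p * exp (- k / 2)"
    have "ennreal (?K * measure M ?E) = (\<integral>\<^sup>+z. ennreal (crossing_weight ?c ?p a b (drifted (fst z) (snd z))) \<partial>(lborel \<Otimes>\<^sub>M M))"
      using crossing_probability_eq[OF ab(1) less, of ?c] by simp
    also have "\<dots> \<le> (\<integral>\<^sup>+z. ennreal ?w * indicator {z. \<not> crosses ?c (drifted (fst z) (snd z)) a} z \<partial>(lborel \<Otimes>\<^sub>M M))"
    proof (rule nn_integral_mono)
      fix z :: "(real ^ 'n) \<times> 'a"
      have "Inf {t\<in>{a..b}. crosses ?c (drifted (fst z) (snd z)) t} powr ?p \<le> b powr ?p"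
        if "\<exists>t\<in>{a..b}. crosses ?c (drifted (fst z) (snd z)) t"
        using first_crossing_in[of a b "crosses ?c (drifted (fst z) (snd z))"] that ab by (intro powr_mono2) auto
      then show "ennreal (crossing_weight ?c ?p a b (drifted (fst z) (snd z)))
          \<le> ennreal ?w * indicator {z. \<not> crosses ?c (drifted (fst z) (snd z)) a} z"
        by (auto simp: crossing_weight_def indicator_def intro!: ennreal_leI)
    qed
    also have "\<dots> = ennreal ?w * (\<integral>\<^sup>+z. indicator {z. \<not> crosses ?c (drifted (fst z) (snd z)) a} z \<partial>(lborel \<Otimes>\<^sub>M M))"
      using pred_crosses_pair[of a ?c] ab by (intro nn_integral_cmult) measurable
    also have "\<dots> \<le> ennreal ?w * ennreal (unit_ball_vol CARD('n) * (max 0 k / a) powr ?p)"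
      by (intro mult_left_mono nn_integral_not_crosses_start ab) auto
    also have "\<dots> = ennreal (?w * (unit_ball_vol CARD('n) * (k / a) powr ?p))"
      using k by (simp add: ennreal_mult)
    finally have "?K * measure M ?E \<le> ?w * (unit_ball_vol CARD('n) * (k / a) powr ?p)"
      by (subst (asm) ennreal_le_iff) auto
    then have "measure M ?E \<le> ?w * (unit_ball_vol CARD('n) * (k / a) powr ?p) / ?K"
      by (simp add: field_simps)
    also have "\<dots> = unit_ball_vol CARD('n) / ?K * (b / a) powr ?p * k powr ?p * exp (- k / 2)"
      using ab k by (simp add: powr_divide mult_ac)
    finally show ?thesis .
  qed
  have "measure M ?A \<le> exp (1 / 2) * (1 * k powr ?p * exp (- k / 2))"
    using chi_square_tail[OF ab(1) k] by simp
  also have "\<dots> \<le> exp (1 / 2) * ((b / a) powr ?p * k powr ?p * exp (- k / 2))"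
    using ba by (intro mult_left_mono mult_right_mono) auto
  finally have A: "measure M ?A \<le> exp (1 / 2) * ((b / a) powr ?p * k powr ?p * exp (- k / 2))" .
  have "measure M {\<omega>\<in>space M. \<exists>t\<in>{a..b}. crosses ?c (drifted 0 \<omega>) t} \<le> measure M (?A \<union> ?E)"
  proof (rule finite_measure_mono)
    have "crosses ?c (drifted 0 \<omega>) a \<longleftrightarrow> a * k < (norm (W a \<omega>))\<^sup>2" for \<omega>
      by (simp add: crosses_def drifted_def)
    then show "{\<omega>\<in>space M. \<exists>t\<in>{a..b}. crosses ?c (drifted 0 \<omega>) t} \<subseteq> ?A \<union> ?E" by blast
  qed measurable
  also have "\<dots> \<le> measure M ?A + measure M ?E" by (rule measure_Un_le) measurable
  finally show ?thesis using A E by (simp add: algebra_simps)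
qed

end

section \<open>The divergent case\<close>

lemma powr_times_exp_tendsto_0:
  fixes p \<kappa> :: real
  assumes "0 < \<kappa>"
  shows "((\<lambda>x. x powr p * exp (- \<kappa> * x)) \<longlongrightarrow> 0) at_top"
  using assms by real_asymp

text \<open>Fatou's lemma along cut-offs tending to 0. Measurability is asked for on the intervals
  away from 0 only, where it follows from continuity on a half-open interval.\<close>

lemma nn_integral_Ioc_le:
  fixes h :: "real \<Rightarrow> ennreal"
  assumes d: "0 < d"
    and meas: "\<And>\<epsilon>. 0 < \<epsilon> \<Longrightarrow> \<epsilon> < d \<Longrightarrow> (\<lambda>x. h x * indicator {\<epsilon>..d} x) \<in> borel_measurable lborel"
    and le: "\<And>\<epsilon>. 0 < \<epsilon> \<Longrightarrow> \<epsilon> < d \<Longrightarrow> (\<integral>\<^sup>+x\<in>{\<epsilon>..d}. h x \<partial>lborel) \<le> B"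
  shows "(\<integral>\<^sup>+x\<in>{0<..d}. h x \<partial>lborel) \<le> B"
proof -
  \<comment> \<open>The shift by 2 keeps every cut-off strictly below \<open>d\<close>.\<close>
  let ?\<epsilon> = "\<lambda>i. d / real (i + 2)"
  have \<epsilon>: "0 < ?\<epsilon> i" "?\<epsilon> i < d" for i using d by (auto simp: divide_less_eq)
  have lim: "liminf (\<lambda>i. h x * indicator {?\<epsilon> i..d} x) = h x * indicator {0<..d} x" for x
  proof (rule lim_imp_Liminf)
    have "eventually (\<lambda>i. h x * indicator {?\<epsilon> i..d} x = h x * indicator {0<..d} x) sequentially"
    proof (cases "0 < x")
      case True
      have "?\<epsilon> \<longlonglongrightarrow> 0" by real_asymp
      from order_tendstoD(2)[OF this True] show ?thesis
        by eventually_elim (use True in \<open>auto simp: indicator_def\<close>)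
    next
      case False
      then have "h x * indicator {?\<epsilon> i..d} x = h x * indicator {0<..d} x" for i
        using \<epsilon>(1)[of i] by (auto simp: indicator_def)
      then show ?thesis by simp
    qed
    then show "(\<lambda>i. h x * indicator {?\<epsilon> i..d} x) \<longlonglongrightarrow> h x * indicator {0<..d} x"
      by (rule tendsto_eventually)
  qed simp
  have "(\<integral>\<^sup>+x\<in>{0<..d}. h x \<partial>lborel) = (\<integral>\<^sup>+x. liminf (\<lambda>i. h x * indicator {?\<epsilon> i..d} x) \<partial>lborel)"
    unfolding lim ..
  also have "\<dots> \<le> liminf (\<lambda>i. \<integral>\<^sup>+x\<in>{?\<epsilon> i..d}. h x \<partial>lborel)"
    by (rule nn_integral_liminf) (rule meas[OF \<epsilon>])
  also have "\<dots> \<le> liminf (\<lambda>i. B)"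
    by (intro Liminf_mono always_eventually allI le \<epsilon>)
  also have "\<dots> = B" by (rule Liminf_const) simp
  finally show ?thesis .
qed

lemma dyadic_grid_Suc: "dyadic_grid a b N k = dyadic_grid a b (Suc N) (2 * k)"
  by (simp add: dyadic_grid_def)

text \<open>Here p t^(p-1) is the derivative of t^p, and c is at least c \<tau> before \<tau>. The
  purpose is to trade the value at a time that depends on the drift for an integral over t, so that
  the order of integration can be exchanged afterwards.\<close>

lemma le_integral_power_times_decreasing:
  fixes c :: "real \<Rightarrow> real"
  assumes p: "0 < p" and \<tau>: "0 < \<tau>" and c: "\<And>t. 0 < t \<Longrightarrow> t \<le> \<tau> \<Longrightarrow> c \<tau> \<le> c t"
  shows "(\<integral>\<^sup>+t\<in>{0<..\<tau>}. ennreal (p * t powr (p - 1) * exp (- c t / 2)) \<partial>lborel) \<le> ennreal (\<tau> powr p * exp (- c \<tau> / 2))"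
proof -
  have "(\<integral>\<^sup>+t\<in>{0<..\<tau>}. ennreal (p * t powr (p - 1) * exp (- c t / 2)) \<partial>lborel)
      \<le> (\<integral>\<^sup>+t. ennreal (exp (- c \<tau> / 2)) * (ennreal (p * t powr (p - 1)) * indicator {0..\<tau>} t) \<partial>lborel)"
  proof (intro nn_integral_mono)
    fix t
    show "ennreal (p * t powr (p - 1) * exp (- c t / 2)) * indicator {0<..\<tau>} t
        \<le> ennreal (exp (- c \<tau> / 2)) * (ennreal (p * t powr (p - 1)) * indicator {0..\<tau>} t)"
      using c[of t] p by (auto simp: indicator_def ennreal_mult[symmetric] mult.commute intro!: ennreal_leI mult_left_mono)
  qed
  also have "\<dots> = ennreal (exp (- c \<tau> / 2)) * (\<integral>\<^sup>+t. ennreal (p * t powr (p - 1)) * indicator {0..\<tau>} t \<partial>lborel)"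
    by (rule nn_integral_cmult) measurable
  also have "(\<integral>\<^sup>+t. ennreal (p * t powr (p - 1)) * indicator {0..\<tau>} t \<partial>lborel) = ennreal (\<tau> powr p)"
  proof -
    have "((\<lambda>t. p * t powr (p - 1)) has_integral (p * (\<tau> powr (p - 1 + 1) / (p - 1 + 1)))) {0..\<tau>}"
      using p \<tau> by (intro has_integral_mult_right has_integral_powr_from_0) auto
    then have "((\<lambda>t. p * t powr (p - 1)) has_integral (\<tau> powr p)) {0..\<tau>}" using p by simp
    then have "(\<integral>\<^sup>+t. ennreal (indicator {0..\<tau>} t * (p * t powr (p - 1))) \<partial>lborel) = ennreal (\<tau> powr p)"
      using p by (intro nn_integral_has_integral_lebesgue) auto
    moreover have "ennreal (indicator {0..\<tau>} t * (p * t powr (p - 1))) = ennreal (p * t powr (p - 1)) * indicator {0..\<tau>} t" for t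
      by (simp add: indicator_def)
    ultimately show ?thesis by simp
  qed
  finally show ?thesis by (simp add: ennreal_mult mult.commute)
qed

context multi_brownian_motion
begin

text \<open>Up to time \<open>1 / \<parallel>\<theta>\<parallel>\<^sup>2\<close>, the drift \<open>\<theta>\<close> changes the measure by a density
  whose inverse has bounded expectation.\<close>

lemma drifted_no_crossing_probability:
  assumes \<theta>: "\<theta> \<noteq> 0" and s: "s * (norm \<theta>)\<^sup>2 = 1" and a: "0 < a" "a < s"
    and c: "continuous_on {a..s} c" and p: "0 < p"
    and no: "p \<le> measure M {\<omega>\<in>space M. \<not> (\<exists>t\<in>{a..s}. crosses c (drifted 0 \<omega>) t)}"
  shows "p\<^sup>2 / (4 * exp 1) \<le> measure M {\<omega>\<in>space M. \<not> (\<exists>t\<in>{a..s}. crosses c (drifted \<theta> \<omega>) t)}"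
proof -
  let ?g = "dyadic_grid a s"
  let ?A = "\<lambda>\<theta> N. {\<omega>\<in>space M. \<forall>k\<in>{..2 ^ N}. \<not> crosses c (drifted \<theta> \<omega>) (?g N k)}"
  let ?Z = "\<lambda>\<omega>. exp (\<theta> \<bullet> W s \<omega> - (norm \<theta>)\<^sup>2 * s / 2)"
  \<comment> \<open>The inverse of \<open>?Z\<close> has expectation exp 1, because s |\<theta>|^2 =
    1. By Markov's inequality \<open>?Z\<close> is below \<epsilon> with probability at most
    \<epsilon> exp 1 = p / 2. At least p / 2 of the no-crossing event is left, with density at least
    \<epsilon>, and \<epsilon> p / 2 is the claimed bound.\<close>
  define \<epsilon> where "\<epsilon> = p / (2 * exp 1)"
  have \<epsilon>: "0 < \<epsilon>" using p by (simp add: \<epsilon>_def)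
  have s0: "0 < s" using a by simp
  have [measurable]: "W s \<in> borel_measurable M" using s0 by simp
  have Am [measurable]: "?A \<theta> N \<in> sets M" for \<theta> N
  proof -
    have [measurable]: "Measurable.pred M (\<lambda>\<omega>. crosses c (drifted \<theta> \<omega>) (?g N k))" for k
      using a by (intro pred_crosses dyadic_grid_nonneg) auto
    show ?thesis by measurable
  qed
  have AI: "(\<Inter>N. ?A \<theta> N) = {\<omega>\<in>space M. \<not> (\<exists>t\<in>{a..s}. crosses c (drifted \<theta> \<omega>) t)}" for \<theta>
  proof -
    have "(\<exists>t\<in>{a..s}. crosses c (drifted \<theta> \<omega>) t) \<longleftrightarrow> (\<exists>N. \<exists>k\<le>2 ^ N. crosses c (drifted \<theta> \<omega>) (?g N k))" if "\<omega> \<in> space M" for \<omega>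
      using a by (intro exists_crossing_dyadic continuous_on_drifted that c) auto
    then show ?thesis by (auto simp only: atMost_iff Ball_def)
  qed
  \<comment> \<open>Refining a dyadic grid keeps its points, so the events shrink and their
    probabilities tend to that of the no-crossing event.\<close>
  have Adec: "decseq (?A \<theta>)" for \<theta>
  proof (rule decseq_SucI, rule subsetI)
    fix N \<omega> assume *: "\<omega> \<in> ?A \<theta> (Suc N)"
    have "\<not> crosses c (drifted \<theta> \<omega>) (?g N k)" if "k \<le> 2 ^ N" for k
      using * that unfolding dyadic_grid_Suc[of a s N k] by simp
    with * show "\<omega> \<in> ?A \<theta> N" by simp
  qed
  have pA: "p \<le> measure M (?A 0 N)" for N
  proof -
    have "measure M {\<omega>\<in>space M. \<not> (\<exists>t\<in>{a..s}. crosses c (drifted 0 \<omega>) t)} \<le> measure M (?A 0 N)"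
      unfolding AI[symmetric] by (intro finite_measure_mono) auto
    with no show ?thesis by simp
  qed
  have small: "measure M {\<omega>\<in>space M. ?Z \<omega> < \<epsilon>} \<le> p / 2"
  proof -
    have "emeasure M {\<omega>\<in>space M. ?Z \<omega> < \<epsilon>} = (\<integral>\<^sup>+\<omega>. indicator {\<omega>\<in>space M. ?Z \<omega> < \<epsilon>} \<omega> \<partial>M)" by simp
    also have "\<dots> \<le> (\<integral>\<^sup>+\<omega>. ennreal (\<epsilon> * exp (1 / 2)) * ennreal (exp ((- \<theta>) \<bullet> W s \<omega>)) \<partial>M)"
    proof (rule nn_integral_mono)
      fix \<omega>
      have "1 \<le> \<epsilon> * exp (1 / 2) * exp ((- \<theta>) \<bullet> W s \<omega>)" if "?Z \<omega> < \<epsilon>"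
      proof -
        have "\<epsilon> * exp (1 / 2) * exp ((- \<theta>) \<bullet> W s \<omega>) = \<epsilon> / ?Z \<omega>"
        proof -
          have "(norm \<theta>)\<^sup>2 * s / 2 = 1 / 2" by (subst mult.commute) (simp only: s)
          then have "?Z \<omega> = exp (\<theta> \<bullet> W s \<omega>) / exp (1 / 2)" by (simp only: exp_diff)
          then show ?thesis
            by (simp only: inner_minus_left exp_minus divide_divide_eq_right) (simp only: divide_inverse)
        qed
        then show ?thesis using that by simp
      qed
      then show "(indicator {\<omega>\<in>space M. ?Z \<omega> < \<epsilon>} \<omega> :: ennreal) \<le> ennreal (\<epsilon> * exp (1 / 2)) * ennreal (exp ((- \<theta>) \<bullet> W s \<omega>))"
        using \<epsilon> by (auto simp: indicator_def ennreal_mult[symmetric] simp del: inner_minus_left ennreal_1 simp flip: ennreal_1 intro!: ennreal_leI)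
    qed
    also have "\<dots> = ennreal (\<epsilon> * exp (1 / 2)) * ennreal (exp (s * (norm (- \<theta>))\<^sup>2 / 2))"
      by (subst nn_integral_cmult) (simp_all only: nn_integral_exp_inner[OF s0], measurable)
    also have "\<dots> = ennreal (\<epsilon> * exp (1 / 2) * exp (1 / 2))"
      using \<epsilon> s by (simp add: ennreal_mult)
    also have "\<epsilon> * exp (1 / 2) * exp (1 / 2) = p / 2"
      by (simp add: \<epsilon>_def mult.assoc exp_add[symmetric])
    finally show ?thesis using p by (simp add: emeasure_eq_measure)
  qed
  have AN: "p\<^sup>2 / (4 * exp 1) \<le> measure M (?A \<theta> N)" for N
  proof -
    define k where "k = (2::nat) ^ N"
    define t where "t i = (case i of 0 \<Rightarrow> 0 | Suc i \<Rightarrow> ?g N i)" for i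
    have t: "t 0 = 0" "\<And>i. i < Suc k \<Longrightarrow> t i < t (Suc i)" "0 < Suc k"
      using a dyadic_grid_less[OF a(2)] by (auto simp: t_def split: nat.split)
    have tk: "t (Suc k) = s" by (simp add: t_def k_def dyadic_grid_def)
    define F where "F q = (of_bool (\<forall>i\<in>{..k}. \<not> ?g N i * c (?g N i) < (norm (q (Suc i)))\<^sup>2) :: ennreal)" for q :: "nat \<Rightarrow> real ^ 'n"
    have F: "F \<in> borel_measurable (PiM {..Suc k} (\<lambda>_. borel))"
    proof -
      have [measurable]: "(\<lambda>p. p (Suc i)) \<in> borel_measurable (PiM {..Suc k} (\<lambda>_. borel :: (real ^ 'n) measure))" if "i \<in> {..k}" for i
        by (rule measurable_component_singleton) (use that in auto)
      show ?thesis unfolding F_def by measurable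
    qed
    have Fx: "F (\<lambda>i\<in>{..Suc k}. W (t i) \<omega> + t i *\<^sub>R \<theta>) = indicator (?A \<theta> N) \<omega>" if "\<omega> \<in> space M" for \<theta> \<omega>
      using that unfolding F_def crosses_def drifted_def k_def[symmetric] by (auto simp: t_def)
    have "ennreal (\<epsilon> * (p - p / 2)) \<le> ennreal (\<epsilon> * measure M (?A 0 N \<inter> {\<omega>\<in>space M. \<epsilon> \<le> ?Z \<omega>}))"
    proof (intro ennreal_leI mult_left_mono)
      have "measure M (?A 0 N) \<le> measure M ((?A 0 N \<inter> {\<omega>\<in>space M. \<epsilon> \<le> ?Z \<omega>}) \<union> {\<omega>\<in>space M. ?Z \<omega> < \<epsilon>})"
        by (rule finite_measure_mono) (auto simp: not_less)
      also have "\<dots> \<le> measure M (?A 0 N \<inter> {\<omega>\<in>space M. \<epsilon> \<le> ?Z \<omega>}) + measure M {\<omega>\<in>space M. ?Z \<omega> < \<epsilon>}"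
        by (rule measure_Un_le) measurable
      finally show "p - p / 2 \<le> measure M (?A 0 N \<inter> {\<omega>\<in>space M. \<epsilon> \<le> ?Z \<omega>})"
        using pA[of N] small by simp
    qed (use \<epsilon> in simp)
    also have "\<dots> = (\<integral>\<^sup>+\<omega>. ennreal \<epsilon> * indicator (?A 0 N \<inter> {\<omega>\<in>space M. \<epsilon> \<le> ?Z \<omega>}) \<omega> \<partial>M)"
      using \<epsilon> by (subst nn_integral_cmult_indicator) (auto simp: emeasure_eq_measure ennreal_mult)
    also have "\<dots> \<le> (\<integral>\<^sup>+\<omega>. F (\<lambda>i\<in>{..Suc k}. W (t i) \<omega>) * ennreal (?Z \<omega>) \<partial>M)"
    proof (rule nn_integral_mono)
      fix \<omega> assume "\<omega> \<in> space M"
      from Fx[OF this, of 0] show "ennreal \<epsilon> * indicator (?A 0 N \<inter> {\<omega>\<in>space M. \<epsilon> \<le> ?Z \<omega>}) \<omega> \<le> F (\<lambda>i\<in>{..Suc k}. W (t i) \<omega>) * ennreal (?Z \<omega>)"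
        by (auto simp: indicator_def intro!: ennreal_leI)
    qed
    also have "\<dots> = (\<integral>\<^sup>+\<omega>. F (\<lambda>i\<in>{..Suc k}. W (t i) \<omega> + t i *\<^sub>R \<theta>) \<partial>M)"
      using cameron_martin_grid[OF t F, of \<theta>] by (simp only: tk)
    also have "\<dots> = (\<integral>\<^sup>+\<omega>. indicator (?A \<theta> N) \<omega> \<partial>M)" by (rule nn_integral_cong) (rule Fx)
    also have "\<dots> = ennreal (measure M (?A \<theta> N))" by (subst nn_integral_indicator) (auto simp: emeasure_eq_measure)
    finally have "\<epsilon> * (p - p / 2) \<le> measure M (?A \<theta> N)" by (subst (asm) ennreal_le_iff) auto
    then show ?thesis by (simp add: \<epsilon>_def power2_eq_square)
  qed
  have "(\<lambda>N. measure M (?A \<theta> N)) \<longlonglongrightarrow> measure M (\<Inter>N. ?A \<theta> N)"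
    by (rule finite_Lim_measure_decseq[OF _ Adec]) auto
  then show ?thesis unfolding AI by (rule LIMSEQ_le_const) (use AN in blast)
qed


text \<open>Triangle inequality in units of sqrt \<delta>: the drift alone exceeds the boundary by
  more than sqrt k, so staying below it forces |W| > sqrt (k \<delta>) at time \<delta>.\<close>

lemma drifted_crosses_at_end:
  assumes \<theta>: "norm \<theta> * sqrt \<delta> > sqrt (c \<delta>) + sqrt k" and \<delta>: "0 < \<delta>" "0 \<le> c \<delta>" and k: "1 < k"
    and n: "\<not> crosses c (drifted \<theta> \<omega>) \<delta>"
  shows "crosses (\<lambda>_. k) (drifted 0 \<omega>) \<delta>"
proof -
  have "(norm (drifted \<theta> \<omega> \<delta>))\<^sup>2 \<le> \<delta> * c \<delta>" using n by (simp add: crosses_def)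
  then have "norm (drifted \<theta> \<omega> \<delta>) \<le> sqrt \<delta> * sqrt (c \<delta>)"
    by (simp add: real_le_rsqrt flip: real_sqrt_mult)
  moreover have "norm (\<delta> *\<^sub>R \<theta>) \<le> norm (drifted \<theta> \<omega> \<delta>) + norm (W \<delta> \<omega>)"
    unfolding drifted_def using norm_triangle_ineq4[of "W \<delta> \<omega> + \<delta> *\<^sub>R \<theta>" "W \<delta> \<omega>"] by simp
  moreover have "norm (\<delta> *\<^sub>R \<theta>) = sqrt \<delta> * (norm \<theta> * sqrt \<delta>)"
    using \<delta> by (simp add: mult.left_commute[of "sqrt \<delta>"])
  moreover have "sqrt \<delta> * (sqrt (c \<delta>) + sqrt k) < sqrt \<delta> * (norm \<theta> * sqrt \<delta>)"
    using \<theta> \<delta> by (intro mult_strict_left_mono) auto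
  ultimately have "sqrt \<delta> * sqrt k < norm (W \<delta> \<omega>)" unfolding distrib_left by linarith
  then have "(sqrt \<delta> * sqrt k)\<^sup>2 < (norm (W \<delta> \<omega>))\<^sup>2"
    using \<delta> k by (intro power_strict_mono) auto
  then show ?thesis using \<delta> k by (simp add: crosses_def drifted_def power_mult_distrib)
qed

text \<open>The opposite use of the triangle inequality: where the drift stays sqrt k below the
  boundary, a crossing must be supplied by the noise.\<close>

lemma drifted_crosses_imp:
  assumes t: "0 < t" and cr: "crosses c (drifted \<theta> \<omega>) t" and k: "0 \<le> k" and ct: "0 \<le> c t"
    and le: "sqrt k + norm \<theta> * sqrt t \<le> sqrt (c t)"
  shows "crosses (\<lambda>_. k) (drifted 0 \<omega>) t"
proof -
  have "t * c t < (norm (drifted \<theta> \<omega> t))\<^sup>2" using cr by (simp add: crosses_def)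
  then have "sqrt t * sqrt (c t) < norm (drifted \<theta> \<omega> t)"
    by (metis real_sqrt_mult real_sqrt_less_mono norm_ge_zero real_sqrt_abs abs_of_nonneg)
  moreover have "norm (drifted \<theta> \<omega> t) \<le> norm (W t \<omega>) + norm (t *\<^sub>R \<theta>)"
    unfolding drifted_def by (rule norm_triangle_ineq)
  moreover have "norm (t *\<^sub>R \<theta>) = sqrt t * (norm \<theta> * sqrt t)"
    using t by (simp add: mult.left_commute[of "sqrt t"])
  moreover have "sqrt t * (sqrt k + norm \<theta> * sqrt t) \<le> sqrt t * sqrt (c t)"
    using le t by (intro mult_left_mono) auto
  ultimately have "sqrt t * sqrt k < norm (W t \<omega>)" unfolding distrib_left by linarith
  then have "(sqrt t * sqrt k)\<^sup>2 < (norm (W t \<omega>))\<^sup>2"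
    using t k by (intro power_strict_mono) auto
  then show ?thesis using t k by (simp add: crosses_def drifted_def power_mult_distrib)
qed

lemma crossing_probability_bound:
  obtains K where "0 < K" "\<And>a b k. 0 < a \<Longrightarrow> a \<le> b \<Longrightarrow> 1 < k \<Longrightarrow>
    measure M {\<omega>\<in>space M. \<exists>t\<in>{a..b}. crosses (\<lambda>_. k) (drifted 0 \<omega>) t}
      \<le> K * (b / a) powr (CARD('n) / 2) * k powr (CARD('n) / 2) * exp (- k / 2)"
proof
  have "0 \<le> unit_ball_vol CARD('n) / (2 * pi) powr (CARD('n) / 2)" by simp
  then show "0 < exp (1 / 2) + unit_ball_vol CARD('n) / (2 * pi) powr (CARD('n) / 2)"
    by (intro add_pos_nonneg) auto
qed (rule crossing_probability_le)

text \<open>From the no-crossing probability q up to s = 1 / |\<theta>|^2 three failures are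
  subtracted: a crossing between s and t / 2, a crossing between t / 2 and t, and no crossing at
  \<delta>. Each costs at most q / 8 by the bound for constant boundaries. On the first interval the
  ratio of the end points is bounded only by c t, but the drift reaches at most sqrt (c t) / sqrt 2
  in units of the square root of time; the noise must supply the fraction 1 - 1 / sqrt 2, whose
  square is \<kappa>, and the exponential in \<kappa> c(t) beats the powers of c t. On the second
  interval the ratio is at most 2, and a fixed excess k suffices.\<close>

lemma late_crossing_probability:
  fixes c :: "real \<Rightarrow> real" and \<kappa> :: real
  defines "\<kappa> \<equiv> (1 - 1 / sqrt 2)\<^sup>2"
  assumes K: "0 < K" "\<And>a b k. 0 < a \<Longrightarrow> a \<le> b \<Longrightarrow> 1 < k \<Longrightarrow>
      measure M {\<omega>\<in>space M. \<exists>t\<in>{a..b}. crosses (\<lambda>_. k) (drifted 0 \<omega>) t}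
        \<le> K * (b / a) powr (CARD('n) / 2) * k powr (CARD('n) / 2) * exp (- k / 2)"
    and s: "s * (norm \<theta>)\<^sup>2 = 1" and a: "0 < a" "a < s" "s \<le> \<delta>" and t: "0 < t" "t \<le> \<delta>" "a \<le> t"
    and c: "continuous_on {a..\<delta>} c" and dec: "\<And>r r'. 0 < r \<Longrightarrow> r \<le> r' \<Longrightarrow> r' \<le> \<delta> \<Longrightarrow> c r' \<le> c r"
    and pos: "\<And>r. 0 < r \<Longrightarrow> r \<le> \<delta> \<Longrightarrow> 0 \<le> c r"
    and no: "q \<le> measure M {\<omega>\<in>space M. \<not> (\<exists>r\<in>{a..s}. crosses c (drifted \<theta> \<omega>) r)}"
    and \<theta>t: "norm \<theta> * sqrt t \<le> sqrt (c t) - sqrt k" and \<theta>\<delta>: "sqrt (c \<delta>) + sqrt k < norm \<theta> * sqrt \<delta>"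
    and k: "1 < k" "K * 2 powr (CARD('n) / 2) * k powr (CARD('n) / 2) * exp (- k / 2) \<le> q / 8"
    and ct: "1 < \<kappa> * c t"
      "K * c t powr (CARD('n) / 2) * (\<kappa> * c t) powr (CARD('n) / 2) * exp (- (\<kappa> * c t) / 2) \<le> q / 8"
  shows "q / 2 \<le> measure M {\<omega>\<in>space M. \<not> (\<exists>r\<in>{a..t}. crosses c (drifted \<theta> \<omega>) r) \<and> crosses c (drifted \<theta> \<omega>) \<delta>}"
proof -
  let ?A = "{\<omega>\<in>space M. \<not> (\<exists>r\<in>{a..s}. crosses c (drifted \<theta> \<omega>) r)}"
  let ?G = "{\<omega>\<in>space M. \<not> (\<exists>r\<in>{a..t}. crosses c (drifted \<theta> \<omega>) r) \<and> crosses c (drifted \<theta> \<omega>) \<delta>}"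
  let ?B = "\<lambda>x y k. {\<omega>\<in>space M. \<exists>r\<in>{x..y}. crosses (\<lambda>_. k) (drifted 0 \<omega>) r}"
  let ?p = "real CARD('n) / 2"
  have \<kappa>: "0 < \<kappa>" "sqrt \<kappa> = 1 - 1 / sqrt 2" by (auto simp: \<kappa>_def)
  have s0: "0 < s" and \<delta>0: "0 < \<delta>" using a by auto
  have \<theta>t': "norm \<theta> * sqrt t \<le> sqrt (c t)" using \<theta>t k(1) real_sqrt_ge_zero[of k] by linarith
  have q0: "0 \<le> q / 8"
    using K(1) by (intro order_trans[OF _ k(2)] mult_nonneg_nonneg) auto
  have ct0: "0 < c t" using ct(1) \<kappa>(1) by (smt (verit) mult_nonneg_nonpos)
  have B2: "measure M (?B s (t / 2) (\<kappa> * c t)) \<le> q / 8"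
  proof (cases "s \<le> t / 2")
    case True
    have "t * (norm \<theta>)\<^sup>2 = (norm \<theta> * sqrt t)\<^sup>2" using t by (simp add: power_mult_distrib)
    also have "\<dots> \<le> (sqrt (c t))\<^sup>2" using \<theta>t' t by (intro power_mono) auto
    finally have "t * (norm \<theta>)\<^sup>2 \<le> c t" using ct0 by simp
    moreover have "t / 2 / s = t * (norm \<theta>)\<^sup>2 / 2" using s s0 by (simp add: field_simps)
    ultimately have "t / 2 / s \<le> c t" using ct0 by linarith
    have "measure M (?B s (t / 2) (\<kappa> * c t)) \<le> K * (t / 2 / s) powr ?p * (\<kappa> * c t) powr ?p * exp (- (\<kappa> * c t) / 2)"
      by (rule K(2)[OF s0 True ct(1)])
    also have "\<dots> \<le> K * c t powr ?p * (\<kappa> * c t) powr ?p * exp (- (\<kappa> * c t) / 2)"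
      using K(1) \<open>t / 2 / s \<le> c t\<close> s0 t by (intro mult_right_mono mult_left_mono powr_mono2) auto
    finally show ?thesis using ct(2) by simp
  next
    case False
    then have "?B s (t / 2) (\<kappa> * c t) = {}" by auto
    then show ?thesis using q0 by (simp only: measure_empty)
  qed
  have B3: "measure M (?B (t / 2) t k) \<le> q / 8"
    using K(2)[of "t / 2" t k] k t by simp
  have B4: "measure M (?B \<delta> \<delta> k) \<le> q / 8"
  proof -
    have "measure M (?B \<delta> \<delta> k) \<le> K * 1 * k powr ?p * exp (- k / 2)"
      using K(2)[of \<delta> \<delta> k] k \<delta>0 by simp
    also have "\<dots> \<le> K * 2 powr ?p * k powr ?p * exp (- k / 2)"
      using K(1) by (intro mult_right_mono mult_left_mono ge_one_powr_ge_zero) auto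
    finally show ?thesis using k(2) by simp
  qed
  have sub: "?A \<subseteq> ?G \<union> (?B s (t / 2) (\<kappa> * c t) \<union> (?B (t / 2) t k \<union> ?B \<delta> \<delta> k))"
  proof
    fix \<omega> assume \<omega>: "\<omega> \<in> ?A"
    show "\<omega> \<in> ?G \<union> (?B s (t / 2) (\<kappa> * c t) \<union> (?B (t / 2) t k \<union> ?B \<delta> \<delta> k))"
    proof (cases "crosses c (drifted \<theta> \<omega>) \<delta>")
      case False
      then have "crosses (\<lambda>_. k) (drifted 0 \<omega>) \<delta>"
        using drifted_crosses_at_end[where c=c, OF \<theta>\<delta> \<delta>0 pos[OF \<delta>0 order_refl] k(1)] by simp
      then show ?thesis using \<omega> by simp
    next
      case True
      show ?thesis
      proof (cases "\<exists>r\<in>{a..t}. crosses c (drifted \<theta> \<omega>) r")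
        case False then show ?thesis using \<omega> True by blast
      next
        case cr: True
        then obtain r where r: "r \<in> {a..t}" "crosses c (drifted \<theta> \<omega>) r" by auto
        have rs: "s < r" using \<omega> r a by (smt (verit, best) atLeastAtMost_iff mem_Collect_eq)
        have r0: "0 < r" "r \<le> \<delta>" using rs s0 r t by auto
        have cr: "sqrt (c t) \<le> sqrt (c r)" using dec[of r t] r0 r t by simp
        show ?thesis
        proof (cases "r \<le> t / 2")
          case True
          have "norm \<theta> * sqrt r \<le> norm \<theta> * sqrt (t / 2)" using True by (intro mult_left_mono) auto
          also have "\<dots> = (norm \<theta> * sqrt t) / sqrt 2" by (simp add: real_sqrt_divide)
          also have "\<dots> \<le> sqrt (c t) / sqrt 2" using \<theta>t' by (intro divide_right_mono) auto
          finally have "sqrt (\<kappa> * c t) + norm \<theta> * sqrt r \<le> (1 - 1 / sqrt 2) * sqrt (c t) + sqrt (c t) / sqrt 2"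
            by (simp add: real_sqrt_mult \<kappa>)
          also have "\<dots> = sqrt (c t)" by (simp add: algebra_simps)
          finally have "crosses (\<lambda>_. \<kappa> * c t) (drifted 0 \<omega>) r"
            using drifted_crosses_imp[where c=c, OF r0(1) r(2), of "\<kappa> * c t"] ct(1) pos[OF r0] cr by simp
          then show ?thesis using \<omega> rs True by auto
        next
          case False
          have "norm \<theta> * sqrt r \<le> norm \<theta> * sqrt t" using r by (intro mult_left_mono) auto
          then have "crosses (\<lambda>_. k) (drifted 0 \<omega>) r"
            using drifted_crosses_imp[where c=c, OF r0(1) r(2), of k] k(1) \<theta>t pos[OF r0] cr by simp
          then show ?thesis using \<omega> r False by auto
        qed
      qed
    qed
  qed
  have m1 [measurable]: "Measurable.pred M (\<lambda>\<omega>. \<exists>r\<in>{a..t}. crosses c (drifted \<theta> \<omega>) r)"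
    using a t by (intro pred_exists_crossing continuous_on_subset[OF c]) auto
  have m2 [measurable]: "Measurable.pred M (\<lambda>\<omega>. crosses c (drifted \<theta> \<omega>) \<delta>)" using \<delta>0 by simp
  have m3: "?B x y k \<in> sets M" if "0 < x" for x y k
  proof (cases "x \<le> y")
    case True
    then have "Measurable.pred M (\<lambda>\<omega>. \<exists>r\<in>{x..y}. crosses (\<lambda>_. k) (drifted 0 \<omega>) r)"
      using that by (intro pred_exists_crossing) auto
    then show ?thesis by measurable
  next
    case False then have "?B x y k = {}" by auto then show ?thesis by (simp only: sets.empty_sets)
  qed
  have G: "?G \<in> sets M" by measurable
  note B = m3[OF s0] m3[of "t / 2"] m3[OF \<delta>0]
  have B': "?B (t / 2) t k \<in> sets M" using t by (intro m3) auto
  have "q \<le> measure M ?A" by (rule no)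
  also have "\<dots> \<le> measure M (?G \<union> (?B s (t / 2) (\<kappa> * c t) \<union> (?B (t / 2) t k \<union> ?B \<delta> \<delta> k)))"
    by (rule finite_measure_mono[OF sub]) (intro sets.Un G B(1) B' B(3))
  also have "\<dots> \<le> measure M ?G + measure M (?B s (t / 2) (\<kappa> * c t) \<union> (?B (t / 2) t k \<union> ?B \<delta> \<delta> k))"
    by (rule measure_Un_le) (intro sets.Un G B(1) B' B(3))+
  also have "measure M (?B s (t / 2) (\<kappa> * c t) \<union> (?B (t / 2) t k \<union> ?B \<delta> \<delta> k)) \<le>
      measure M (?B s (t / 2) (\<kappa> * c t)) + measure M (?B (t / 2) t k \<union> ?B \<delta> \<delta> k)"
    by (rule measure_Un_le) (intro sets.Un B(1) B' B(3))+
  also have "measure M (?B (t / 2) t k \<union> ?B \<delta> \<delta> k) \<le> measure M (?B (t / 2) t k) + measure M (?B \<delta> \<delta> k)"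
    by (rule measure_Un_le) (intro B' B(3))+
  \<comment> \<open>Three losses of q / 8 leave 5 q / 8; \<open>q0\<close> adds that q is
    nonnegative.\<close>
  finally show ?thesis using B2 B3 B4 q0 by simp
qed

text \<open>On the event whose probability is at least q, the first crossing lies in [t, \<delta>],
  where the power is at least t^p and c is at most c t.\<close>

lemma crossing_weight_integral_ge:
  assumes a: "0 < a" "a \<le> t" "t \<le> \<delta>" and c: "continuous_on {a..\<delta>} c"
    and dec: "\<And>r. t \<le> r \<Longrightarrow> r \<le> \<delta> \<Longrightarrow> c r \<le> c t" and p: "0 \<le> p"
    and q: "q \<le> measure M {\<omega>\<in>space M. \<not> (\<exists>r\<in>{a..t}. crosses c (drifted \<theta> \<omega>) r) \<and> crosses c (drifted \<theta> \<omega>) \<delta>}"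
  shows "ennreal (q * (t powr p * exp (- c t / 2))) \<le> (\<integral>\<^sup>+\<omega>. ennreal (crossing_weight c p a \<delta> (drifted \<theta> \<omega>)) \<partial>M)"
proof -
  let ?G = "{\<omega>\<in>space M. \<not> (\<exists>r\<in>{a..t}. crosses c (drifted \<theta> \<omega>) r) \<and> crosses c (drifted \<theta> \<omega>) \<delta>}"
  have m1 [measurable]: "Measurable.pred M (\<lambda>\<omega>. \<exists>r\<in>{a..t}. crosses c (drifted \<theta> \<omega>) r)"
    using a by (intro pred_exists_crossing continuous_on_subset[OF c]) auto
  have m2 [measurable]: "Measurable.pred M (\<lambda>\<omega>. crosses c (drifted \<theta> \<omega>) \<delta>)" using a by simp
  have "ennreal (q * (t powr p * exp (- c t / 2))) \<le> ennreal (measure M ?G * (t powr p * exp (- c t / 2)))"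
    using q by (intro ennreal_leI mult_right_mono) auto
  also have "\<dots> = (\<integral>\<^sup>+\<omega>. ennreal (t powr p * exp (- c t / 2)) * indicator ?G \<omega> \<partial>M)"
    by (subst nn_integral_cmult_indicator) (measurable, simp add: emeasure_eq_measure ennreal_mult mult.commute)
  also have "\<dots> \<le> (\<integral>\<^sup>+\<omega>. ennreal (crossing_weight c p a \<delta> (drifted \<theta> \<omega>)) \<partial>M)"
  proof (rule nn_integral_mono)
    fix \<omega>
    have "t powr p * exp (- c t / 2) \<le> crossing_weight c p a \<delta> (drifted \<theta> \<omega>)" if "\<omega> \<in> ?G"
    proof -
      let ?U = "{r\<in>{a..\<delta>}. crosses c (drifted \<theta> \<omega>) r}"
      have ex: "\<exists>r\<in>{a..\<delta>}. crosses c (drifted \<theta> \<omega>) r" using that a by (intro bexI[of _ \<delta>]) auto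
      have na: "\<not> crosses c (drifted \<theta> \<omega>) a" using that a by auto
      have "t \<le> Inf ?U"
      proof (rule cInf_greatest)
        show "?U \<noteq> {}" using ex by auto
        fix r assume "r \<in> ?U" then show "t \<le> r" using that by (cases "r \<le> t") auto
      qed
      moreover have "Inf ?U \<le> \<delta>" using first_crossing_in[OF ex] by simp
      ultimately show ?thesis
        using na ex a p dec[of "Inf ?U"] unfolding crossing_weight_def
        by (simp only: not_False_eq_True simp_thms if_True) (intro mult_mono powr_mono2, auto)
    qed
    then show "ennreal (t powr p * exp (- c t / 2)) * indicator ?G \<omega> \<le> ennreal (crossing_weight c p a \<delta> (drifted \<theta> \<omega>))"
      by (cases "\<omega> \<in> ?G") (auto intro: ennreal_leI)
  qed
  finally show ?thesis .
qed

end

text \<open>In dimension n \<ge> 1, 2 r \<le> R gives 2 r^n \<le> R^n, so removing the inner ball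
  costs at most half the volume.\<close>

lemma emeasure_norm_shell_ge:
  fixes r R :: real
  assumes "0 \<le> r" "2 * r \<le> R"
  shows "ennreal (unit_ball_vol CARD('n) / 2 * R ^ CARD('n)) \<le> emeasure lborel {x::real^'n::finite. r < norm x \<and> norm x \<le> R}"
proof -
  have R: "0 \<le> R" "r \<le> R" using assms by auto
  have "{x::real^'n. r < norm x \<and> norm x \<le> R} = cball 0 R - cball 0 r" by auto
  then have "emeasure lborel {x::real^'n. r < norm x \<and> norm x \<le> R} = emeasure lborel (cball (0::real^'n) R) - emeasure lborel (cball (0::real^'n) r)"
    using R emeasure_lborel_cball_finite[of "0::real^'n" r] by (simp add: emeasure_Diff subset_iff)
  also have "\<dots> = ennreal (unit_ball_vol CARD('n) * R ^ CARD('n) - unit_ball_vol CARD('n) * r ^ CARD('n))"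
    using R assms(1) by (simp add: emeasure_cball ennreal_minus)
  finally have eq: "emeasure lborel {x::real^'n. r < norm x \<and> norm x \<le> R} = \<dots>" .
  have "2 * r ^ CARD('n) \<le> 2 ^ CARD('n) * r ^ CARD('n)"
    using assms(1) self_le_power[of "2::real" "CARD('n)"] by (intro mult_right_mono) auto
  also have "\<dots> = (2 * r) ^ CARD('n)" by (simp add: power_mult_distrib)
  also have "\<dots> \<le> R ^ CARD('n)" using assms by (intro power_mono) auto
  finally have "unit_ball_vol CARD('n) * (2 * r ^ CARD('n)) \<le> unit_ball_vol CARD('n) * R ^ CARD('n)"
    by (intro mult_left_mono) auto
  then show ?thesis unfolding eq by (intro ennreal_leI) simp
qed

context multi_brownian_motion
begin

text \<open>The contrapositive of the divergent case. The mixture identity bounds the integral of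
  \<open>J \<theta>\<close> by (2 pi)^P, uniformly in the cut-off \<epsilon>. From below,
  \<open>J \<theta>\<close> is at least (q / 2) t^P exp (- c t / 2) at every t with r0 < |\<theta>|
  \<le> \<open>R t\<close>. Taking the last such t, bounding its value below by an integral over
  earlier times and exchanging the integrals brings in a shell volume of order (c t / t)^P, and with
  it the integrand in question.\<close>

lemma integral_finite_if_no_crossing:
  fixes c :: "real \<Rightarrow> real"
  assumes \<delta>: "0 < \<delta>" and c: "continuous_on {0<..\<delta>} c"
    and dec: "\<And>r r'. 0 < r \<Longrightarrow> r \<le> r' \<Longrightarrow> r' \<le> \<delta> \<Longrightarrow> c r' \<le> c r"
    and pos: "\<And>r. 0 < r \<Longrightarrow> r \<le> \<delta> \<Longrightarrow> 0 \<le> c r"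
    and lim: "filterlim c at_top (at_right 0)"
    and p: "0 < p"
    and no: "\<And>a. 0 < a \<Longrightarrow> a < \<delta> \<Longrightarrow> p \<le> measure M {\<omega>\<in>space M. \<not> (\<exists>t\<in>{a..\<delta>}. crosses c (drifted 0 \<omega>) t)}"
  shows "\<exists>d. 0 < d \<and> d \<le> \<delta> \<and>
    (\<integral>\<^sup>+t\<in>{0<..d}. ennreal (1 / t * c t powr (CARD('n) / 2) * exp (- c t / 2)) \<partial>lborel) < \<infinity>"
proof -
  define P where "P = real CARD('n) / 2"
  define \<omega>n where "\<omega>n = unit_ball_vol CARD('n)"
  define \<kappa> where "\<kappa> = (1 - 1 / sqrt 2 :: real)\<^sup>2"
  define q where "q = p\<^sup>2 / (4 * exp 1)"
  have P0: "0 < P" by (simp add: P_def)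
  have \<omega>n: "0 < \<omega>n" by (simp add: \<omega>n_def)
  have \<kappa>: "0 < \<kappa>" by (simp add: \<kappa>_def)
  have q: "0 < q" using p by (simp add: q_def)
  obtain K where K: "0 < K" "\<And>a b k. 0 < a \<Longrightarrow> a \<le> b \<Longrightarrow> 1 < k \<Longrightarrow>
    measure M {\<omega>\<in>space M. \<exists>t\<in>{a..b}. crosses (\<lambda>_. k) (drifted 0 \<omega>) t}
      \<le> K * (b / a) powr (CARD('n) / 2) * k powr (CARD('n) / 2) * exp (- k / 2)"
    using crossing_probability_bound by blast
  \<comment> \<open>An excess of noise that costs at most q / 8 over a time ratio of 2.\<close>
  obtain k where k: "1 < k" "K * 2 powr P * k powr P * exp (- k / 2) \<le> q / 8"
  proof -
    have "0 < q / 8 / (K * 2 powr P)" using q K(1) by simp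
    from order_tendstoD(2)[OF powr_times_exp_tendsto_0[of "1 / 2" P] this]
    have "eventually (\<lambda>k. k powr P * exp (- (1 / 2) * k) < q / 8 / (K * 2 powr P)) at_top" by simp
    then have "eventually (\<lambda>k. 1 < k \<and> k powr P * exp (- (1 / 2) * k) < q / 8 / (K * 2 powr P)) at_top"
      using eventually_gt_at_top[of 1] by eventually_elim auto
    then obtain k where k: "1 < k" "k powr P * exp (- (1 / 2) * k) < q / 8 / (K * 2 powr P)"
      using eventually_happens'[OF trivial_limit_at_top_linorder] by blast
    have "(K * 2 powr P) * (k powr P * exp (- (1 / 2) * k)) \<le> (K * 2 powr P) * (q / 8 / (K * 2 powr P))"
      using k K(1) by (intro mult_left_mono) auto
    also have "\<dots> = q / 8" using K(1) by simp
    finally show thesis using k(1) by (intro that[of k]) (simp_all add: mult_ac)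
  qed
  \<comment> \<open>Once c t is at least \<open>C0\<close>, crossings between s and t / 2 cost at
    most q / 8; there the noise threshold is \<kappa> c(t) and the time ratio is at most c
    t.\<close>
  obtain C0 where C0: "\<And>x. C0 \<le> x \<Longrightarrow> K * x powr P * (\<kappa> * x) powr P * exp (- (\<kappa> * x) / 2) \<le> q / 8"
  proof -
    have "0 < q / 8 / (K * \<kappa> powr P)" using q K(1) \<kappa> by simp
    from order_tendstoD(2)[OF powr_times_exp_tendsto_0[of "\<kappa> / 2" "P + P"] this]
    have "eventually (\<lambda>x. x powr (P + P) * exp (- (\<kappa> / 2) * x) < q / 8 / (K * \<kappa> powr P)) at_top" using \<kappa> by simp
    then have "eventually (\<lambda>x. K * x powr P * (\<kappa> * x) powr P * exp (- (\<kappa> * x) / 2) \<le> q / 8) at_top"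
      using eventually_gt_at_top[of 0]
    proof eventually_elim
      case (elim x)
      have "K * x powr P * (\<kappa> * x) powr P * exp (- (\<kappa> * x) / 2) = (K * \<kappa> powr P) * (x powr (P + P) * exp (- (\<kappa> / 2) * x))"
        using elim(2) \<kappa> by (simp add: powr_mult mult_ac flip: powr_add[of x P P])
      also have "\<dots> \<le> (K * \<kappa> powr P) * (q / 8 / (K * \<kappa> powr P))"
        using elim(1) K(1) by (intro mult_left_mono) auto
      also have "\<dots> = q / 8" using K(1) \<kappa> by simp
      finally show ?case .
    qed
    then show thesis using that by (auto simp: eventually_at_top_linorder)
  qed
  \<comment> \<open>Beyond this length the drift at \<delta> exceeds the boundary by more than sqrt
    k, in units of sqrt \<delta>.\<close>
  define r0 where "r0 = (sqrt (c \<delta>) + sqrt k) / sqrt \<delta>"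
  have r0: "0 < r0" using k(1) \<delta> pos[of \<delta>] by (auto simp: r0_def intro!: divide_pos_pos add_nonneg_pos)
  \<comment> \<open>The entries serve, in turn, the choice of \<open>C0\<close>, the condition 1 <
    \<kappa> c(t), the bound sqrt k \<le> sqrt (c t) / 2, and \<open>2 * r0 \<le> R t\<close>; the
    last also uses t \<le> 1, hence the 1 in \<open>d\<close>.\<close>
  define L where "L = Max {C0, 2 / \<kappa>, 4 * k, 16 * r0\<^sup>2}"
  have L: "C0 \<le> L" "2 / \<kappa> \<le> L" "4 * k \<le> L" "16 * r0\<^sup>2 \<le> L" by (auto simp: L_def)
  have "eventually (\<lambda>t. L \<le> c t) (at_right 0)" using lim by (auto simp: filterlim_at_top)
  then obtain d0 where d0: "0 < d0" "\<And>t. 0 < t \<Longrightarrow> t < d0 \<Longrightarrow> L \<le> c t"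
    by (auto simp: eventually_at_right_field)
  define d where "d = Min {d0 / 2, \<delta>, 1}"
  have d: "0 < d" "d < d0" "d \<le> \<delta>" "d \<le> 1" using d0(1) \<delta> by (auto simp: d_def)
  have cL: "L \<le> c t" if "0 < t" "t \<le> d" for t using d0(2)[of t] that d by simp
  \<comment> \<open>The largest drift length that is still sqrt k below the boundary at time t, in
    units of sqrt t.\<close>
  define R where "R t = (sqrt (c t) - sqrt k) / sqrt t" for t
  have R_ge: "sqrt (c t) / (2 * sqrt t) \<le> R t" "2 * r0 \<le> R t" "0 < c t" if t: "0 < t" "t \<le> d" for t
  proof -
    show ct: "0 < c t" using cL[OF t] L(3) k(1) by linarith
    have "sqrt (4 * k) \<le> sqrt (c t)" using cL[OF t] L(3) by simp
    then have "2 * sqrt k \<le> sqrt (c t)" by (simp add: real_sqrt_mult)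
    then have "sqrt (c t) / 2 / sqrt t \<le> R t" unfolding R_def using t by (intro divide_right_mono) auto
    then show 1: "sqrt (c t) / (2 * sqrt t) \<le> R t" by simp
    have "sqrt (16 * r0\<^sup>2) \<le> sqrt (c t)" using cL[OF t] L(4) by simp
    then have "4 * r0 \<le> sqrt (c t)" using r0 by (simp add: real_sqrt_mult)
    moreover have "sqrt (c t) / 2 \<le> sqrt (c t) / (2 * sqrt t)" using t d ct by (simp add: field_simps)
    ultimately show "2 * r0 \<le> R t" using 1 by linarith
  qed
  \<comment> \<open>The factors are the probability q / 2, the P from the derivative of t^P, half
    the unit ball volume from the shell, and 1 / 4 to the power P, because \<open>R t\<close> is at
    least sqrt (c t / (4 t)).\<close>
  define C where "C = q / 2 * P * (\<omega>n / 2) * (1 / 4) powr P"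
  have C: "0 < C" using q P0 \<omega>n by (simp add: C_def)
  let ?h = "\<lambda>t. ennreal (1 / t * c t powr P * exp (- c t / 2))"
  have bound: "ennreal C * (\<integral>\<^sup>+t\<in>{\<epsilon>..d}. ?h t \<partial>lborel) \<le> ennreal ((2 * pi) powr P)" 
    and meas: "(\<lambda>t. ?h t * indicator {\<epsilon>..d} t) \<in> borel_measurable lborel"
    if \<epsilon>: "0 < \<epsilon>" "\<epsilon> < d" for \<epsilon>
  proof -
    \<comment> \<open>The hypotheses control c on (0, \<delta>] only; cutting it off gives a
      function that is measurable on the whole line.\<close>
    define c1 where "c1 t = (if t \<in> {\<epsilon>..d} then c t else 0)" for t
    have c1 [measurable]: "c1 \<in> borel_measurable borel"
      unfolding c1_def using \<epsilon> d by (intro borel_measurable_continuous_on_if continuous_on_subset[OF c]) auto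
    have "(\<lambda>t. ?h t * indicator {\<epsilon>..d} t) = (\<lambda>t. ennreal (1 / t * c1 t powr P * exp (- c1 t / 2)) * indicator {\<epsilon>..d} t)"
      by (auto simp: c1_def indicator_def)
    also have "\<dots> \<in> borel_measurable lborel" by measurable
    finally show "(\<lambda>t. ?h t * indicator {\<epsilon>..d} t) \<in> borel_measurable lborel" .
    define R1 where "R1 t = (sqrt (c1 t) - sqrt k) / sqrt t" for t
    have R1 [measurable]: "R1 \<in> borel_measurable borel" unfolding R1_def by measurable
    have R1_eq: "R1 t = R t" "c1 t = c t" if "t \<in> {\<epsilon>..d}" for t using that by (auto simp: R1_def R_def c1_def)
    \<comment> \<open>Placed below s = 1 / |\<theta>|^2 for all relevant drifts at once: |\<theta>|
      \<le> \<open>R t\<close> with t \<ge> \<epsilon> gives |\<theta>|^2 \<epsilon> \<le>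
      \<open>c \<epsilon>\<close>, hence s \<ge> \<open>\<epsilon> / c \<epsilon>\<close>, which is
      2 a.\<close>
    define a where "a = \<epsilon> / (2 * c \<epsilon>)"
    have c\<epsilon>: "1 < c \<epsilon>" using cL[of \<epsilon>] \<epsilon> L(3) k(1) by linarith
    have a: "0 < a" "a < \<epsilon>" using \<epsilon> c\<epsilon> by (auto simp: a_def field_simps)
    have a\<delta>: "a < \<delta>" using a \<epsilon> d by simp
    have ca: "continuous_on {a..\<delta>} c" using a by (intro continuous_on_subset[OF c]) auto
    define J where "J \<theta> = (\<integral>\<^sup>+\<omega>. ennreal (crossing_weight c P a \<delta> (drifted \<theta> \<omega>)) \<partial>M)" for \<theta>
    have J: "ennreal (q / 2 * (t powr P * exp (- c t / 2))) \<le> J \<theta>"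
      if t: "t \<in> {\<epsilon>..d}" and \<theta>: "r0 < norm \<theta>" "norm \<theta> \<le> R t" for t \<theta>
    proof -
      have t0: "0 < t" "t \<le> d" "t \<le> \<delta>" "a \<le> t" using t \<epsilon> d a by auto
      have \<theta>0: "0 < norm \<theta>" using \<theta>(1) r0 by linarith
      define s where "s = 1 / (norm \<theta>)\<^sup>2"
      have s: "s * (norm \<theta>)\<^sup>2 = 1" "0 < s" using \<theta>0 by (auto simp: s_def)
      have \<theta>t: "norm \<theta> * sqrt t \<le> sqrt (c t) - sqrt k" using \<theta>(2) t0 by (simp add: R_def field_simps)
      have \<theta>\<delta>: "sqrt (c \<delta>) + sqrt k < norm \<theta> * sqrt \<delta>" using \<theta>(1) \<delta> by (simp add: r0_def field_simps)
      have "norm \<theta> * sqrt t \<le> sqrt (c t)" using \<theta>t k(1) real_sqrt_ge_zero[of k] by linarith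
      then have "(norm \<theta> * sqrt t)\<^sup>2 \<le> (sqrt (c t))\<^sup>2" using t0 by (intro power_mono) auto
      then have "(norm \<theta>)\<^sup>2 * t \<le> c t" using t0 R_ge(3)[of t] by (simp add: power_mult_distrib)
      also have "\<dots> \<le> c \<epsilon>" using dec[of \<epsilon> t] t t0 \<epsilon> by auto
      finally have "(norm \<theta>)\<^sup>2 * t \<le> c \<epsilon>" .
      moreover have "(norm \<theta>)\<^sup>2 * \<epsilon> \<le> (norm \<theta>)\<^sup>2 * t" using t by (intro mult_left_mono) auto
      ultimately have "(norm \<theta>)\<^sup>2 * \<epsilon> \<le> c \<epsilon>" by linarith
      then have "\<epsilon> / c \<epsilon> \<le> s" using \<theta>0 c\<epsilon> by (simp add: s_def field_simps)
      moreover have "a < \<epsilon> / c \<epsilon>" using \<epsilon> c\<epsilon> by (simp add: a_def field_simps)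
      ultimately have as: "a < s" by linarith
      \<comment> \<open>This puts s before \<delta>, so that the assumption of not crossing on
        [a, \<delta>] covers [a, s].\<close>
      have "1 < norm \<theta> * sqrt \<delta>" using \<theta>\<delta> k(1) real_sqrt_ge_zero[OF pos[OF \<delta> order_refl]] real_sqrt_ge_1_iff[of k] by linarith
      then have "1 < (norm \<theta> * sqrt \<delta>)\<^sup>2" by (rule one_less_power) simp
      then have "s \<le> \<delta>" using \<theta>0 \<delta> by (simp add: s_def power_mult_distrib field_simps)
      have "p \<le> measure M {\<omega>\<in>space M. \<not> (\<exists>t\<in>{a..\<delta>}. crosses c (drifted 0 \<omega>) t)}" by (rule no[OF a(1) a\<delta>])
      also have "\<dots> \<le> measure M {\<omega>\<in>space M. \<not> (\<exists>t\<in>{a..s}. crosses c (drifted 0 \<omega>) t)}"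
      proof (rule finite_measure_mono)
        have [measurable]: "Measurable.pred M (\<lambda>\<omega>. \<exists>t\<in>{a..s}. crosses c (drifted 0 \<omega>) t)"
          using a as \<open>s \<le> \<delta>\<close> by (intro pred_exists_crossing continuous_on_subset[OF ca]) auto
        show "{\<omega>\<in>space M. \<not> (\<exists>t\<in>{a..s}. crosses c (drifted 0 \<omega>) t)} \<in> sets M" by measurable
      qed (use \<open>s \<le> \<delta>\<close> in auto)
      finally have "q \<le> measure M {\<omega>\<in>space M. \<not> (\<exists>r\<in>{a..s}. crosses c (drifted \<theta> \<omega>) r)}"
        unfolding q_def using \<theta>0 s(1) a(1) as p \<open>s \<le> \<delta>\<close>
        by (intro drifted_no_crossing_probability continuous_on_subset[OF ca]) auto
      moreover have "1 < \<kappa> * c t"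
      proof -
        have "\<kappa> * (2 / \<kappa>) \<le> \<kappa> * c t" using L(2) cL[OF t0(1,2)] \<kappa> by (intro mult_left_mono) auto
        then show ?thesis using \<kappa> by simp
      qed
      moreover have "K * c t powr P * (\<kappa> * c t) powr P * exp (- (\<kappa> * c t) / 2) \<le> q / 8"
        using C0 L(1) cL[OF t0(1,2)] by simp
      ultimately have "q / 2 \<le> measure M {\<omega>\<in>space M. \<not> (\<exists>r\<in>{a..t}. crosses c (drifted \<theta> \<omega>) r) \<and> crosses c (drifted \<theta> \<omega>) \<delta>}"
        using late_crossing_probability[where c=c, OF K s(1) a(1) as \<open>s \<le> \<delta>\<close> t0(1,3,4) ca dec pos _ \<theta>t \<theta>\<delta> k(1)] k(2)
        unfolding \<kappa>_def P_def by blast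
      then show ?thesis unfolding J_def
        using a t0 P0 by (intro crossing_weight_integral_ge ca dec) auto
    qed
    let ?w = "\<lambda>t. ennreal (q / 2 * (P * t powr (P - 1) * exp (- c1 t / 2)))"
    \<comment> \<open>Integrated over t first, \<open>?f\<close> is bounded by
      \<open>J \<theta>\<close>; integrated over \<theta> first, it yields the volume of the shell
      between \<open>r0\<close> and \<open>R1 t\<close>.\<close>
    let ?f = "\<lambda>z :: (real ^ 'n) \<times> real. ?w (snd z) * indicator {\<epsilon>..d} (snd z) * indicator {z. r0 < norm (fst z) \<and> norm (fst z) \<le> R1 (snd z)} z"
    have inner: "(\<integral>\<^sup>+t. ?f (\<theta>, t) \<partial>lborel) \<le> J \<theta>" for \<theta> :: "real ^ 'n"
    proof (cases "r0 < norm \<theta> \<and> (\<exists>t\<in>{\<epsilon>..d}. norm \<theta> \<le> R t)")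
      case False
      then have zero: "?f (\<theta>, t) = 0" for t by (auto simp: indicator_def R1_eq)
      show ?thesis unfolding zero by simp
    next
      case True
      let ?T = "{t\<in>{\<epsilon>..d}. norm \<theta> \<le> R t}"
      have "continuous_on {\<epsilon>..d} R"
        unfolding R_def using \<epsilon> d by (intro continuous_intros continuous_on_subset[OF c]) auto
      then have "closed ?T"
        using continuous_on_closed_Collect_le[of "{\<epsilon>..d}" "\<lambda>_. norm \<theta>" R] by (simp add: continuous_on_const)
      moreover have "?T = {\<epsilon>..d} \<inter> ?T" by auto
      ultimately have "compact ?T" by (metis compact_Icc compact_Int_closed)
      \<comment> \<open>The last time at which \<theta> is admissible. All times that contribute for
        this \<theta> come no later, so their integral is bounded by the single value at
        \<open>t1\<close>.\<close>
      then obtain t1 where t1: "t1 \<in> ?T" "\<And>t. t \<in> ?T \<Longrightarrow> t \<le> t1"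
        using compact_attains_sup[of ?T] True by blast
      have t10: "0 < t1" "t1 \<le> d" using t1(1) \<epsilon> by auto
      have "(\<integral>\<^sup>+t. ?f (\<theta>, t) \<partial>lborel) \<le> (\<integral>\<^sup>+t. ennreal (q / 2) * (ennreal (P * t powr (P - 1) * exp (- c t / 2)) * indicator {0<..t1} t) \<partial>lborel)"
      proof (rule nn_integral_mono)
        fix t
        show "?f (\<theta>, t) \<le> ennreal (q / 2) * (ennreal (P * t powr (P - 1) * exp (- c t / 2)) * indicator {0<..t1} t)"
        proof (cases "t \<in> ?T")
          case True
          then show ?thesis using t1(2)[OF True] \<epsilon> q P0 by (simp add: R1_eq ennreal_mult'[symmetric] indicator_def)
        next
          case False
          then have zero: "?f (\<theta>, t) = 0" by (auto simp: indicator_def R1_eq)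
          show ?thesis unfolding zero by simp
        qed
      qed
      also have "\<dots> = ennreal (q / 2) * (\<integral>\<^sup>+t\<in>{0<..t1}. ennreal (P * t powr (P - 1) * exp (- c t / 2)) \<partial>lborel)"
      proof (rule nn_integral_cmult)
        define c2 where "c2 t = (if t \<in> {0<..t1} then c t else 0)" for t
        have [measurable]: "c2 \<in> borel_measurable borel"
          unfolding c2_def using t10 d by (intro borel_measurable_continuous_on_if continuous_on_subset[OF c]) auto
        have "(\<lambda>t. ennreal (P * t powr (P - 1) * exp (- c t / 2)) * indicator {0<..t1} t) =
            (\<lambda>t. ennreal (P * t powr (P - 1) * exp (- c2 t / 2)) * indicator {0<..t1} t)"
          by (auto simp: c2_def indicator_def)
        also have "\<dots> \<in> borel_measurable lborel" by measurable
        finally show "(\<lambda>t. ennreal (P * t powr (P - 1) * exp (- c t / 2)) * indicator {0<..t1} t) \<in> borel_measurable lborel" .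
      qed
      also have "\<dots> \<le> ennreal (q / 2) * ennreal (t1 powr P * exp (- c t1 / 2))"
        using t10 d by (intro mult_left_mono le_integral_power_times_decreasing P0 dec) auto
      also have "\<dots> = ennreal (q / 2 * (t1 powr P * exp (- c t1 / 2)))"
        using q by (subst ennreal_mult') simp_all
      also have "\<dots> \<le> J \<theta>" using t1(1) True by (intro J) auto
      finally show ?thesis .
    qed
    have "ennreal C * (\<integral>\<^sup>+t\<in>{\<epsilon>..d}. ?h t \<partial>lborel) = (\<integral>\<^sup>+t. ennreal C * (?h t * indicator {\<epsilon>..d} t) \<partial>lborel)"
      by (rule nn_integral_cmult[symmetric]) fact
    also have "\<dots> \<le> (\<integral>\<^sup>+t. \<integral>\<^sup>+\<theta>. ?f (\<theta>, t) \<partial>lborel \<partial>lborel)"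
    proof (rule nn_integral_mono)
      fix t
      show "ennreal C * (?h t * indicator {\<epsilon>..d} t) \<le> (\<integral>\<^sup>+\<theta>. ?f (\<theta>, t) \<partial>lborel)"
      proof (cases "t \<in> {\<epsilon>..d}")
        case True
        then have t: "0 < t" "t \<le> d" using \<epsilon> by auto
        have "(c t / (4 * t)) powr P = (sqrt (c t) / (2 * sqrt t)) ^ CARD('n)"
          using R_ge(3)[OF t] t sqrt_power_eq_powr[of "c t / (4 * t)" "CARD('n)"]
          by (simp add: P_def real_sqrt_divide real_sqrt_mult)
        also have "\<dots> \<le> R t ^ CARD('n)" using R_ge[OF t] t by (intro power_mono) auto
        finally have Rn: "(c t / (4 * t)) powr P \<le> R t ^ CARD('n)" .
        \<comment> \<open>The powers of t combine to t^(P-1) t^(-P) = 1 / t.\<close>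
        have "C * (1 / t * c t powr P * exp (- c t / 2)) = q / 2 * (P * t powr (P - 1) * exp (- c t / 2)) * (\<omega>n / 2 * (c t / (4 * t)) powr P)"
          using t R_ge(3)[OF t] by (simp add: C_def powr_divide powr_mult powr_diff field_simps)
        also have "\<dots> \<le> q / 2 * (P * t powr (P - 1) * exp (- c t / 2)) * (\<omega>n / 2 * R t ^ CARD('n))"
          using q P0 \<omega>n Rn by (intro mult_left_mono) auto
        finally have "ennreal C * ?h t \<le> ennreal (q / 2 * (P * t powr (P - 1) * exp (- c t / 2)) * (\<omega>n / 2 * R t ^ CARD('n)))"
          using C by (simp only: ennreal_mult'[symmetric] less_imp_le) (rule ennreal_leI)
        also have "\<dots> = ?w t * ennreal (\<omega>n / 2 * R t ^ CARD('n))"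
          using q P0 by (simp add: R1_eq(2)[OF True] ennreal_mult'[symmetric])
        also have "\<dots> \<le> ?w t * emeasure lborel {\<theta>::real^'n. r0 < norm \<theta> \<and> norm \<theta> \<le> R t}"
          unfolding \<omega>n_def using r0 R_ge(2)[OF t] by (intro mult_left_mono emeasure_norm_shell_ge) auto
        also have "\<dots> = (\<integral>\<^sup>+\<theta>. ?w t * indicator {\<theta>::real^'n. r0 < norm \<theta> \<and> norm \<theta> \<le> R t} \<theta> \<partial>lborel)"
          by (rule nn_integral_cmult_indicator[symmetric]) measurable
        also have "\<dots> = (\<integral>\<^sup>+\<theta>. ?f (\<theta>, t) \<partial>lborel)"
          by (rule nn_integral_cong) (use True in \<open>simp add: R1_eq indicator_def\<close>)
        finally show ?thesis using True by simp
      qed simp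
    qed
    also have "\<dots> = (\<integral>\<^sup>+\<theta>. \<integral>\<^sup>+t. ?f (\<theta>, t) \<partial>lborel \<partial>lborel)"
      by (rule lborel_pair.Fubini') measurable
    also have "\<dots> \<le> (\<integral>\<^sup>+\<theta>. J \<theta> \<partial>lborel)" by (intro nn_integral_mono inner)
    also have "\<dots> = (\<integral>\<^sup>+z. ennreal (crossing_weight c P a \<delta> (drifted (fst z) (snd z))) \<partial>(lborel \<Otimes>\<^sub>M M))"
      unfolding J_def using measurable_crossing_weight_pair[OF a(1) a\<delta> ca]
      by (subst nn_integral_fst[symmetric]) auto
    also have "\<dots> \<le> ennreal ((2 * pi) powr P)"
      unfolding P_def crossing_probability_eq[OF a(1) a\<delta> ca] by (intro ennreal_leI) (simp add: mult_left_le)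
    finally show "ennreal C * (\<integral>\<^sup>+t\<in>{\<epsilon>..d}. ?h t \<partial>lborel) \<le> ennreal ((2 * pi) powr P)" .
  qed
  have "(\<integral>\<^sup>+t\<in>{0<..d}. ?h t \<partial>lborel) \<le> ennreal ((2 * pi) powr P / C)"
  proof (rule nn_integral_Ioc_le[OF d(1) meas])
    fix \<epsilon> assume \<epsilon>: "0 < \<epsilon>" "\<epsilon> < d"
    have "(\<integral>\<^sup>+t\<in>{\<epsilon>..d}. ?h t \<partial>lborel) = ennreal (1 / C) * (ennreal C * (\<integral>\<^sup>+t\<in>{\<epsilon>..d}. ?h t \<partial>lborel))"
      using C by (simp add: mult.assoc[symmetric] ennreal_mult[symmetric])
    also have "\<dots> \<le> ennreal (1 / C) * ennreal ((2 * pi) powr P)" by (intro mult_left_mono bound \<epsilon>) auto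
    also have "\<dots> = ennreal ((2 * pi) powr P / C)" using C by (simp add: ennreal_mult[symmetric])
    finally show "(\<integral>\<^sup>+t\<in>{\<epsilon>..d}. ?h t \<partial>lborel) \<le> ennreal ((2 * pi) powr P / C)" .
  qed
  also have "\<dots> < \<infinity>" by simp
  finally show ?thesis using d unfolding P_def by blast
qed

end

section \<open>The convergent case\<close>

lemma nn_integral_lborel_scaleR:
  fixes h :: "'v::euclidean_space \<Rightarrow> ennreal"
  assumes "c \<noteq> 0" and [measurable]: "h \<in> borel_measurable borel"
  shows "(\<integral>\<^sup>+x. h x \<partial>lborel) = ennreal (\<bar>c\<bar> ^ DIM('v)) * (\<integral>\<^sup>+x. h (c *\<^sub>R x) \<partial>lborel)"
  by (subst lborel_affine[OF assms(1), of 0])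
     (simp add: nn_integral_density nn_integral_distr nn_integral_cmult)

text \<open>Computes the image of Lebesgue measure on the shell under y -> 1 / |y|^2 by comparing
  half-lines. Up to x in [a, 1] the image has the volume of the shell from 1 / sqrt x to 1 / sqrt a,
  that is, the unit ball volume times a^(-P) - x^(-P), whose derivative is the stated
  density.\<close>

lemma nn_integral_radial_inverse_square:
  fixes f :: "real \<Rightarrow> ennreal"
  assumes a: "0 < a" "a < 1" and f [measurable]: "f \<in> borel_measurable borel"
  defines "P \<equiv> real CARD('n::finite) / 2"
  shows "(\<integral>\<^sup>+y. f (1 / (norm y)\<^sup>2) * indicator {y. 1 \<le> norm y \<and> norm y \<le> 1 / sqrt a} y \<partial>(lborel :: (real^'n) measure)) =
    (\<integral>\<^sup>+t. f t * (ennreal (unit_ball_vol CARD('n) * (P * t powr (- P - 1))) * indicator {a..1} t) \<partial>lborel)"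
proof -
  let ?S = "{y::real^'n. 1 \<le> norm y \<and> norm y \<le> 1 / sqrt a}"
  let ?\<omega> = "unit_ball_vol CARD('n)"
  let ?w = "\<lambda>t. ennreal (?\<omega> * (P * t powr (- P - 1))) * indicator {a..1} t"
  define \<mu> where "\<mu> = distr (density lborel (indicator ?S)) borel (\<lambda>y. 1 / (norm y)\<^sup>2)"
  define \<nu> where "\<nu> = density lborel ?w"
  have P: "0 < P" by (simp add: P_def)
  have \<omega>: "0 < ?\<omega>" by simp
  have S [measurable]: "?S \<in> sets borel" by measurable
  have sets: "sets \<mu> = sets borel" "sets \<nu> = sets borel" by (simp_all add: \<mu>_def \<nu>_def)
  have shell: "emeasure lborel {y::real^'n. r \<le> norm y \<and> norm y \<le> R} = ennreal (?\<omega> * (R ^ CARD('n) - r ^ CARD('n)))"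
    if "0 < r" "r \<le> R" for r R
  proof -
    have "{y::real^'n. r \<le> norm y \<and> norm y \<le> R} = cball 0 R - ball 0 r" by auto
    then have "emeasure lborel {y::real^'n. r \<le> norm y \<and> norm y \<le> R} = emeasure lborel (cball (0::real^'n) R) - emeasure lborel (ball (0::real^'n) r)"
      using that emeasure_lborel_ball_finite[of "0::real^'n" r] by (simp add: emeasure_Diff subset_iff)
    also have "\<dots> = ennreal (?\<omega> * (R ^ CARD('n) - r ^ CARD('n)))"
      using that by (simp add: emeasure_cball emeasure_ball ennreal_minus right_diff_distrib)
    finally show ?thesis .
  qed
  have pw: "(1 / sqrt x) ^ CARD('n) = x powr (- P)" if "0 < x" for x
    using sqrt_power_eq_powr[of "1 / x" "CARD('n)"] that
    by (simp add: P_def real_sqrt_divide powr_divide powr_minus_divide)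
  have int: "(\<integral>\<^sup>+t. ennreal (?\<omega> * (P * t powr (- P - 1))) * indicator {a..x} t \<partial>lborel) = ennreal (?\<omega> * (a powr (- P) - x powr (- P)))"
    if "a \<le> x" for x
  proof -
    have "(\<integral>\<^sup>+t. ennreal (?\<omega> * (P * t powr (- P - 1))) * indicator {a..x} t \<partial>lborel) =
      ennreal (- (?\<omega> * x powr (- P)) - - (?\<omega> * a powr (- P)))"
    proof (rule nn_integral_FTC_Icc[where F = "\<lambda>t. - (?\<omega> * t powr (- P))"])
      fix t assume t: "t \<in> {a..x}"
      then have "0 < t" using a by auto
      then have "((\<lambda>t. - (?\<omega> * t powr (- P))) has_field_derivative (?\<omega> * (P * t powr (- P - 1)))) (at t)"
        by (auto intro!: derivative_eq_intros)
      then show "DERIV (\<lambda>t. - (?\<omega> * t powr (- P))) t :> ?\<omega> * (P * t powr (- P - 1))" .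
    next
      fix t :: real
      show "0 \<le> ?\<omega> * (P * t powr (- P - 1))" using P by simp
    qed (use that in auto)
    then show ?thesis by (simp add: right_diff_distrib)
  qed
  have em\<mu>: "emeasure \<mu> {..x} = (if x < a then 0 else ennreal (?\<omega> * (a powr (- P) - (min x 1) powr (- P))))" for x
  proof -
    have T [measurable]: "{y::real^'n. 1 / (norm y)\<^sup>2 \<le> x} \<in> sets borel" by measurable
    have "emeasure \<mu> {..x} = emeasure (density lborel (indicator ?S)) {y::real^'n. 1 / (norm y)\<^sup>2 \<le> x}"
      unfolding \<mu>_def by (subst emeasure_distr) (simp_all add: vimage_def)
    also have "\<dots> = (\<integral>\<^sup>+y. indicator ?S y * indicator {y::real^'n. 1 / (norm y)\<^sup>2 \<le> x} y \<partial>lborel)"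
      using S T by (intro emeasure_density) auto
    also have "\<dots> = (\<integral>\<^sup>+y. indicator ({y::real^'n. 1 / (norm y)\<^sup>2 \<le> x} \<inter> ?S) y \<partial>lborel)"
      by (rule nn_integral_cong) (auto simp: indicator_def)
    also have "\<dots> = emeasure lborel ({y::real^'n. 1 / (norm y)\<^sup>2 \<le> x} \<inter> ?S)"
      using S T by (intro nn_integral_indicator) auto
    \<comment> \<open>On the shell, 1 / |y|^2 takes values in [a, 1] only: a bound below a leaves
      nothing, and a bound above 1 acts like 1.\<close>
    also have "{y. 1 / (norm y)\<^sup>2 \<le> x} \<inter> ?S = (if x < a then {} else {y. 1 / sqrt (min x 1) \<le> norm y \<and> norm y \<le> 1 / sqrt a})"
    proof (cases "x < a")
      case True
      have "\<not> 1 / (norm y)\<^sup>2 \<le> x" if "y \<in> ?S" for y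
      proof -
        have "norm y * sqrt a \<le> 1" "0 < norm y" using that a by (auto simp: field_simps)
        then have "(norm y * sqrt a)\<^sup>2 \<le> 1" using a by (intro power_le_one) auto
        then have "a \<le> 1 / (norm y)\<^sup>2" using a \<open>0 < norm y\<close> by (simp add: power_mult_distrib field_simps)
        then show ?thesis using True by simp
      qed
      then show ?thesis using True by auto
    next
      case False
      then have x: "0 < x" "0 < min x 1" using a by auto
      have "1 / (norm y)\<^sup>2 \<le> x \<and> 1 \<le> norm y \<longleftrightarrow> 1 / sqrt (min x 1) \<le> norm y" for y :: "real^'n"
      proof -
        have "1 / sqrt (min x 1) \<le> norm y \<longleftrightarrow> sqrt (1 / min x 1) \<le> norm y" by (simp add: real_sqrt_divide)
        also have "\<dots> \<longleftrightarrow> 1 / min x 1 \<le> (norm y)\<^sup>2"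
          using real_sqrt_le_iff[of "1 / min x 1" "(norm y)\<^sup>2"] by simp
        also have "\<dots> \<longleftrightarrow> 1 / x \<le> (norm y)\<^sup>2 \<and> 1 \<le> (norm y)\<^sup>2"
        proof -
          have "1 / min x 1 = max (1 / x) 1" using x by (auto simp: min_def max_def field_simps)
          then show ?thesis by simp
        qed
        also have "1 \<le> (norm y)\<^sup>2 \<longleftrightarrow> 1 \<le> norm y" using real_sqrt_ge_1_iff[of "(norm y)\<^sup>2"] by simp
        finally have *: "1 / sqrt (min x 1) \<le> norm y \<longleftrightarrow> 1 / x \<le> (norm y)\<^sup>2 \<and> 1 \<le> norm y" .
        show ?thesis
        proof (cases "1 \<le> norm y")
          case True
          then have "0 < norm y" by linarith
          then have "0 < (norm y)\<^sup>2" by (rule zero_less_power)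
          then have "1 / (norm y)\<^sup>2 \<le> x \<longleftrightarrow> 1 / x \<le> (norm y)\<^sup>2" using x by (simp add: field_simps)
          then show ?thesis unfolding * by simp
        qed (simp add: *)
      qed
      then show ?thesis using False by auto
    qed
    also have "emeasure lborel \<dots> = (if x < a then 0 else ennreal (?\<omega> * (a powr (- P) - (min x 1) powr (- P))))"
      using a shell[of "1 / sqrt (min x 1)" "1 / sqrt a"] pw[of "min x 1"] pw[of a]
      by (auto simp: not_less frac_le)
    finally show ?thesis .
  qed
  have em\<nu>: "emeasure \<nu> {..x} = (if x < a then 0 else ennreal (?\<omega> * (a powr (- P) - (min x 1) powr (- P))))" for x
  proof -
    have "emeasure \<nu> {..x} = (\<integral>\<^sup>+t. ?w t * indicator {..x} t \<partial>lborel)"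
      unfolding \<nu>_def by (rule emeasure_density) auto
    also have "\<dots> = (\<integral>\<^sup>+t. ennreal (?\<omega> * (P * t powr (- P - 1))) * indicator {a..min x 1} t \<partial>lborel)"
      by (intro nn_integral_cong) (auto simp: indicator_def)
    also have "\<dots> = (if x < a then 0 else ennreal (?\<omega> * (a powr (- P) - (min x 1) powr (- P))))"
      using int[of "min x 1"] a by (auto simp: min_def not_less)
    finally show ?thesis .
  qed
  have em: "emeasure \<mu> {..x} = emeasure \<nu> {..x}" for x unfolding em\<mu> em\<nu> ..
  have UN: "(\<Union>i::nat. {..real i}) = (UNIV :: real set)" using real_arch_simple by auto
  have "\<mu> = \<nu>"
  proof (rule measure_eqI_generator_eq[where E="range atMost" and \<Omega>=UNIV and A="\<lambda>i::nat. {..real i}"])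
    show "Int_stable (range (atMost :: real \<Rightarrow> _))"
      by (auto simp: Int_stable_def intro: range_eqI)
    show "sets \<mu> = sigma_sets UNIV (range atMost)" "sets \<nu> = sigma_sets UNIV (range atMost)"
      unfolding sets by (simp_all add: borel_eq_atMost)
    show "emeasure \<mu> {..real i} \<noteq> \<infinity>" for i unfolding em\<mu> by simp
  qed (use em UN in auto)
  have "(\<integral>\<^sup>+y. f (1 / (norm y)\<^sup>2) * indicator ?S y \<partial>(lborel :: (real^'n) measure)) = (\<integral>\<^sup>+t. f t \<partial>\<mu>)"
    unfolding \<mu>_def by (subst nn_integral_distr) (auto simp: nn_integral_density mult.commute)
  also have "\<dots> = (\<integral>\<^sup>+t. f t * ?w t \<partial>lborel)"
    unfolding \<open>\<mu> = \<nu>\<close> \<nu>_def by (subst nn_integral_density) (auto simp: mult.commute)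
  finally show ?thesis .
qed

text \<open>At |y| = 1 and |y| = 1 / sqrt a the limiting crossing time sits at an end point of
  [a, 1], where large u alone does not decide whether the path crosses. These drifts form a null
  set.\<close>

lemma AE_norm_neq: "AE y in (lborel :: 'v::euclidean_space measure). norm y \<noteq> r"
proof -
  have "sphere (0::'v) r \<in> null_sets lborel"
    using negligible_sphere[of 0 r]
    by (auto simp: null_sets_completion_iff negligible_iff_null_sets negligible_convex_frontier)
  from AE_not_in[OF this] show ?thesis by eventually_elim auto
qed

lemma powr_eventually_dominated:
  fixes B C \<eta> :: real
  assumes "0 < \<eta>"
  shows "eventually (\<lambda>u. B + C * sqrt u < \<eta> * u) at_top"
  using assms by real_asymp

section \<open>First crossings for drifts of length proportional to sqrt u\<close>

context multi_brownian_motion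
begin

text \<open>With drift sqrt u y the squared norm is u t^2 |y|^2 up to an error of order sqrt u, and
  the boundary is u t up to a bounded error, uniformly on [a, 1] because W and g are bounded there.
  So for large u the sign of t |y|^2 - 1 decides.\<close>

lemma eventually_crossing_pattern:
  assumes a: "0 < a" "a < 1" and g: "continuous_on {a..1} g" and \<omega>: "\<omega> \<in> space M" and \<eta>: "0 < \<eta>"
  shows "eventually (\<lambda>u. \<forall>t\<in>{a..1}.
    (t * (norm y)\<^sup>2 \<le> 1 - \<eta> \<longrightarrow> \<not> crosses (\<lambda>t. g t + u) (drifted (sqrt u *\<^sub>R y) \<omega>) t) \<and>
    (1 + \<eta> \<le> t * (norm y)\<^sup>2 \<longrightarrow> crosses (\<lambda>t. g t + u) (drifted (sqrt u *\<^sub>R y) \<omega>) t)) at_top"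
proof -
  have "compact ((\<lambda>t. W t \<omega>) ` {a..1})"
    using a by (intro compact_continuous_image continuous_on_subset[OF continuous_paths_W[OF \<omega>]]) auto
  then obtain B where B: "\<And>t. t \<in> {a..1} \<Longrightarrow> norm (W t \<omega>) \<le> B"
    using compact_imp_bounded bounded_iff by (metis imageI)
  have "compact (g ` {a..1})" using g by (intro compact_continuous_image) auto
  then obtain G where G: "\<And>t. t \<in> {a..1} \<Longrightarrow> \<bar>g t\<bar> \<le> G"
    using compact_imp_bounded bounded_iff by (metis imageI real_norm_def)
  have B0: "0 \<le> B" using B[of 1] a norm_ge_zero order_trans by (metis atLeastAtMost_iff less_imp_le order_refl)
  have G0: "0 \<le> G" using G[of 1] a by (smt (verit) atLeastAtMost_iff)
  let ?\<rho> = "norm y"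
  \<comment> \<open>All error terms on the left, against the smallest margin, since u t \<eta> is at
    least a \<eta> u.\<close>
  have 1: "eventually (\<lambda>u. (B\<^sup>2 + G) + (2 * B * ?\<rho>) * sqrt u < (a * \<eta>) * u) at_top"
    using a \<eta> by (intro powr_eventually_dominated) simp
  from 1 eventually_ge_at_top[of 0] show ?thesis
  proof eventually_elim
    case (elim u)
    show ?case
    proof (intro ballI conjI impI)
      fix t assume t: "t \<in> {a..1}"
      have nrm: "norm (t *\<^sub>R (sqrt u *\<^sub>R y)) = sqrt u * t * ?\<rho>" using t a elim(2) by simp
      have tr: "2 * B * (sqrt u * t * ?\<rho>) \<le> (2 * B * ?\<rho>) * sqrt u"
      proof -
        have "(2 * B * ?\<rho> * sqrt u) * t \<le> (2 * B * ?\<rho> * sqrt u) * 1"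
          using t B0 elim(2) by (intro mult_left_mono) auto
        then show ?thesis by (simp add: mult_ac)
      qed
      have sq: "(sqrt u * t * ?\<rho>)\<^sup>2 = u * t * (t * ?\<rho>\<^sup>2)" using elim(2) by (simp add: power_mult_distrib power2_eq_square)
      have tg: "\<bar>t * g t\<bar> \<le> G"
      proof -
        have "\<bar>t * g t\<bar> \<le> 1 * G" unfolding abs_mult using t a G[OF t] by (intro mult_mono) auto
        then show ?thesis by simp
      qed
      have at: "(a * \<eta>) * u \<le> u * t * \<eta>"
      proof -
        have "(\<eta> * u) * a \<le> (\<eta> * u) * t" using t elim(2) \<eta> by (intro mult_left_mono) auto
        then show ?thesis by (simp add: mult_ac)
      qed
      {
        assume le: "t * ?\<rho>\<^sup>2 \<le> 1 - \<eta>"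
        have "norm (drifted (sqrt u *\<^sub>R y) \<omega> t) \<le> B + sqrt u * t * ?\<rho>"
          unfolding drifted_def using norm_triangle_ineq[of "W t \<omega>" "t *\<^sub>R sqrt u *\<^sub>R y"] B[OF t] unfolding nrm by linarith
        then have "(norm (drifted (sqrt u *\<^sub>R y) \<omega> t))\<^sup>2 \<le> (B + sqrt u * t * ?\<rho>)\<^sup>2"
          by (rule power_mono) simp
        also have "\<dots> = B\<^sup>2 + 2 * B * (sqrt u * t * ?\<rho>) + u * t * (t * ?\<rho>\<^sup>2)"
          unfolding power2_sum sq by simp
        also have "u * t * (t * ?\<rho>\<^sup>2) \<le> u * t * (1 - \<eta>)" using le t a elim(2) by (intro mult_left_mono) auto
        finally have "(norm (drifted (sqrt u *\<^sub>R y) \<omega> t))\<^sup>2 \<le> B\<^sup>2 + 2 * B * (sqrt u * t * ?\<rho>) + u * t * (1 - \<eta>)" by simp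
        then show "\<not> crosses (\<lambda>t. g t + u) (drifted (sqrt u *\<^sub>R y) \<omega>) t"
          using tr tg at elim(1) unfolding crosses_def by (simp add: algebra_simps abs_le_iff)
      next
        assume ge: "1 + \<eta> \<le> t * ?\<rho>\<^sup>2"
        have up: "u * t * (1 + \<eta>) \<le> u * t * (t * ?\<rho>\<^sup>2)" using ge t a elim(2) by (intro mult_left_mono) auto
        have lo: "sqrt u * t * ?\<rho> - B \<le> norm (drifted (sqrt u *\<^sub>R y) \<omega> t)"
          unfolding drifted_def using norm_diff_ineq[of "t *\<^sub>R sqrt u *\<^sub>R y" "W t \<omega>"] B[OF t]
          unfolding nrm add.commute[of "W t \<omega>"] by linarith
        have "B \<le> sqrt u * t * ?\<rho>"
        proof (rule power2_le_imp_le)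
          have "0 \<le> u * t" "0 \<le> 2 * B * ?\<rho> * sqrt u" using t a elim(2) B0 by auto
          then show "B\<^sup>2 \<le> (sqrt u * t * ?\<rho>)\<^sup>2"
            unfolding sq using up at elim(1) G0 by (simp add: algebra_simps)
        qed (use t a elim(2) in auto)
        then have "(sqrt u * t * ?\<rho> - B)\<^sup>2 \<le> (norm (drifted (sqrt u *\<^sub>R y) \<omega> t))\<^sup>2"
          using lo by (intro power_mono) auto
        moreover have "(sqrt u * t * ?\<rho> - B)\<^sup>2 = u * t * (t * ?\<rho>\<^sup>2) - 2 * B * (sqrt u * t * ?\<rho>) + B\<^sup>2"
          unfolding power2_diff sq by simp
        moreover have "u * t + u * t * \<eta> \<le> u * t * (t * ?\<rho>\<^sup>2)" using up by (simp only: distrib_left mult_1_right)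
        moreover have "0 \<le> B\<^sup>2" by simp
        ultimately have "u * t + t * g t < (norm (drifted (sqrt u *\<^sub>R y) \<omega> t))\<^sup>2"
          using tr tg at elim(1) by linarith
        then show "crosses (\<lambda>t. g t + u) (drifted (sqrt u *\<^sub>R y) \<omega>) t"
          unfolding crosses_def by (simp add: algebra_simps)
      }
    qed
  qed
qed

text \<open>The factor exp (u / 2) cancels the u in the boundary, so u enters only through the
  crossing. For |y| < 1 there is eventually no crossing by time 1; for |y| > 1 / sqrt a the path is
  eventually across at a; in between, the first crossing is squeezed between (1 - \<eta>) / |y|^2
  and (1 + \<eta>) / |y|^2.\<close>

lemma scaled_crossing_weight_limit:
  assumes a: "0 < a" "a < 1" and g: "continuous_on {a..1} g" and \<omega>: "\<omega> \<in> space M"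
    and y: "norm y \<noteq> 1" "norm y \<noteq> 1 / sqrt a"
  shows "((\<lambda>u. exp (u / 2) * crossing_weight (\<lambda>t. g t + u) p a 1 (drifted (sqrt u *\<^sub>R y) \<omega>)) \<longlongrightarrow>
    (if 1 \<le> norm y \<and> norm y \<le> 1 / sqrt a then (1 / (norm y)\<^sup>2) powr p * exp (- g (1 / (norm y)\<^sup>2) / 2) else 0)) at_top"
proof -
  let ?cr = "\<lambda>u. crosses (\<lambda>t. g t + u) (drifted (sqrt u *\<^sub>R y) \<omega>)"
  let ?\<tau> = "\<lambda>u. Inf {t\<in>{a..1}. ?cr u t}"
  let ?h = "\<lambda>t. t powr p * exp (- g t / 2)"
  let ?f = "\<lambda>u. exp (u / 2) * crossing_weight (\<lambda>t. g t + u) p a 1 (drifted (sqrt u *\<^sub>R y) \<omega>)"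
  note pattern = eventually_crossing_pattern[OF a g \<omega>, of _ y]
  have f: "?f u = (if \<not> ?cr u a \<and> (\<exists>t\<in>{a..1}. ?cr u t) then ?h (?\<tau> u) else 0)" for u
    by (simp add: crossing_weight_def exp_add[symmetric] add_divide_distrib mult.left_commute exp_minus_inverse
        diff_divide_distrib exp_diff)
  consider "norm y < 1" | "1 / sqrt a < norm y" | "1 < norm y" "norm y < 1 / sqrt a" using y by linarith
  then show ?thesis
  proof cases
    case 1
    then have y2: "(norm y)\<^sup>2 < 1" by (simp add: power_less_one_iff)
    have gap: "0 < 1 - (norm y)\<^sup>2" using y2 by simp
    have "eventually (\<lambda>u. ?f u = 0) at_top"
      using pattern[OF gap]
    proof eventually_elim
      case (elim u)
      have "\<not> ?cr u t" if t: "t \<in> {a..1}" for t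
      proof -
        have "t * (norm y)\<^sup>2 \<le> 1 * (norm y)\<^sup>2" using t by (intro mult_right_mono) auto
        then show ?thesis using elim t by auto
      qed
      then show ?case unfolding f by auto
    qed
    then show ?thesis using 1 by (simp add: tendsto_eventually)
  next
    case 2
    then have "(1 / sqrt a)\<^sup>2 < (norm y)\<^sup>2" using a by (intro power_strict_mono) auto
    then have y2: "1 < a * (norm y)\<^sup>2" using a by (simp add: power_divide field_simps)
    have gap: "0 < a * (norm y)\<^sup>2 - 1" using y2 by simp
    have "eventually (\<lambda>u. ?f u = 0) at_top"
      using pattern[OF gap]
    proof eventually_elim
      case (elim u)
      have "?cr u a" using elim a by auto
      then show ?case unfolding f by auto
    qed
    then show ?thesis using 2 by (simp add: tendsto_eventually)
  next
    case 3
    define \<rho> where "\<rho> = (norm y)\<^sup>2"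
    have \<rho>1: "1 < \<rho>" unfolding \<rho>_def using 3(1) by (rule one_less_power) simp
    have "(norm y)\<^sup>2 < (1 / sqrt a)\<^sup>2" using 3 by (intro power_strict_mono) auto
    then have \<rho>a: "a * \<rho> < 1" using a \<rho>1 by (simp add: power_divide field_simps \<rho>_def)
    define s where "s = 1 / \<rho>"
    have s: "a < s" "s < 1" using \<rho>1 \<rho>a by (auto simp: s_def field_simps)
    \<comment> \<open>Small enough that a falls on the side without crossing and 1 on the side with
      crossing.\<close>
    define \<eta>0 where "\<eta>0 = min (1 - a * \<rho>) (\<rho> - 1)"
    have \<eta>0: "0 < \<eta>0" using \<rho>1 \<rho>a by (simp add: \<eta>0_def)
    have good: "eventually (\<lambda>u. \<not> ?cr u a \<and> (\<exists>t\<in>{a..1}. ?cr u t)) at_top"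
      using pattern[folded \<rho>_def, OF \<eta>0]
    proof eventually_elim
      case (elim u)
      have "\<not> ?cr u a" using elim a by (auto simp: \<eta>0_def)
      moreover have "?cr u 1" using elim a by (auto simp: \<eta>0_def)
      ultimately show ?case using a by auto
    qed
    have lim: "(?\<tau> \<longlongrightarrow> s) at_top"
    proof (rule tendstoI)
      fix e :: real assume e: "0 < e"
      \<comment> \<open>The bound \<open>\<eta>0\<close> keeps \<open>s + \<eta> / \<rho>\<close>
        inside [a, 1]; the other entry keeps the deviation from \<open>s\<close> at most e /
        2.\<close>
      define \<eta> where "\<eta> = min \<eta>0 (e * \<rho> / 2)"
      have \<eta>: "0 < \<eta>" using \<eta>0 e \<rho>1 by (simp add: \<eta>_def)
      show "eventually (\<lambda>u. dist (?\<tau> u) s < e) at_top"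
        using pattern[folded \<rho>_def, OF \<eta>] good
      proof eventually_elim
        case (elim u)
        let ?U = "{t\<in>{a..1}. ?cr u t}"
        have \<eta>e: "\<eta> / \<rho> \<le> e / 2" using \<rho>1 by (simp add: \<eta>_def field_simps)
        have "?\<tau> u \<le> s + \<eta> / \<rho>"
        proof (rule cInf_lower)
          have "s + \<eta> / \<rho> \<le> 1" using \<rho>1 by (simp add: s_def \<eta>_def \<eta>0_def field_simps)
          moreover have "(s + \<eta> / \<rho>) * \<rho> = 1 + \<eta>" using \<rho>1 by (simp add: s_def field_simps)
          moreover have "a \<le> s + \<eta> / \<rho>" using s \<eta> \<rho>1 by (simp add: add_increasing2)
          ultimately show "s + \<eta> / \<rho> \<in> ?U" using elim(1) by auto
        qed (auto intro!: bdd_belowI[of _ a])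
        moreover have "s - \<eta> / \<rho> \<le> ?\<tau> u"
        proof (rule cInf_greatest)
          show "?U \<noteq> {}" using elim(2) by auto
          fix t assume t: "t \<in> ?U"
          then have "1 - \<eta> < t * \<rho>" using elim(1) by fastforce
          then show "s - \<eta> / \<rho> \<le> t" using \<rho>1 by (simp add: s_def field_simps)
        qed
        ultimately show ?case using \<eta>e e unfolding dist_real_def by linarith
      qed
    qed
    have "continuous_on {a..1} ?h" using a by (intro continuous_intros g) auto
    then have "((\<lambda>u. ?h (?\<tau> u)) \<longlongrightarrow> ?h s) at_top"
    proof (rule continuous_on_tendsto_compose[OF _ lim])
      show "eventually (\<lambda>u. ?\<tau> u \<in> {a..1}) at_top"
        using good by eventually_elim (rule first_crossing_in, blast)
    qed (use s in auto)
    then have "(?f \<longlongrightarrow> ?h s) at_top"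
      by (rule Lim_transform_eventually) (use good in eventually_elim, unfold f, simp)
    then show ?thesis using 3 by (simp add: s_def \<rho>_def)
  qed
qed

text \<open>Integrability of the dominating function of the scaled identity. For fixed \<omega> the
  inner integral is the volume of a ball whose radius is affine in |W_a|, and Gaussian tails absorb
  the resulting power.\<close>

lemma nn_integral_drift_ball_finite:
  assumes a: "0 < a" and A: "0 \<le> A"
  shows "(\<integral>\<^sup>+z. indicator {z. norm (fst z) \<le> (norm (W a (snd z)) + A) / a} z \<partial>((lborel :: (real ^ 'n) measure) \<Otimes>\<^sub>M M)) < \<infinity>"
proof -
  interpret P: pair_sigma_finite "lborel :: (real ^ 'n) measure" M ..
  have [measurable]: "W a \<in> borel_measurable M" using a by simp
  let ?n = "CARD('n)"
  \<comment> \<open>Comes from (x + A)^n \<le> exp (n (x + A)) and n x \<le> x^2 / (4 a) + a n^2, a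
    completed square. The quadratic exponent is integrable by \<open>nn_integral_exp_square\<close>
    with \<kappa> = 2 a.\<close>
  define C where "C = unit_ball_vol ?n / a ^ ?n * exp (?n * A + a * (real ?n)\<^sup>2)"
  have C: "0 \<le> C" using a by (simp add: C_def)
  have le: "unit_ball_vol ?n * ((x + A) / a) ^ ?n \<le> C * exp (x\<^sup>2 / (2 * (2 * a)))" if x: "0 \<le> x" for x
  proof -
    have "(x + A) ^ ?n \<le> exp (x + A) ^ ?n"
      using x A exp_ge_add_one_self[of "x + A"] by (intro power_mono) linarith+
    also have "\<dots> = exp (?n * (x + A))" by (simp add: exp_of_nat_mult)
    also have "\<dots> \<le> exp (?n * A + a * (real ?n)\<^sup>2 + x\<^sup>2 / (2 * (2 * a)))"
    proof -
      have "0 \<le> (x - 2 * a * ?n)\<^sup>2 / (4 * a)" using a by simp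
      also have "\<dots> = x\<^sup>2 / (2 * (2 * a)) - ?n * x + a * (real ?n)\<^sup>2" using a by (simp add: power2_eq_square field_simps)
      finally show ?thesis by (simp add: algebra_simps)
    qed
    finally have "unit_ball_vol ?n / a ^ ?n * (x + A) ^ ?n \<le> unit_ball_vol ?n / a ^ ?n * exp (?n * A + a * (real ?n)\<^sup>2 + x\<^sup>2 / (2 * (2 * a)))"
      using a by (intro mult_left_mono) auto
    then show ?thesis unfolding C_def exp_add by (simp add: power_divide mult_ac)
  qed
  have "(\<integral>\<^sup>+z. indicator {z. norm (fst z) \<le> (norm (W a (snd z)) + A) / a} z \<partial>((lborel :: (real ^ 'n) measure) \<Otimes>\<^sub>M M))
      = (\<integral>\<^sup>+\<omega>. \<integral>\<^sup>+\<theta>. indicator {z. norm (fst z) \<le> (norm (W a (snd z)) + A) / a} (\<theta>, \<omega>) \<partial>(lborel :: (real ^ 'n) measure) \<partial>M)"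
    by (rule P.nn_integral_snd[symmetric]) measurable
  also have "\<dots> = (\<integral>\<^sup>+\<omega>. \<integral>\<^sup>+\<theta>. indicator (cball (0 :: real ^ 'n) ((norm (W a \<omega>) + A) / a)) \<theta> \<partial>lborel \<partial>M)"
    by (intro nn_integral_cong) (auto simp: indicator_def)
  also have "\<dots> = (\<integral>\<^sup>+\<omega>. ennreal (unit_ball_vol ?n * ((norm (W a \<omega>) + A) / a) ^ ?n) \<partial>M)"
    using a A by (intro nn_integral_cong) (simp add: emeasure_cball)
  also have "\<dots> \<le> (\<integral>\<^sup>+\<omega>. ennreal C * ennreal (exp ((norm (W a \<omega>))\<^sup>2 / (2 * (2 * a)))) \<partial>M)"
    using le C by (intro nn_integral_mono) (simp add: ennreal_mult[symmetric] ennreal_leI)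
  also have "\<dots> = ennreal C * ennreal ((2 * a / (2 * a - a)) powr (CARD('n) / 2))"
  proof -
    have e: "(\<integral>\<^sup>+\<omega>. ennreal (exp ((norm (W a \<omega>))\<^sup>2 / (2 * (2 * a)))) \<partial>M) = ennreal ((2 * a / (2 * a - a)) powr (CARD('n) / 2))"
      using a by (intro nn_integral_exp_square) auto
    show ?thesis by (subst nn_integral_cmult) (simp_all only: e, measurable)
  qed
  also have "\<dots> < \<infinity>" by (simp add: ennreal_mult_less_top)
  finally show ?thesis .
qed

text \<open>Without exp (- u / 2) the weight is at most 1, as \<tau> \<le> 1 and g \<ge> 0. Not
  crossing at a bounds a sqrt u |y| by |W_a| + sqrt (a (g a + u)); for u \<ge> 1 the factor sqrt u
  can be taken out, so the resulting bound on |y| is free of u.\<close>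

lemma scaled_crossing_weight_le:
  assumes a: "0 < a" "a < 1" and g: "\<And>t. t \<in> {a..1} \<Longrightarrow> 0 \<le> g t" and u: "1 \<le> u" and p: "0 \<le> p"
  shows "ennreal (exp (u / 2) * crossing_weight (\<lambda>t. g t + u) p a 1 (drifted (sqrt u *\<^sub>R y) \<omega>))
    \<le> indicator {z. norm (fst z) \<le> (norm (W a (snd z)) + sqrt (a * (g a + 1))) / a} (y, \<omega>)"
proof (cases "\<not> crosses (\<lambda>t. g t + u) (drifted (sqrt u *\<^sub>R y) \<omega>) a \<and> (\<exists>t\<in>{a..1}. crosses (\<lambda>t. g t + u) (drifted (sqrt u *\<^sub>R y) \<omega>) t)")
  case False
  then have "crossing_weight (\<lambda>t. g t + u) p a 1 (drifted (sqrt u *\<^sub>R y) \<omega>) = 0" by (simp only: crossing_weight_def if_False)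
  then show ?thesis by simp
next
  case True
  let ?\<tau> = "Inf {t\<in>{a..1}. crosses (\<lambda>t. g t + u) (drifted (sqrt u *\<^sub>R y) \<omega>) t}"
  have \<tau>: "?\<tau> \<in> {a..1}" using True by (intro first_crossing_in) blast
  have "exp (u / 2) * crossing_weight (\<lambda>t. g t + u) p a 1 (drifted (sqrt u *\<^sub>R y) \<omega>) = ?\<tau> powr p * exp (- g ?\<tau> / 2)"
    using True unfolding crossing_weight_def
    by (simp add: exp_add[symmetric] add_divide_distrib mult.left_commute exp_minus_inverse diff_divide_distrib exp_diff)
  also have "\<dots> \<le> 1 * 1"
    using \<tau> g[OF \<tau>] a p by (intro mult_mono powr_le1) auto
  finally have le1: "exp (u / 2) * crossing_weight (\<lambda>t. g t + u) p a 1 (drifted (sqrt u *\<^sub>R y) \<omega>) \<le> 1" by simp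
  have ga: "0 \<le> g a" using g a by simp
  have su: "1 \<le> sqrt u" using u by simp
  have "(norm (drifted (sqrt u *\<^sub>R y) \<omega> a))\<^sup>2 \<le> a * (g a + u)" using True by (simp add: crosses_def not_less)
  also have "\<dots> \<le> u * (a * (g a + 1))"
  proof -
    have "g a + u \<le> u * (g a + 1)" using mult_right_mono[OF u ga] by (simp add: algebra_simps)
    then show ?thesis using a mult_left_mono[of "g a + u" "u * (g a + 1)" a] by (simp add: mult_ac)
  qed
  finally have "norm (drifted (sqrt u *\<^sub>R y) \<omega> a) \<le> sqrt u * sqrt (a * (g a + 1))"
    by (simp add: real_le_rsqrt flip: real_sqrt_mult)
  moreover have "norm (a *\<^sub>R sqrt u *\<^sub>R y) \<le> norm (drifted (sqrt u *\<^sub>R y) \<omega> a) + norm (W a \<omega>)"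
    unfolding drifted_def using norm_triangle_ineq4[of "W a \<omega> + a *\<^sub>R sqrt u *\<^sub>R y" "W a \<omega>"] by simp
  moreover have "norm (a *\<^sub>R sqrt u *\<^sub>R y) = sqrt u * (a * norm y)" using a u by simp
  moreover have "norm (W a \<omega>) \<le> sqrt u * norm (W a \<omega>)" using su mult_right_mono[OF su, of "norm (W a \<omega>)"] by simp
  ultimately have "sqrt u * (a * norm y) \<le> sqrt u * (norm (W a \<omega>) + sqrt (a * (g a + 1)))"
    unfolding distrib_left by linarith
  then have "a * norm y \<le> norm (W a \<omega>) + sqrt (a * (g a + 1))" using su by (subst (asm) mult_le_cancel_left_pos) auto
  then have "norm y \<le> (norm (W a \<omega>) + sqrt (a * (g a + 1))) / a" using a by (simp add: field_simps)
  then show ?thesis using le1 by (simp add: ennreal_leI flip: ennreal_1)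
qed

end

section \<open>Crossings near time 0\<close>

lemma nn_integral_Ioc_small:
  fixes h :: "real \<Rightarrow> ennreal"
  assumes [measurable]: "h \<in> borel_measurable borel"
    and fin: "(\<integral>\<^sup>+x\<in>{0<..d}. h x \<partial>lborel) < \<infinity>" and "0 < d" "0 < \<epsilon>"
  shows "\<exists>b. 0 < b \<and> b \<le> d \<and> (\<integral>\<^sup>+x\<in>{0<..b}. h x \<partial>lborel) < \<epsilon>"
proof -
  let ?b = "\<lambda>i. d / real (Suc i)"
  have b: "0 < ?b i" "?b i \<le> d" for i using \<open>0 < d\<close> by (auto simp: divide_le_eq mult_le_cancel_left1)
  have "(\<lambda>i. \<integral>\<^sup>+x\<in>{0<..?b i}. h x \<partial>lborel) \<longlonglongrightarrow> (\<integral>\<^sup>+x. 0 \<partial>(lborel :: real measure))"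
  proof (rule nn_integral_dominated_convergence[where w="\<lambda>x. h x * indicator {0<..d} x"])
    show "AE x in lborel. h x * indicator {0<..?b j} x \<le> h x * indicator {0<..d} x" for j
      using b[of j] by (intro AE_I2 mult_left_mono) (auto simp: indicator_def)
    show "AE x in lborel. (\<lambda>i. h x * indicator {0<..?b i} x) \<longlonglongrightarrow> 0"
    proof (rule AE_I2)
      fix x :: real
      have "eventually (\<lambda>i. h x * indicator {0<..?b i} x = 0) sequentially"
      proof (cases "0 < x")
        case True
        have "?b \<longlonglongrightarrow> 0" by real_asymp
        from order_tendstoD(2)[OF this True] show ?thesis
          by eventually_elim (auto simp: indicator_def)
      qed (auto simp: indicator_def)
      then show "(\<lambda>i. h x * indicator {0<..?b i} x) \<longlonglongrightarrow> 0" by (rule tendsto_eventually)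
    qed
    show "(\<integral>\<^sup>+x. h x * indicator {0<..d} x \<partial>lborel) < \<infinity>" by (rule fin)
  qed measurable
  from order_tendstoD(2)[OF this, of \<epsilon>] \<open>0 < \<epsilon>\<close>
  obtain i where "(\<integral>\<^sup>+x\<in>{0<..?b i}. h x \<partial>lborel) < \<epsilon>"
    by (auto simp: eventually_sequentially)
  with b show ?thesis by blast
qed

text \<open>The logarithmic derivative p / x - 1 / 2 is nonpositive from 2 p on; here this is ln z
  \<le> z - 1 at z = y / x.\<close>

lemma powr_times_exp_decreasing:
  fixes p x y :: real
  assumes "0 < p" "2 * p \<le> x" "x \<le> y"
  shows "y powr p * exp (- y / 2) \<le> x powr p * exp (- x / 2)"
proof -
  have x: "0 < x" "0 < y" using assms by auto
  have "ln (y / x) \<le> y / x - 1" using x by (intro ln_le_minus_one) auto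
  then have "p * ln (y / x) \<le> p * (y / x - 1)" using assms by (intro mult_left_mono) auto
  also have "\<dots> = (2 * p / x) * ((y - x) / 2)" using x by (simp add: field_simps)
  also have "\<dots> \<le> 1 * ((y - x) / 2)" using assms x by (intro mult_right_mono) (auto simp: field_simps)
  finally have "p * ln y + - y / 2 \<le> p * ln x + - x / 2"
    using x by (simp add: ln_div algebra_simps)
  then have "exp (p * ln y + - y / 2) \<le> exp (p * ln x + - x / 2)" by simp
  then show ?thesis using x unfolding exp_add by (simp add: powr_def)
qed

text \<open>To the right of b the values of g are smaller but still at least 2 P, so x^P exp (- x /
  2) is larger there. The factor 2 appears because 1 / t \<ge> 1 / (2 b) on an interval of length
  b.\<close>

lemma dyadic_interval_integral_ge:
  fixes g :: "real \<Rightarrow> real"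
  assumes b: "0 < b" and P: "0 < P" and [measurable]: "g \<in> borel_measurable borel"
    and dec: "\<And>t. b \<le> t \<Longrightarrow> t \<le> 2 * b \<Longrightarrow> g t \<le> g b" and ge: "\<And>t. b \<le> t \<Longrightarrow> t \<le> 2 * b \<Longrightarrow> 2 * P \<le> g t"
  shows "ennreal (g b powr P * exp (- g b / 2)) \<le>
    2 * (\<integral>\<^sup>+t. ennreal (1 / t * g t powr P * exp (- g t / 2)) * indicator {b<..2 * b} t \<partial>lborel)"
proof -
  let ?r = "g b powr P * exp (- g b / 2)"
  have r: "ennreal ?r = 2 * (ennreal (1 / (2 * b) * ?r) * emeasure lborel {b<..2 * b})"
    using b by (simp add: ennreal_mult[symmetric] mult.assoc[symmetric] flip: ennreal_numeral)
  have "ennreal (1 / (2 * b) * ?r) * emeasure lborel {b<..2 * b} = (\<integral>\<^sup>+t. ennreal (1 / (2 * b) * ?r) * indicator {b<..2 * b} t \<partial>lborel)"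
    by (rule nn_integral_cmult_indicator[symmetric]) simp
  also have "\<dots> \<le> (\<integral>\<^sup>+t. ennreal (1 / t * g t powr P * exp (- g t / 2)) * indicator {b<..2 * b} t \<partial>lborel)"
  proof (rule nn_integral_mono)
    fix t
    have "1 / (2 * b) * ?r \<le> 1 / t * (g t powr P * exp (- g t / 2))" if "b < t" "t \<le> 2 * b"
      using that b P dec[of t] ge[of t] by (intro mult_mono powr_times_exp_decreasing frac_le) auto
    then show "ennreal (1 / (2 * b) * ?r) * indicator {b<..2 * b} t \<le> ennreal (1 / t * g t powr P * exp (- g t / 2)) * indicator {b<..2 * b} t"
      by (auto simp: indicator_def mult.assoc intro!: ennreal_leI)
  qed
  finally show ?thesis unfolding r by (rule mult_left_mono) simp
qed

lemma dyadic_cover: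
  fixes t a :: real
  assumes "0 < t" "t \<le> a"
  obtains k where "a / 2 ^ Suc k \<le> t" "t \<le> a / 2 ^ k"
proof -
  have "(\<lambda>k. a / 2 ^ k) \<longlonglongrightarrow> 0" using LIMSEQ_divide_realpow_zero[of 2 a] by simp
  from order_tendstoD(2)[OF this assms(1)] obtain N where "a / 2 ^ N < t"
    by (auto simp: eventually_sequentially)
  then have ex: "\<exists>k. a / 2 ^ Suc k \<le> t"
    using assms by (intro exI[of _ N]) (simp add: field_simps)
  \<comment> \<open>The least such index: its predecessor fails, which is the upper bound on
    t.\<close>
  define k where "k = (LEAST k. a / 2 ^ Suc k \<le> t)"
  have k: "a / 2 ^ Suc k \<le> t" unfolding k_def using LeastI_ex[OF ex] .
  moreover have "t \<le> a / 2 ^ k"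
  proof (cases k)
    case (Suc j)
    then have "\<not> a / 2 ^ Suc j \<le> t" using not_less_Least[of j "\<lambda>k. a / 2 ^ Suc k \<le> t"] by (simp add: k_def)
    then show ?thesis using Suc by simp
  qed (use assms in simp)
  ultimately show thesis by (rule that)
qed

lemma disjoint_dyadic_Ioc:
  fixes a :: real
  assumes "0 < a"
  shows "disjoint_family (\<lambda>k. {a / 2 ^ k<..2 * (a / 2 ^ k)})"
proof -
  have "{a / 2 ^ i<..2 * (a / 2 ^ i)} \<inter> {a / 2 ^ j<..2 * (a / 2 ^ j)} = {}" if "i < j" for i j :: nat
  proof -
    have "(2::real) * 2 ^ i \<le> 2 ^ j" using power_increasing[of "Suc i" j "2::real"] that by simp
    then have "2 * (a / 2 ^ j) \<le> a / 2 ^ i" using assms by (simp add: field_simps)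
    then show ?thesis by auto
  qed
  then show ?thesis unfolding disjoint_family_on_def by (metis inf_commute linorder_neqE_nat)
qed

context multi_brownian_motion
begin

text \<open>On the interval from \<open>a / 2 ^ Suc k\<close> to \<open>a / 2 ^ k\<close> the
  boundary is at least its value at the right end, and the bound for constant boundaries has time
  ratio 2. The sum over k is compared with integrals over the intervals to the right, hence the
  range up to 2 a. \<open>K\<close> is fixed before g, a and u, so that a small a serves all large
  u.\<close>

lemma tail_crossing_probability_le:
  defines "P \<equiv> real CARD('n) / 2"
  obtains K where "0 < K" "\<And>g a u T. 0 < a \<Longrightarrow> 2 \<le> u \<Longrightarrow> g \<in> borel_measurable borel \<Longrightarrow>
    (\<And>s t. 0 < s \<Longrightarrow> s \<le> t \<Longrightarrow> t \<le> 2 * a \<Longrightarrow> g t \<le> g s) \<Longrightarrow>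
    (\<And>t. 0 < t \<Longrightarrow> t \<le> 2 * a \<Longrightarrow> max 1 (2 * P) \<le> g t) \<Longrightarrow>
    T \<in> sets M \<Longrightarrow> (\<And>\<omega>. \<omega> \<in> T \<Longrightarrow> \<exists>t\<in>{0<..a}. crosses (\<lambda>t. g t + u) (drifted 0 \<omega>) t) \<Longrightarrow>
    emeasure M T \<le> ennreal (K * u powr P * exp (- u / 2)) *
      (\<integral>\<^sup>+t\<in>{0<..2 * a}. ennreal (1 / t * g t powr P * exp (- g t / 2)) \<partial>lborel)"
proof -
  have P: "0 < P" by (simp add: P_def)
  obtain K0 where K0: "0 < K0" "\<And>a b k. 0 < a \<Longrightarrow> a \<le> b \<Longrightarrow> 1 < k \<Longrightarrow>
    measure M {\<omega>\<in>space M. \<exists>t\<in>{a..b}. crosses (\<lambda>_. k) (drifted 0 \<omega>) t}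
      \<le> K0 * (b / a) powr P * k powr P * exp (- k / 2)"
    unfolding P_def using crossing_probability_bound by blast
  \<comment> \<open>One power of 2 is the time ratio, the other comes from g + u \<le> 2 g u, and
    the last 2 from \<open>dyadic_interval_integral_ge\<close>.\<close>
  define K where "K = K0 * 2 powr P * 2 powr P * 2"
  have K: "0 < K" using K0(1) by (simp add: K_def)
  show thesis
  proof (rule that[OF K])
    fix g :: "real \<Rightarrow> real" and a u :: real and T
    assume a: "0 < a" and u: "2 \<le> u" and g [measurable]: "g \<in> borel_measurable borel"
      and dec: "\<And>s t. 0 < s \<Longrightarrow> s \<le> t \<Longrightarrow> t \<le> 2 * a \<Longrightarrow> g t \<le> g s"
      and ge: "\<And>t. 0 < t \<Longrightarrow> t \<le> 2 * a \<Longrightarrow> max 1 (2 * P) \<le> g t"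
      and T: "T \<in> sets M" "\<And>\<omega>. \<omega> \<in> T \<Longrightarrow> \<exists>t\<in>{0<..a}. crosses (\<lambda>t. g t + u) (drifted 0 \<omega>) t"
    let ?b = "\<lambda>k. a / 2 ^ k"
    let ?A = "\<lambda>k. {\<omega>\<in>space M. \<exists>t\<in>{?b (Suc k)..?b k}. crosses (\<lambda>_. g (?b k) + u) (drifted 0 \<omega>) t}"
    let ?h = "\<lambda>t. ennreal (1 / t * g t powr P * exp (- g t / 2))"
    let ?I = "\<lambda>k. {?b k<..2 * ?b k}"
    let ?c = "K0 * 2 powr P * 2 powr P * u powr P * exp (- u / 2)"
    have b: "0 < ?b k" "?b k \<le> a" "?b (Suc k) \<le> ?b k" for k
      using a by (auto simp: divide_le_eq mult_le_cancel_left1 field_simps)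
    have Am: "?A k \<in> sets M" for k
      using pred_exists_crossing[of "?b (Suc k)" "?b k" "\<lambda>_. g (?b k) + u" 0] b[of k] b[of "Suc k"] by simp
    have TA: "T \<subseteq> (\<Union>k. ?A k)"
    proof
      fix \<omega> assume \<omega>: "\<omega> \<in> T"
      then have sp: "\<omega> \<in> space M" using T(1) sets.sets_into_space by blast
      obtain t where t: "0 < t" "t \<le> a" "crosses (\<lambda>t. g t + u) (drifted 0 \<omega>) t" using T(2)[OF \<omega>] by auto
      obtain k where k: "?b (Suc k) \<le> t" "t \<le> ?b k" using dyadic_cover[OF t(1,2)] .
      have "g (?b k) \<le> g t" using dec[of t "?b k"] t k b[of k] a by simp
      then have "t * (g (?b k) + u) \<le> t * (g t + u)" using t by (intro mult_left_mono) auto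
      then have "crosses (\<lambda>_. g (?b k) + u) (drifted 0 \<omega>) t" using t(3) by (simp add: crosses_def)
      then have "\<omega> \<in> ?A k" using k sp by auto
      then show "\<omega> \<in> (\<Union>k. ?A k)" by blast
    qed
    have Ak: "emeasure M (?A k) \<le> ennreal (2 * ?c) * (\<integral>\<^sup>+t. ?h t * indicator (?I k) t \<partial>lborel)" for k
    proof -
      let ?g = "g (?b k)"
      have g1: "1 \<le> ?g" using ge[of "?b k"] b[of k] a by simp
      \<comment> \<open>This separates g from u: both are at least 1, so g + u \<le> g u + 1 \<le> 2
        g u.\<close>
      have "0 \<le> (?g - 1) * (u - 1)" using g1 u by (intro mult_nonneg_nonneg) auto
      then have gu: "?g + u \<le> 2 * (?g * u)" using g1 u by (simp add: algebra_simps)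
      have "measure M (?A k) \<le> K0 * (?b k / ?b (Suc k)) powr P * (?g + u) powr P * exp (- (?g + u) / 2)"
        by (rule K0(2)[OF b(1) b(3)]) (use g1 u in linarith)
      also have "?b k / ?b (Suc k) = 2" using a by simp
      also have "K0 * 2 powr P * (?g + u) powr P * exp (- (?g + u) / 2) \<le> K0 * 2 powr P * (2 * (?g * u)) powr P * exp (- (?g + u) / 2)"
        using K0(1) gu g1 u P by (intro mult_right_mono mult_left_mono powr_mono2) auto
      also have "\<dots> = ?c * (?g powr P * exp (- ?g / 2))"
        using g1 u by (simp add: powr_mult mult_ac diff_divide_distrib flip: exp_add)
      finally have "emeasure M (?A k) \<le> ennreal ?c * ennreal (?g powr P * exp (- ?g / 2))"
        using K0(1) by (simp add: emeasure_eq_measure ennreal_mult[symmetric] ennreal_leI)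
      also have "\<dots> \<le> ennreal ?c * (2 * (\<integral>\<^sup>+t. ?h t * indicator (?I k) t \<partial>lborel))"
      proof (intro mult_left_mono dyadic_interval_integral_ge P g)
        fix t assume t: "?b k \<le> t" "t \<le> 2 * ?b k"
        then show "g t \<le> g (?b k)" "2 * P \<le> g t" using dec[of "?b k" t] ge[of t] b[of k] by auto
      qed (use b in auto)
      also have "\<dots> = ennreal (2 * ?c) * (\<integral>\<^sup>+t. ?h t * indicator (?I k) t \<partial>lborel)"
        using K0(1) by (simp add: ennreal_mult mult_ac)
      finally show ?thesis .
    qed
    have "emeasure M T \<le> emeasure M (\<Union>k. ?A k)" by (rule emeasure_mono[OF TA]) (use Am in blast)
    also have "\<dots> \<le> (\<Sum>k. emeasure M (?A k))" by (rule emeasure_subadditive_countably) (use Am in blast)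
    also have "\<dots> \<le> (\<Sum>k. ennreal (2 * ?c) * (\<integral>\<^sup>+t. ?h t * indicator (?I k) t \<partial>lborel))"
      by (intro suminf_le Ak) auto
    also have "\<dots> = ennreal (2 * ?c) * (\<Sum>k. \<integral>\<^sup>+t. ?h t * indicator (?I k) t \<partial>lborel)" by simp
    also have "(\<Sum>k. \<integral>\<^sup>+t. ?h t * indicator (?I k) t \<partial>lborel) = (\<integral>\<^sup>+t. (\<Sum>k. ?h t * indicator (?I k) t) \<partial>lborel)"
      by (rule nn_integral_suminf[symmetric]) measurable
    also have "\<dots> = (\<integral>\<^sup>+t. ?h t * indicator (\<Union>k. ?I k) t \<partial>lborel)"
      by (intro nn_integral_cong) (simp only: ennreal_suminf_cmult suminf_indicator[OF disjoint_dyadic_Ioc[OF a]])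
    also have "\<dots> \<le> (\<integral>\<^sup>+t\<in>{0<..2 * a}. ?h t \<partial>lborel)"
    proof (intro nn_integral_mono mult_left_mono)
      fix t
      have "(\<Union>k. ?I k) \<subseteq> {0<..2 * a}"
      proof
        fix t assume "t \<in> (\<Union>k. ?I k)"
        then obtain k where "?b k < t" "t \<le> 2 * ?b k" by auto
        then show "t \<in> {0<..2 * a}" using b[of k] by auto
      qed
      then show "indicator (\<Union>k. ?I k) t \<le> (indicator {0<..2 * a} t :: ennreal)" by (rule indicator_leI[OF subsetD])
    qed auto
    finally have "emeasure M T \<le> ennreal (2 * ?c) * (\<integral>\<^sup>+t\<in>{0<..2 * a}. ?h t \<partial>lborel)" by (simp add: mult_left_mono)
    then show "emeasure M T \<le> ennreal (K * u powr P * exp (- u / 2)) * (\<integral>\<^sup>+t\<in>{0<..2 * a}. ?h t \<partial>lborel)"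
      by (simp add: K_def mult_ac)
  qed
qed

text \<open>Substituting \<theta> = sqrt u y produces the Jacobian u^P, and the weight supplies exp
  (- u / 2). With both divided out, the integrand converges almost everywhere under a dominating
  function free of u, and its limit depends on y only through 1 / |y|^2.\<close>

lemma interior_crossing_limit:
  assumes a: "0 < a" "a < 1" and g: "continuous_on {a..1} g" "\<And>t. t \<in> {a..1} \<Longrightarrow> 0 \<le> g t"
    and gm [measurable]: "g \<in> borel_measurable borel"
  defines "P \<equiv> real CARD('n) / 2"
  shows "((\<lambda>u. ennreal ((2 * pi) powr P * measure M {\<omega>\<in>space M. \<not> crosses (\<lambda>t. g t + u) (drifted 0 \<omega>) a \<and>
        (\<exists>t\<in>{a..1}. crosses (\<lambda>t. g t + u) (drifted 0 \<omega>) t)} / (u powr P * exp (- u / 2)))) \<longlongrightarrow>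
    ennreal (unit_ball_vol CARD('n) * P) * (\<integral>\<^sup>+t\<in>{a..1}. ennreal (1 / t * exp (- g t / 2)) \<partial>lborel)) at_top"
proof -
  interpret V: pair_sigma_finite "lborel :: (real ^ 'n) measure" M ..
  let ?LM = "(lborel :: (real ^ 'n) measure) \<Otimes>\<^sub>M M"
  let ?E = "\<lambda>u. {\<omega>\<in>space M. \<not> crosses (\<lambda>t. g t + u) (drifted 0 \<omega>) a \<and> (\<exists>t\<in>{a..1}. crosses (\<lambda>t. g t + u) (drifted 0 \<omega>) t)}"
  let ?cw = "\<lambda>u z. crossing_weight (\<lambda>t. g t + u) P a 1 (drifted (sqrt u *\<^sub>R fst z) (snd z))"
  let ?\<psi> = "\<lambda>y :: real ^ 'n. if 1 \<le> norm y \<and> norm y \<le> 1 / sqrt a then (1 / (norm y)\<^sup>2) powr P * exp (- g (1 / (norm y)\<^sup>2) / 2) else 0"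
  let ?S = "\<lambda>u. \<integral>\<^sup>+z. ennreal (exp (u / 2) * ?cw u z) \<partial>?LM"
  have P: "0 < P" by (simp add: P_def)
  have gu: "continuous_on {a..1} (\<lambda>t. g t + u)" for u by (intro continuous_intros g)
  have [measurable]: "W a \<in> borel_measurable M" using a by simp
  have cw0: "(\<lambda>z. crossing_weight (\<lambda>t. g t + u) P a 1 (drifted (fst z) (snd z))) \<in> borel_measurable ?LM" for u
    by (rule measurable_crossing_weight_pair[OF a gu])
  have cwm [measurable]: "?cw u \<in> borel_measurable ?LM" for u
  proof -
    have "(\<lambda>z. (sqrt u *\<^sub>R fst z, snd z)) \<in> measurable ?LM ?LM" by measurable
    from measurable_compose[OF this cw0] show ?thesis by simp
  qed
  have eq: "ennreal ((2 * pi) powr P * measure M (?E u) / (u powr P * exp (- u / 2))) = ?S u" if u: "1 \<le> u" for u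
  proof -
    have "ennreal ((2 * pi) powr P * measure M (?E u)) = (\<integral>\<^sup>+z. ennreal (crossing_weight (\<lambda>t. g t + u) P a 1 (drifted (fst z) (snd z))) \<partial>?LM)"
      unfolding P_def by (rule crossing_probability_eq[OF a gu, symmetric])
    also have "\<dots> = (\<integral>\<^sup>+\<omega>. \<integral>\<^sup>+\<theta>. ennreal (crossing_weight (\<lambda>t. g t + u) P a 1 (drifted \<theta> \<omega>)) \<partial>lborel \<partial>M)"
      using V.nn_integral_snd[of "\<lambda>z. ennreal (crossing_weight (\<lambda>t. g t + u) P a 1 (drifted (fst z) (snd z)))"] cw0[of u] by simp
    also have "\<dots> = (\<integral>\<^sup>+\<omega>. ennreal (u powr P) * (\<integral>\<^sup>+y. ennreal (?cw u (y, \<omega>)) \<partial>lborel) \<partial>M)"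
    proof (rule nn_integral_cong)
      fix \<omega> assume "\<omega> \<in> space M"
      then have "(\<lambda>\<theta>. (\<theta>, \<omega>)) \<in> measurable lborel ?LM" by measurable
      from measurable_compose[OF this cw0[of u]]
      have "(\<lambda>\<theta>. crossing_weight (\<lambda>t. g t + u) P a 1 (drifted \<theta> \<omega>)) \<in> borel_measurable borel" by simp
      then have "(\<integral>\<^sup>+\<theta>. ennreal (crossing_weight (\<lambda>t. g t + u) P a 1 (drifted \<theta> \<omega>)) \<partial>lborel)
          = ennreal (\<bar>sqrt u\<bar> ^ DIM(real ^ 'n)) * (\<integral>\<^sup>+y. ennreal (?cw u (y, \<omega>)) \<partial>lborel)"
        using u by (subst nn_integral_lborel_scaleR[of "sqrt u"]) auto
      then show "(\<integral>\<^sup>+\<theta>. ennreal (crossing_weight (\<lambda>t. g t + u) P a 1 (drifted \<theta> \<omega>)) \<partial>lborel)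
          = ennreal (u powr P) * (\<integral>\<^sup>+y. ennreal (?cw u (y, \<omega>)) \<partial>lborel)"
        using u sqrt_power_eq_powr[of u "CARD('n)"] by (simp add: P_def)
    qed
    also have "\<dots> = ennreal (u powr P) * (\<integral>\<^sup>+\<omega>. \<integral>\<^sup>+y. ennreal (?cw u (y, \<omega>)) \<partial>lborel \<partial>M)"
      by (rule nn_integral_cmult) measurable
    also have "(\<integral>\<^sup>+\<omega>. \<integral>\<^sup>+y. ennreal (?cw u (y, \<omega>)) \<partial>lborel \<partial>M) = (\<integral>\<^sup>+z. ennreal (?cw u z) \<partial>?LM)"
      by (rule V.nn_integral_snd) measurable
    finally have *: "ennreal ((2 * pi) powr P * measure M (?E u)) = ennreal (u powr P) * (\<integral>\<^sup>+z. ennreal (?cw u z) \<partial>?LM)" .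
    have "ennreal ((2 * pi) powr P * measure M (?E u) / (u powr P * exp (- u / 2)))
        = ennreal (exp (u / 2) / u powr P) * ennreal ((2 * pi) powr P * measure M (?E u))"
      by (simp add: ennreal_mult[symmetric] exp_minus field_simps)
    also have "\<dots> = ennreal (exp (u / 2) / u powr P) * ennreal (u powr P) * (\<integral>\<^sup>+z. ennreal (?cw u z) \<partial>?LM)"
      unfolding * by (simp add: mult.assoc)
    also have "ennreal (exp (u / 2) / u powr P) * ennreal (u powr P) = ennreal (exp (u / 2))"
      using u by (simp add: ennreal_mult[symmetric])
    also have "ennreal (exp (u / 2)) * (\<integral>\<^sup>+z. ennreal (?cw u z) \<partial>?LM) = ?S u"
      by (subst nn_integral_cmult[symmetric]) (auto simp: ennreal_mult crossing_weight_nonneg)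
    finally show ?thesis .
  qed
  have lim: "(\<integral>\<^sup>+z. ennreal (?\<psi> (fst z)) \<partial>?LM) = ennreal (unit_ball_vol CARD('n) * P) * (\<integral>\<^sup>+t\<in>{a..1}. ennreal (1 / t * exp (- g t / 2)) \<partial>lborel)"
  proof -
    have "(\<integral>\<^sup>+z. ennreal (?\<psi> (fst z)) \<partial>?LM) = (\<integral>\<^sup>+y. \<integral>\<^sup>+\<omega>. ennreal (?\<psi> (fst (y, \<omega>))) \<partial>M \<partial>lborel)"
      by (rule nn_integral_fst[symmetric]) measurable
    also have "\<dots> = (\<integral>\<^sup>+y. ennreal (?\<psi> y) \<partial>lborel)"
      by (simp only: fst_conv nn_integral_const emeasure_space_1 mult_1_right)
    also have "\<dots> = (\<integral>\<^sup>+y. ennreal ((1 / (norm y)\<^sup>2) powr P * exp (- g (1 / (norm y)\<^sup>2) / 2)) *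
        indicator {y. 1 \<le> norm y \<and> norm y \<le> 1 / sqrt a} y \<partial>(lborel :: (real ^ 'n) measure))"
      by (intro nn_integral_cong) (auto simp: indicator_def)
    also have "\<dots> = (\<integral>\<^sup>+t. ennreal (t powr P * exp (- g t / 2)) *
        (ennreal (unit_ball_vol CARD('n) * (P * t powr (- P - 1))) * indicator {a..1} t) \<partial>lborel)"
      unfolding P_def by (rule nn_integral_radial_inverse_square[OF a, where f="\<lambda>t. ennreal (t powr (real CARD('n) / 2) * exp (- g t / 2))"]) measurable
    also have "\<dots> = (\<integral>\<^sup>+t. ennreal (unit_ball_vol CARD('n) * P) * (ennreal (1 / t * exp (- g t / 2)) * indicator {a..1} t) \<partial>lborel)"
    proof (rule nn_integral_cong)
      fix t :: real
      have "t powr P * exp (- g t / 2) * (unit_ball_vol CARD('n) * (P * t powr (- P - 1))) = unit_ball_vol CARD('n) * P * (1 / t * exp (- g t / 2))" if "t \<in> {a..1}"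
      proof -
        have e: "t powr P * t powr (- P - 1) = 1 / t" using that a by (simp add: powr_add[symmetric] powr_minus_divide)
        have "t powr P * exp (- g t / 2) * (unit_ball_vol CARD('n) * (P * t powr (- P - 1))) =
            (t powr P * t powr (- P - 1)) * (unit_ball_vol CARD('n) * P * exp (- g t / 2))"
          by (simp only: mult_ac)
        then show ?thesis unfolding e by (simp only: mult_ac)
      qed
      then show "ennreal (t powr P * exp (- g t / 2)) * (ennreal (unit_ball_vol CARD('n) * (P * t powr (- P - 1))) * indicator {a..1} t)
          = ennreal (unit_ball_vol CARD('n) * P) * (ennreal (1 / t * exp (- g t / 2)) * indicator {a..1} t)"
        using P a by (auto simp: indicator_def ennreal_mult[symmetric])
    qed
    also have "\<dots> = ennreal (unit_ball_vol CARD('n) * P) * (\<integral>\<^sup>+t\<in>{a..1}. ennreal (1 / t * exp (- g t / 2)) \<partial>lborel)"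
      by (rule nn_integral_cmult) measurable
    finally show ?thesis .
  qed
  show ?thesis
  proof (rule tendsto_at_topI_sequentially)
    fix X :: "nat \<Rightarrow> real" assume X: "filterlim X at_top sequentially"
    \<comment> \<open>Replaces the finitely many terms below 1, to which the dominating bound does
      not apply.\<close>
    let ?X = "\<lambda>m. max 1 (X m)"
    have ev: "eventually (\<lambda>m. 1 \<le> X m) sequentially" using X by (auto simp: filterlim_at_top)
    have X': "filterlim ?X at_top sequentially"
      by (rule filterlim_at_top_mono[OF X]) auto
    have "(\<lambda>m. ?S (?X m)) \<longlonglongrightarrow> (\<integral>\<^sup>+z. ennreal (?\<psi> (fst z)) \<partial>?LM)"
    proof (rule nn_integral_dominated_convergence[where w="indicator {z. norm (fst z) \<le> (norm (W a (snd z)) + sqrt (a * (g a + 1))) / a}"])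
      show "AE z in ?LM. ennreal (exp (?X m / 2) * ?cw (?X m) z) \<le> indicator {z. norm (fst z) \<le> (norm (W a (snd z)) + sqrt (a * (g a + 1))) / a} z" for m
      proof (rule AE_I2)
        fix z :: "(real ^ 'n) \<times> 'a"
        show "ennreal (exp (?X m / 2) * ?cw (?X m) z) \<le> indicator {z. norm (fst z) \<le> (norm (W a (snd z)) + sqrt (a * (g a + 1))) / a} z"
          using scaled_crossing_weight_le[where g=g and u="?X m" and p=P and y="fst z" and \<omega>="snd z", OF a g(2)] P by simp
      qed
      show "(\<integral>\<^sup>+z. indicator {z. norm (fst z) \<le> (norm (W a (snd z)) + sqrt (a * (g a + 1))) / a} z \<partial>?LM) < \<infinity>"
        using a g(2)[of a] by (intro nn_integral_drift_ball_finite) auto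
      have "AE y in (lborel :: (real ^ 'n) measure). norm y \<noteq> 1 \<and> norm y \<noteq> 1 / sqrt a"
        using AE_norm_neq[of 1] AE_norm_neq[of "1 / sqrt a"] by eventually_elim auto
      then have AE1: "AE y in (lborel :: (real ^ 'n) measure). AE \<omega> in M. norm (fst (y, \<omega>)) \<noteq> 1 \<and> norm (fst (y, \<omega>)) \<noteq> 1 / sqrt a"
        by eventually_elim simp
      have "AE z in ?LM. norm (fst z) \<noteq> 1 \<and> norm (fst z) \<noteq> 1 / sqrt a"
        by (rule V.AE_pair_measure[OF _ AE1]) measurable
      then show "AE z in ?LM. (\<lambda>m. ennreal (exp (?X m / 2) * ?cw (?X m) z)) \<longlonglongrightarrow> ennreal (?\<psi> (fst z))"
        using AE_space
      proof eventually_elim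
        case (elim z)
        then have "snd z \<in> space M" by (auto simp: space_pair_measure)
        from filterlim_compose[OF scaled_crossing_weight_limit[where g=g and p=P and y="fst z", OF a g(1) this] X'] elim(1)
        show ?case by (intro tendsto_ennrealI) auto
      qed
    qed measurable
    then have "(\<lambda>m. ?S (?X m)) \<longlonglongrightarrow> ennreal (unit_ball_vol CARD('n) * P) * (\<integral>\<^sup>+t\<in>{a..1}. ennreal (1 / t * exp (- g t / 2)) \<partial>lborel)"
      unfolding lim .
    then show "(\<lambda>m. ennreal ((2 * pi) powr P * measure M (?E (X m)) / (X m powr P * exp (- X m / 2)))) \<longlonglongrightarrow>
        ennreal (unit_ball_vol CARD('n) * P) * (\<integral>\<^sup>+t\<in>{a..1}. ennreal (1 / t * exp (- g t / 2)) \<partial>lborel)"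
    proof (rule Lim_transform_eventually)
      show "eventually (\<lambda>m. ?S (?X m) = ennreal ((2 * pi) powr P * measure M (?E (X m)) / (X m powr P * exp (- X m / 2)))) sequentially"
        using ev by eventually_elim (simp only: eq max_absorb2)
    qed
  qed
qed

end

section \<open>Conclusion\<close>

lemma nn_integral_Icc_finite:
  fixes f :: "real \<Rightarrow> real"
  assumes "continuous_on {a..b} f"
  shows "(\<integral>\<^sup>+t\<in>{a..b}. ennreal (f t) \<partial>lborel) < \<infinity>"
proof -
  have "compact (f ` {a..b})" using assms by (intro compact_continuous_image) auto
  then obtain B where B: "\<And>t. t \<in> {a..b} \<Longrightarrow> norm (f t) \<le> B"
    using compact_imp_bounded bounded_iff by (metis imageI)
  have "(\<integral>\<^sup>+t\<in>{a..b}. ennreal (f t) \<partial>lborel) \<le> (\<integral>\<^sup>+t. ennreal B * indicator {a..b} t \<partial>lborel)"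
    using B by (intro nn_integral_mono) (auto simp: indicator_def abs_le_iff intro!: ennreal_leI)
  also have "\<dots> = ennreal B * emeasure lborel {a..b}" by (rule nn_integral_cmult_indicator) simp
  also have "\<dots> < \<infinity>" by (cases "a \<le> b") (auto simp: ennreal_mult_less_top)
  finally show ?thesis .
qed

context multi_brownian_motion
begin

text \<open>A strict inequality for a supremum is witnessed at a single time, so the event of the
  theorem is a crossing event of the driftless path.\<close>

lemma less_SUP_iff_crosses:
  "ereal u < (SUP t\<in>{0<..1}. ereal ((norm (W t \<omega>))\<^sup>2 / t - g t)) \<longleftrightarrow>
    (\<exists>t\<in>{0<..1}. crosses (\<lambda>t. g t + u) (drifted 0 \<omega>) t)"
  unfolding less_SUP_iff
  by (rule bex_cong) (auto simp: crosses_def drifted_def field_simps)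

lemma pred_exists_crossing_Ioc:
  assumes b: "0 < b" and c: "continuous_on {0<..b} c"
  shows "Measurable.pred M (\<lambda>\<omega>. \<exists>t\<in>{0<..b}. crosses c (drifted \<theta> \<omega>) t)"
proof -
  have p: "0 < b / real (Suc m)" "b / real (Suc m) \<le> b" for m
    using b by (auto simp: divide_le_eq mult_le_cancel_left1)
  have [measurable]: "Measurable.pred M (\<lambda>\<omega>. \<exists>t\<in>{b / real (Suc m)..b}. crosses c (drifted \<theta> \<omega>) t)" for m
    using p[of m] by (intro pred_exists_crossing continuous_on_subset[OF c]) auto
  have eq: "(\<exists>t\<in>{0<..b}. crosses c (drifted \<theta> \<omega>) t) \<longleftrightarrow> (\<exists>m. \<exists>t\<in>{b / real (Suc m)..b}. crosses c (drifted \<theta> \<omega>) t)" for \<omega>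
  proof
    assume "\<exists>t\<in>{0<..b}. crosses c (drifted \<theta> \<omega>) t"
    then obtain t where t: "0 < t" "t \<le> b" "crosses c (drifted \<theta> \<omega>) t" by auto
    have "(\<lambda>m. b / real (Suc m)) \<longlonglongrightarrow> 0" by real_asymp
    from order_tendstoD(2)[OF this t(1)] obtain m where "b / real (Suc m) < t"
      by (auto simp: eventually_sequentially)
    then show "\<exists>m. \<exists>t\<in>{b / real (Suc m)..b}. crosses c (drifted \<theta> \<omega>) t" using t by (intro exI[of _ m]) auto
  next
    assume "\<exists>m. \<exists>t\<in>{b / real (Suc m)..b}. crosses c (drifted \<theta> \<omega>) t"
    then obtain m t where "t \<in> {b / real (Suc m)..b}" "crosses c (drifted \<theta> \<omega>) t" by auto
    then show "\<exists>t\<in>{0<..b}. crosses c (drifted \<theta> \<omega>) t" using p(1)[of m] by (intro bexI[of _ t]) auto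
  qed
  show ?thesis unfolding eq by measurable
qed

text \<open>If g + u is avoided with positive probability, the integral for g + u is finite near 0.
  Passing from g to g + u changes the exponential by a constant factor and can only increase the
  power, so the integral for g is finite near 0 as well; away from 0 its integrand is
  continuous.\<close>

lemma crossing_almost_sure_if_divergent:
  fixes g :: "real \<Rightarrow> real"
  assumes gm [measurable]: "g \<in> borel_measurable borel" and g: "continuous_on {0<..1} g"
    and nonneg: "\<And>t. t \<in> {0<..1} \<Longrightarrow> 0 \<le> g t"
    and \<delta>: "0 < \<delta>" "\<delta> \<le> 1" and dec: "\<And>s t. 0 < s \<Longrightarrow> s \<le> t \<Longrightarrow> t \<le> \<delta> \<Longrightarrow> g t \<le> g s"
    and lim: "filterlim g at_top (at_right 0)" and u: "0 \<le> u"
    and div: "(\<integral>\<^sup>+t\<in>{0<..1}. ennreal (1 / t * g t powr (CARD('n) / 2) * exp (- g t / 2)) \<partial>lborel) = \<infinity>"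
  shows "measure M {\<omega>\<in>space M. \<exists>t\<in>{0<..1}. crosses (\<lambda>t. g t + u) (drifted 0 \<omega>) t} = 1"
proof (rule ccontr)
  let ?c = "\<lambda>t. g t + u" and ?P = "real CARD('n) / 2"
  let ?E = "{\<omega>\<in>space M. \<exists>t\<in>{0<..1}. crosses ?c (drifted 0 \<omega>) t}"
  let ?h = "\<lambda>c t. ennreal (1 / t * c t powr ?P * exp (- c t / 2))"
  assume "measure M ?E \<noteq> 1"
  then have p: "0 < 1 - measure M ?E" using prob_le_1[of ?E] by linarith
  have [measurable]: "Measurable.pred M (\<lambda>\<omega>. \<exists>t\<in>{0<..1}. crosses ?c (drifted 0 \<omega>) t)"
    by (intro pred_exists_crossing_Ioc continuous_intros g) simp
  have E: "?E \<in> sets M" by measurable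
  have "\<exists>d. 0 < d \<and> d \<le> \<delta> \<and> (\<integral>\<^sup>+t\<in>{0<..d}. ?h ?c t \<partial>lborel) < \<infinity>"
  proof (rule integral_finite_if_no_crossing[OF \<delta>(1) _ _ _ _ p])
    show "continuous_on {0<..\<delta>} ?c" using \<delta> by (intro continuous_intros continuous_on_subset[OF g]) auto
    show "filterlim ?c at_top (at_right 0)"
      by (rule filterlim_at_top_mono[OF lim]) (use u in simp)
    show "1 - measure M ?E \<le> measure M {\<omega>\<in>space M. \<not> (\<exists>t\<in>{a..\<delta>}. crosses ?c (drifted 0 \<omega>) t)}"
      if a: "0 < a" "a < \<delta>" for a
    proof -
      have [measurable]: "Measurable.pred M (\<lambda>\<omega>. \<exists>t\<in>{a..\<delta>}. crosses ?c (drifted 0 \<omega>) t)"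
        using a \<delta> by (intro pred_exists_crossing continuous_intros continuous_on_subset[OF g]) auto
      have "1 - measure M ?E = measure M (space M - ?E)" by (rule prob_compl[OF E, symmetric])
      also have "\<dots> \<le> measure M {\<omega>\<in>space M. \<not> (\<exists>t\<in>{a..\<delta>}. crosses ?c (drifted 0 \<omega>) t)}"
      proof (rule finite_measure_mono)
        show "{\<omega>\<in>space M. \<not> (\<exists>t\<in>{a..\<delta>}. crosses ?c (drifted 0 \<omega>) t)} \<in> sets M" by measurable
      qed (use a \<delta> in force)
      finally show ?thesis .
    qed
  qed (use dec nonneg \<delta> u in auto)
  then obtain d where d: "0 < d" "d \<le> \<delta>" and fin: "(\<integral>\<^sup>+t\<in>{0<..d}. ?h ?c t \<partial>lborel) < \<infinity>" by blast
  have "(\<integral>\<^sup>+t\<in>{0<..1}. ?h g t \<partial>lborel) \<le>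
      (\<integral>\<^sup>+t. ennreal (exp (u / 2)) * (?h ?c t * indicator {0<..d} t) + ?h g t * indicator {d..1} t \<partial>lborel)"
  proof (rule nn_integral_mono)
    fix t
    have "?h g t \<le> ennreal (exp (u / 2)) * ?h ?c t" if t: "0 < t" "t \<le> d"
    proof -
      have "g t powr ?P * exp (- g t / 2) \<le> (g t + u) powr ?P * exp (- g t / 2)"
        using nonneg[of t] t d \<delta> u by (intro mult_right_mono powr_mono2) auto
      then have "1 / t * (g t powr ?P * exp (- g t / 2)) \<le> 1 / t * ((g t + u) powr ?P * exp (- g t / 2))"
        using t by (intro mult_left_mono) auto
      moreover have "exp (- g t / 2) = exp (u / 2) * exp (- (g t + u) / 2)"
        unfolding exp_add[symmetric] by (rule arg_cong[where f=exp]) (simp add: field_simps)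
      then have "1 / t * ((g t + u) powr ?P * exp (- g t / 2)) = exp (u / 2) * (1 / t * (g t + u) powr ?P * exp (- (g t + u) / 2))"
        by (simp only: mult_ac)
      ultimately have "1 / t * g t powr ?P * exp (- g t / 2) \<le> exp (u / 2) * (1 / t * (g t + u) powr ?P * exp (- (g t + u) / 2))"
        by (simp only: mult.assoc)
      from ennreal_leI[OF this] show ?thesis by (subst (asm) ennreal_mult) (use t in auto)
    qed
    then show "?h g t * indicator {0<..1} t \<le> ennreal (exp (u / 2)) * (?h ?c t * indicator {0<..d} t) + ?h g t * indicator {d..1} t"
      by (cases "t \<le> d") (auto simp: indicator_def add_increasing2)
  qed
  also have "\<dots> = ennreal (exp (u / 2)) * (\<integral>\<^sup>+t\<in>{0<..d}. ?h ?c t \<partial>lborel) + (\<integral>\<^sup>+t\<in>{d..1}. ?h g t \<partial>lborel)"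
    by (subst nn_integral_add) (measurable, simp add: nn_integral_cmult)
  also have "\<dots> < \<infinity>"
  proof -
    have "(\<integral>\<^sup>+t\<in>{d..1}. ?h g t \<partial>lborel) < \<infinity>"
    proof (rule nn_integral_Icc_finite)
      have g': "continuous_on {d..1} g" using d by (intro continuous_on_subset[OF g]) auto
      show "continuous_on {d..1} (\<lambda>t. 1 / t * g t powr ?P * exp (- g t / 2))"
        using d \<delta> nonneg by (intro continuous_intros g' continuous_on_powr') auto
    qed
    then show ?thesis using fin by (simp add: ennreal_mult_less_top)
  qed
  finally show False using div by simp
qed

text \<open>The event lies between the interior event on [a, 1] and the union of that event with the
  crossings in (0, a]. The interior limit holds for each fixed a, and the tail is small relative to
  u^P exp (- u / 2) uniformly in u \<ge> 2 when a is small; so a is fixed before u grows.\<close>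

lemma crossing_probability_limit:
  fixes g :: "real \<Rightarrow> real"
  assumes gm [measurable]: "g \<in> borel_measurable borel" and g: "continuous_on {0<..1} g"
    and nonneg: "\<And>t. t \<in> {0<..1} \<Longrightarrow> 0 \<le> g t"
    and \<delta>: "0 < \<delta>" "\<delta> \<le> 1" and dec: "\<And>s t. 0 < s \<Longrightarrow> s \<le> t \<Longrightarrow> t \<le> \<delta> \<Longrightarrow> g t \<le> g s"
    and lim: "filterlim g at_top (at_right 0)"
  defines "P \<equiv> real CARD('n) / 2" and "J \<equiv> (\<integral>\<^sup>+t\<in>{0<..1}. ennreal (1 / t * exp (- g t / 2)) \<partial>lborel)"
  assumes fin: "(\<integral>\<^sup>+t\<in>{0<..1}. ennreal (1 / t * g t powr P * exp (- g t / 2)) \<partial>lborel) < \<infinity>"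
  shows "J < \<infinity>"
    and "((\<lambda>u. (2 * pi) powr P * measure M {\<omega>\<in>space M. \<exists>t\<in>{0<..1}. crosses (\<lambda>t. g t + u) (drifted 0 \<omega>) t} /
        (u powr P * exp (- u / 2))) \<longlongrightarrow> unit_ball_vol CARD('n) * P * enn2real J) at_top"
proof -
  let ?h = "\<lambda>t. ennreal (1 / t * g t powr P * exp (- g t / 2))"
  let ?k = "\<lambda>t. ennreal (1 / t * exp (- g t / 2))"
  let ?\<omega> = "unit_ball_vol CARD('n) * P"
  have P: "0 < P" by (simp add: P_def)
  have \<omega>: "0 < ?\<omega>" using P by simp
  obtain K where K: "0 < K" "\<And>g a u T. 0 < a \<Longrightarrow> 2 \<le> u \<Longrightarrow> g \<in> borel_measurable borel \<Longrightarrow>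
    (\<And>s t. 0 < s \<Longrightarrow> s \<le> t \<Longrightarrow> t \<le> 2 * a \<Longrightarrow> g t \<le> g s) \<Longrightarrow>
    (\<And>t. 0 < t \<Longrightarrow> t \<le> 2 * a \<Longrightarrow> max 1 (2 * P) \<le> g t) \<Longrightarrow>
    T \<in> sets M \<Longrightarrow> (\<And>\<omega>. \<omega> \<in> T \<Longrightarrow> \<exists>t\<in>{0<..a}. crosses (\<lambda>t. g t + u) (drifted 0 \<omega>) t) \<Longrightarrow>
    emeasure M T \<le> ennreal (K * u powr P * exp (- u / 2)) *
      (\<integral>\<^sup>+t\<in>{0<..2 * a}. ennreal (1 / t * g t powr P * exp (- g t / 2)) \<partial>lborel)"
    using tail_crossing_probability_le unfolding P_def by blast
  have "eventually (\<lambda>t. max 1 (2 * P) \<le> g t) (at_right 0)"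
    using lim unfolding filterlim_at_top by blast
  then obtain d0 where d0: "0 < d0" "\<And>t. 0 < t \<Longrightarrow> t < d0 \<Longrightarrow> max 1 (2 * P) \<le> g t"
    by (auto simp: eventually_at_right_field)
  define d where "d = min (d0 / 2) \<delta>"
  have d: "0 < d" "d < d0" "d \<le> \<delta>" "d \<le> 1" using d0(1) \<delta> by (auto simp: d_def)
  have gd: "max 1 (2 * P) \<le> g t" if "0 < t" "t \<le> d" for t using d0(2)[of t] that d by simp
  \<comment> \<open>Near 0 one has g \<ge> 1, so the convergent integral dominates the one without
    the factor g^P.\<close>
  have kh: "(\<integral>\<^sup>+t\<in>{0<..b}. ?k t \<partial>lborel) \<le> (\<integral>\<^sup>+t\<in>{0<..b}. ?h t \<partial>lborel)" if "b \<le> d" for b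
  proof (rule nn_integral_mono)
    fix t
    have "1 / t * exp (- g t / 2) \<le> 1 / t * g t powr P * exp (- g t / 2)" if "0 < t" "t \<le> b"
    proof -
      have "1 \<le> g t powr P" using gd[of t] that \<open>b \<le> d\<close> P by (intro ge_one_powr_ge_zero) auto
      then have "1 / t * exp (- g t / 2) * 1 \<le> 1 / t * exp (- g t / 2) * g t powr P"
        using that by (intro mult_left_mono) auto
      then show ?thesis by (simp add: mult_ac)
    qed
    then show "?k t * indicator {0<..b} t \<le> ?h t * indicator {0<..b} t"
      by (auto simp: indicator_def intro!: ennreal_leI)
  qed
  have split: "J \<le> (\<integral>\<^sup>+t\<in>{0<..b}. ?k t \<partial>lborel) + (\<integral>\<^sup>+t\<in>{b..1}. ?k t \<partial>lborel)" for b
    unfolding J_def by (subst nn_integral_add[symmetric]) (measurable, auto intro!: nn_integral_mono simp: indicator_def)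
  have Jb: "(\<integral>\<^sup>+t\<in>{b..1}. ?k t \<partial>lborel) < \<infinity>" if "0 < b" for b
  proof (rule nn_integral_Icc_finite)
    have g': "continuous_on {b..1} g" using that by (intro continuous_on_subset[OF g]) auto
    show "continuous_on {b..1} (\<lambda>t. 1 / t * exp (- g t / 2))"
      using that by (intro continuous_intros g') auto
  qed
  have hd: "(\<integral>\<^sup>+t\<in>{0<..d}. ?h t \<partial>lborel) < \<infinity>"
  proof -
    have "(\<integral>\<^sup>+t\<in>{0<..d}. ?h t \<partial>lborel) \<le> (\<integral>\<^sup>+t\<in>{0<..1}. ?h t \<partial>lborel)"
      using d by (intro nn_integral_mono mult_left_mono indicator_leI) auto
    then show ?thesis using fin by (rule order_le_less_trans)
  qed
  show J: "J < \<infinity>"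
  proof -
    have "J \<le> (\<integral>\<^sup>+t\<in>{0<..d}. ?k t \<partial>lborel) + (\<integral>\<^sup>+t\<in>{d..1}. ?k t \<partial>lborel)" by (rule split)
    also have "\<dots> < \<infinity>" using Jb[OF d(1)] kh[OF order_refl] hd by (auto intro: order_le_less_trans)
    finally show ?thesis .
  qed
  let ?E = "\<lambda>u. {\<omega>\<in>space M. \<exists>t\<in>{0<..1}. crosses (\<lambda>t. g t + u) (drifted 0 \<omega>) t}"
  let ?Ea = "\<lambda>a u. {\<omega>\<in>space M. \<not> crosses (\<lambda>t. g t + u) (drifted 0 \<omega>) a \<and> (\<exists>t\<in>{a..1}. crosses (\<lambda>t. g t + u) (drifted 0 \<omega>) t)}"
  let ?T = "\<lambda>a u. {\<omega>\<in>space M. \<exists>t\<in>{0<..a}. crosses (\<lambda>t. g t + u) (drifted 0 \<omega>) t}"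
  let ?R = "\<lambda>A u. (2 * pi) powr P * measure M (A u) / (u powr P * exp (- u / 2))"
  show "(?R ?E \<longlongrightarrow> ?\<omega> * enn2real J) at_top"
  proof (rule tendstoI)
    fix e :: real assume e: "0 < e"
    \<comment> \<open>There are three errors of size e / 3: the interior limit, the part of
      \<open>J\<close> missing from [a, 1] times \<open>?\<omega>\<close>, and the tail with the
      factor (2 pi)^P K. This \<open>e'\<close> serves the last two at once.\<close>
    define e' where "e' = e / (3 * (?\<omega> + (2 * pi) powr P * K))"
    have den: "0 < ?\<omega> + (2 * pi) powr P * K" using \<omega> K(1) by (intro add_pos_nonneg) auto
    have e': "0 < e'" using e den by (simp add: e'_def)
    have "D * (e / (3 * D)) = e / 3" if "0 < D" for D using that by simp
    from this[OF den] have "(?\<omega> + (2 * pi) powr P * K) * e' = e / 3" by (simp only: e'_def)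
    moreover have "0 \<le> ?\<omega> * e'" "0 \<le> (2 * pi) powr P * K * e'" using \<omega> K(1) e' by auto
    ultimately have e3: "?\<omega> * e' \<le> e / 3" "(2 * pi) powr P * K * e' \<le> e / 3" by (simp_all add: distrib_right)
    obtain b where b: "0 < b" "b \<le> d" "(\<integral>\<^sup>+t\<in>{0<..b}. ?h t \<partial>lborel) < ennreal e'"
      using nn_integral_Ioc_small[OF _ hd d(1), of "ennreal e'"] e' by auto
    \<comment> \<open>The tail estimate integrates up to 2 a, hence half of
      \<open>b\<close>.\<close>
    define a where "a = b / 2"
    have a: "0 < a" "2 * a = b" "a < 1" "a \<le> d" using b d by (auto simp: a_def)
    have ga: "continuous_on {a..1} g" using a by (intro continuous_on_subset[OF g]) auto
    define Ja where "Ja = (\<integral>\<^sup>+t\<in>{a..1}. ?k t \<partial>lborel)"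
    have Ja: "Ja < \<infinity>" unfolding Ja_def by (rule Jb[OF a(1)])
    have JaJ: "enn2real Ja \<le> enn2real J" "enn2real J \<le> enn2real Ja + e'"
    proof -
      have "Ja \<le> J" unfolding Ja_def J_def using a by (intro nn_integral_mono mult_left_mono indicator_leI) auto
      then show "enn2real Ja \<le> enn2real J" using J by (intro enn2real_mono) auto
      have "J \<le> (\<integral>\<^sup>+t\<in>{0<..a}. ?k t \<partial>lborel) + Ja" unfolding Ja_def by (rule split)
      also have "(\<integral>\<^sup>+t\<in>{0<..a}. ?k t \<partial>lborel) \<le> (\<integral>\<^sup>+t\<in>{0<..a}. ?h t \<partial>lborel)" by (rule kh[OF a(4)])
      also have "\<dots> \<le> (\<integral>\<^sup>+t\<in>{0<..b}. ?h t \<partial>lborel)"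
        using a b by (intro nn_integral_mono mult_left_mono indicator_leI) (auto simp: a_def)
      also have "\<dots> \<le> ennreal e'" using b(3) by simp
      finally have "J \<le> ennreal e' + Ja" by (simp add: add_mono)
      moreover have "ennreal e' + Ja = ennreal (e' + enn2real Ja)" using Ja e' by simp
      ultimately have "J \<le> ennreal (e' + enn2real Ja)" by (simp only:)
      then show "enn2real J \<le> enn2real Ja + e'"
        using e' by (subst add.commute, intro enn2real_leI) (auto intro: add_nonneg_nonneg)
    qed
    have "(?R (?Ea a) \<longlongrightarrow> ?\<omega> * enn2real Ja) at_top"
    proof -
      have "((\<lambda>u. ennreal (?R (?Ea a) u)) \<longlongrightarrow> ennreal ?\<omega> * Ja) at_top"
        unfolding P_def Ja_def using a nonneg by (intro interior_crossing_limit ga) auto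
      moreover have "ennreal ?\<omega> * Ja = ennreal (?\<omega> * enn2real Ja)"
        using Ja \<omega> by (simp add: ennreal_mult)
      ultimately have "((\<lambda>u. ennreal (?R (?Ea a) u)) \<longlongrightarrow> ennreal (?\<omega> * enn2real Ja)) at_top" by simp
      then show ?thesis
        using \<omega> by (subst (asm) tendsto_ennreal_iff) (auto intro!: always_eventually)
    qed
    from tendstoD[OF this, of "e / 3"] e
    have "eventually (\<lambda>u. dist (?R (?Ea a) u) (?\<omega> * enn2real Ja) < e / 3) at_top" by simp
    then show "eventually (\<lambda>u. dist (?R ?E u) (?\<omega> * enn2real J) < e) at_top"
      using eventually_ge_at_top[of 2]
    proof eventually_elim
      case (elim u)
      have c: "continuous_on {0<..1} (\<lambda>t. g t + u)" by (intro continuous_intros g)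
      have m1 [measurable]: "Measurable.pred M (\<lambda>\<omega>. \<exists>t\<in>{0<..b}. crosses (\<lambda>t. g t + u) (drifted 0 \<omega>) t)" if "0 < b" "b \<le> 1" for b
        using that by (intro pred_exists_crossing_Ioc continuous_on_subset[OF c]) auto
      have m2 [measurable]: "Measurable.pred M (\<lambda>\<omega>. \<exists>t\<in>{a..1}. crosses (\<lambda>t. g t + u) (drifted 0 \<omega>) t)"
        using a by (intro pred_exists_crossing continuous_on_subset[OF c]) auto
      have m3 [measurable]: "Measurable.pred M (\<lambda>\<omega>. crosses (\<lambda>t. g t + u) (drifted 0 \<omega>) a)" using a by simp
      have Em: "?E u \<in> sets M" using m1[OF zero_less_one order_refl] by measurable
      have Eam: "?Ea a u \<in> sets M" by measurable
      have Tm: "?T a u \<in> sets M" using m1[OF a(1) less_imp_le[OF a(3)]] by measurable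
      let ?\<Phi> = "u powr P * exp (- u / 2)"
      have \<Phi>: "0 < ?\<Phi>" using elim(2) by simp
      have T: "measure M (?T a u) \<le> K * ?\<Phi> * e'"
      proof -
        have "emeasure M (?T a u) \<le> ennreal (K * u powr P * exp (- u / 2)) * (\<integral>\<^sup>+t\<in>{0<..2 * a}. ?h t \<partial>lborel)"
          using a b d by (intro K(2)[OF a(1) elim(2) gm _ _ Tm] dec gd) auto
        also have "\<dots> \<le> ennreal (K * u powr P * exp (- u / 2)) * ennreal e'"
          using b(3) unfolding a(2) by (intro mult_left_mono) auto
        also have "\<dots> = ennreal (K * ?\<Phi> * e')" using K(1) e' by (simp add: ennreal_mult[symmetric] mult_ac)
        finally show ?thesis using K(1) e' by (simp add: emeasure_eq_measure mult_nonneg_nonneg)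
      qed
      have lo: "measure M (?Ea a u) \<le> measure M (?E u)"
        using a by (intro finite_measure_mono[OF _ Em]) force
      have "measure M (?E u) \<le> measure M (?Ea a u \<union> ?T a u)"
      proof (rule finite_measure_mono[OF _ sets.Un[OF Eam Tm]], rule subsetI)
        fix \<omega> assume \<omega>: "\<omega> \<in> ?E u"
        then obtain t where t: "0 < t" "t \<le> 1" "crosses (\<lambda>t. g t + u) (drifted 0 \<omega>) t" by auto
        \<comment> \<open>A path that is across at a counts for the tail event, since a belongs to
          (0, a].\<close>
        have "(\<exists>t\<in>{0<..a}. crosses (\<lambda>t. g t + u) (drifted 0 \<omega>) t) \<or>
            (\<not> crosses (\<lambda>t. g t + u) (drifted 0 \<omega>) a \<and> (\<exists>t\<in>{a..1}. crosses (\<lambda>t. g t + u) (drifted 0 \<omega>) t))"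
        proof (cases "t \<le> a \<or> crosses (\<lambda>t. g t + u) (drifted 0 \<omega>) a")
          case True then show ?thesis using t a(1) by (metis greaterThanAtMost_iff order_refl)
        next
          case False then show ?thesis using t by (metis atLeastAtMost_iff linear)
        qed
        then show "\<omega> \<in> ?Ea a u \<union> ?T a u" using \<omega> by blast
      qed
      also have "\<dots> \<le> measure M (?Ea a u) + measure M (?T a u)" by (rule measure_Un_le[OF Eam Tm])
      finally have hi: "measure M (?E u) \<le> measure M (?Ea a u) + K * ?\<Phi> * e'" using T by linarith
      have "?R (?Ea a) u \<le> ?R ?E u" using lo \<Phi> by (intro divide_right_mono mult_left_mono) auto
      moreover have "?R ?E u \<le> ?R (?Ea a) u + (2 * pi) powr P * K * e'"
      proof -
        have alg: "C * (m + k * D * x) / D = C * m / D + C * k * x" if "0 < D" for C m k D x :: real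
          using that by (simp add: field_simps)
        have "?R ?E u \<le> (2 * pi) powr P * (measure M (?Ea a u) + K * ?\<Phi> * e') / ?\<Phi>"
          using hi \<Phi> by (intro divide_right_mono mult_left_mono) auto
        also have "\<dots> = ?R (?Ea a) u + (2 * pi) powr P * K * e'" by (rule alg[OF \<Phi>])
        finally show ?thesis .
      qed
      moreover have "?\<omega> * enn2real Ja \<le> ?\<omega> * enn2real J" using JaJ(1) \<omega> by (intro mult_left_mono) auto
      moreover have "?\<omega> * enn2real J \<le> ?\<omega> * enn2real Ja + ?\<omega> * e'"
        using mult_left_mono[OF JaJ(2), of ?\<omega>] \<omega> by (simp add: distrib_left)
      ultimately show ?case using elim(1) e3 unfolding dist_real_def by linarith
    qed
  qed
qed

end

text \<open>The unit ball volume in dimension 2 P is pi^P / Gamma (P + 1), and Gamma (P + 1) = P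
  Gamma P.\<close>

lemma gaussian_constant_eq:
  fixes P :: real
  assumes "0 < P"
  shows "2 powr (- P) / Gamma P = unit_ball_vol (2 * P) * P / (2 * pi) powr P"
proof -
  have "Gamma (P + 1) = P * Gamma P" using assms by (intro Gamma_plus1) (auto elim!: nonpos_Ints_cases)
  moreover have "0 < Gamma P" using assms by (rule Gamma_real_pos)
  ultimately show ?thesis
    using assms by (simp add: unit_ball_vol_def powr_mult powr_minus field_simps)
qed

theorem corollary2p8:
  fixes M :: "'a measure"
    and W :: "real \<Rightarrow> 'a \<Rightarrow> real ^ 'n"
    and g :: "real \<Rightarrow> real"
  assumes "multi_brownian_motion M W"
    and "continuous_on {0<..1} g"
    and "\<And>t. t \<in> {0<..1} \<Longrightarrow> 0 \<le> g t"
    and "increases_to_infinity_at_0 g"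
  shows "((\<integral>\<^sup>+ t\<in>{0<..1}. ennreal (1 / t * g t powr (CARD('n) / 2) * exp (- g t / 2)) \<partial>lborel) < \<infinity> \<longrightarrow>
      (\<lambda>u::real. measure M {\<omega> \<in> space M.
          (SUP t\<in>{0<..1}. ereal ((norm (W t \<omega>))\<^sup>2 / t - g t)) > ereal u})
      \<sim>[at_top]
      (\<lambda>u. 2 powr (- (CARD('n) / 2)) * u powr (CARD('n) / 2) * exp (- u / 2) / Gamma (CARD('n) / 2)
          * (LBINT t:{0<..1}. 1 / t * exp (- g t / 2)))) \<and>
    ((\<integral>\<^sup>+ t\<in>{0<..1}. ennreal (1 / t * g t powr (CARD('n) / 2) * exp (- g t / 2)) \<partial>lborel) = \<infinity> \<longrightarrow>
      measure M {\<omega> \<in> space M.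
          (SUP t\<in>{0<..1}. ereal ((norm (W t \<omega>))\<^sup>2 / t - g t)) = \<infinity>} = 1)"
  proof -
  interpret multi_brownian_motion M W by fact
  let ?P = "real CARD('n) / 2"
  \<comment> \<open>Outside (0, 1] nothing makes g measurable. The truncation is Borel on the whole
    line and leaves the supremum and the integrals unchanged.\<close>
  define g1 where "g1 t = (if t \<in> {0<..1} then g t else 0)" for t
  have g1_eq: "g1 t = g t" if "t \<in> {0<..1}" for t using that by (simp add: g1_def)
  have gm: "g1 \<in> borel_measurable borel"
    unfolding g1_def by (intro borel_measurable_continuous_on_if assms) auto
  have gc: "continuous_on {0<..1} g1"
    using assms(2) by (rule continuous_on_cong[THEN iffD1, rotated 2]) (simp_all add: g1_def)
  have nonneg: "0 \<le> g1 t" if "t \<in> {0<..1}" for t using assms(3)[OF that] g1_eq[OF that] by simp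
  obtain \<delta>0 where \<delta>0: "0 < \<delta>0" "\<And>s t. 0 < s \<Longrightarrow> s \<le> t \<Longrightarrow> t \<le> \<delta>0 \<Longrightarrow> g t \<le> g s"
    and lim0: "filterlim g at_top (at_right 0)"
    using assms(4) unfolding increases_to_infinity_at_0_def by blast
  define \<delta> where "\<delta> = min \<delta>0 1"
  have \<delta>: "0 < \<delta>" "\<delta> \<le> 1" using \<delta>0(1) by (auto simp: \<delta>_def)
  have dec: "g1 t \<le> g1 s" if "0 < s" "s \<le> t" "t \<le> \<delta>" for s t
    using \<delta>0(2)[of s t] that by (simp add: g1_def \<delta>_def)
  have "eventually (\<lambda>t. g1 t = g t) (at_right 0)"
    unfolding eventually_at_right_field by (intro exI[of _ 1]) (auto simp: g1_def)
  then have lim: "filterlim g1 at_top (at_right 0)"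
    using lim0 by (simp add: filterlim_cong)
  have SUP: "(SUP t\<in>{0<..1}. ereal ((norm (W t \<omega>))\<^sup>2 / t - g t)) = (SUP t\<in>{0<..1}. ereal ((norm (W t \<omega>))\<^sup>2 / t - g1 t))" for \<omega>
    by (intro SUP_cong) (simp_all add: g1_eq)
  have int1: "(\<integral>\<^sup>+t\<in>{0<..1}. ennreal (1 / t * g t powr ?P * exp (- g t / 2)) \<partial>lborel) =
      (\<integral>\<^sup>+t\<in>{0<..1}. ennreal (1 / t * g1 t powr ?P * exp (- g1 t / 2)) \<partial>lborel)"
    by (intro nn_integral_cong) (auto simp: indicator_def g1_def)
  let ?E = "\<lambda>u. {\<omega>\<in>space M. \<exists>t\<in>{0<..1}. crosses (\<lambda>t. g1 t + u) (drifted 0 \<omega>) t}"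
  have Em: "?E u \<in> sets M" for u
    using pred_exists_crossing_Ioc[OF zero_less_one, of "\<lambda>t. g1 t + u" 0] gc
    by (simp add: continuous_on_add)
  show ?thesis
  proof (intro conjI impI)
    assume "(\<integral>\<^sup>+t\<in>{0<..1}. ennreal (1 / t * g t powr ?P * exp (- g t / 2)) \<partial>lborel) < \<infinity>"
    then have fin: "(\<integral>\<^sup>+t\<in>{0<..1}. ennreal (1 / t * g1 t powr ?P * exp (- g1 t / 2)) \<partial>lborel) < \<infinity>"
      unfolding int1 .
    let ?J = "\<integral>\<^sup>+t\<in>{0<..1}. ennreal (1 / t * exp (- g1 t / 2)) \<partial>lborel"
    note J_fin = crossing_probability_limit(1)[OF gm gc nonneg \<delta> dec lim fin]
    note J_lim = crossing_probability_limit(2)[OF gm gc nonneg \<delta> dec lim fin]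
    have LBINT: "(LBINT t:{0<..1}. 1 / t * exp (- g t / 2)) = enn2real ?J"
    proof -
      have [measurable]: "g1 \<in> borel_measurable borel" by (rule gm)
      have "(LBINT t:{0<..1}. 1 / t * exp (- g t / 2)) = (\<integral>t. indicator {0<..1} t * (1 / t * exp (- g1 t / 2)) \<partial>lborel)"
        unfolding set_lebesgue_integral_def by (intro Bochner_Integration.integral_cong) (auto simp: indicator_def g1_def)
      also have "\<dots> = enn2real (\<integral>\<^sup>+t. ennreal (indicator {0<..1} t * (1 / t * exp (- g1 t / 2))) \<partial>lborel)"
        by (rule integral_eq_nn_integral) (measurable, auto simp: indicator_def)
      also have "(\<integral>\<^sup>+t. ennreal (indicator {0<..1} t * (1 / t * exp (- g1 t / 2))) \<partial>lborel) = ?J"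
        by (intro nn_integral_cong) (auto simp: indicator_def)
      finally show ?thesis .
    qed
    \<comment> \<open>The equivalence is proved through the quotient, so its constant must not
      vanish; the integrand is positive on (0, 1].\<close>
    have "?J \<noteq> 0"
    proof
      have [measurable]: "g1 \<in> borel_measurable borel" by (rule gm)
      assume "?J = 0"
      then have "AE t in lborel. ennreal (1 / t * exp (- g1 t / 2)) * indicator {0<..1} t = 0"
        by (subst (asm) nn_integral_0_iff_AE) auto
      then have "AE t in lborel. t \<notin> {0<..1::real}"
        by eventually_elim (auto simp: indicator_def ennreal_eq_0_iff divide_le_0_iff split: if_splits)
      then have "emeasure lborel {0<..1::real} = 0"
        by (subst (asm) AE_iff_measurable[where N="{0<..1}"]) auto
      then show False by simp
    qed
    then have Jpos: "0 < enn2real ?J" using J_fin by (simp add: enn2real_positive_iff less_top zero_less_iff_neq_zero)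
    let ?L = "unit_ball_vol CARD('n) * ?P * enn2real ?J"
    have L: "0 < ?L" using Jpos by simp
    have ev: "measure M {\<omega>\<in>space M. (SUP t\<in>{0<..1}. ereal ((norm (W t \<omega>))\<^sup>2 / t - g t)) > ereal u} = measure M (?E u)" for u
      unfolding SUP less_SUP_iff_crosses ..
    show "(\<lambda>u. measure M {\<omega>\<in>space M. (SUP t\<in>{0<..1}. ereal ((norm (W t \<omega>))\<^sup>2 / t - g t)) > ereal u}) \<sim>[at_top]
      (\<lambda>u. 2 powr (- ?P) * u powr ?P * exp (- u / 2) / Gamma ?P * (LBINT t:{0<..1}. 1 / t * exp (- g t / 2)))"
    proof (rule asymp_equivI')
      have "((\<lambda>u. (2 * pi) powr ?P * measure M (?E u) / (u powr ?P * exp (- u / 2)) / ?L) \<longlongrightarrow> ?L / ?L) at_top"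
        using L by (intro tendsto_divide J_lim tendsto_const) auto
      moreover have "?L / ?L = 1" using L by (intro divide_self) auto
      ultimately have ratio: "((\<lambda>u. (2 * pi) powr ?P * measure M (?E u) / (u powr ?P * exp (- u / 2)) / ?L) \<longlongrightarrow> 1) at_top"
        by (simp only:)
      have rhs: "2 powr (- ?P) * u powr ?P * exp (- u / 2) / Gamma ?P * enn2real ?J =
          (?L / (2 * pi) powr ?P) * (u powr ?P * exp (- u / 2))" for u
      proof -
        have "2 powr (- ?P) * u powr ?P * exp (- u / 2) / Gamma ?P * enn2real ?J =
            (2 powr (- ?P) / Gamma ?P) * (enn2real ?J * (u powr ?P * exp (- u / 2)))"
          by (simp only: times_divide_eq_left times_divide_eq_right mult_ac)
        also have "2 powr (- ?P) / Gamma ?P = unit_ball_vol CARD('n) * ?P / (2 * pi) powr ?P"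
          using gaussian_constant_eq[of ?P] by simp
        finally show ?thesis by (simp only: times_divide_eq_left times_divide_eq_right mult_ac)
      qed
      have quotient: "m / ((l / A) * F) = A * m / F / l" for m l A F :: real
        by (simp add: mult_ac)
      show "((\<lambda>u. measure M {\<omega>\<in>space M. (SUP t\<in>{0<..1}. ereal ((norm (W t \<omega>))\<^sup>2 / t - g t)) > ereal u} /
        (2 powr (- ?P) * u powr ?P * exp (- u / 2) / Gamma ?P * (LBINT t:{0<..1}. 1 / t * exp (- g t / 2)))) \<longlongrightarrow> 1) at_top"
        unfolding ev LBINT rhs quotient by (rule ratio)
    qed
  next
    assume "(\<integral>\<^sup>+t\<in>{0<..1}. ennreal (1 / t * g t powr ?P * exp (- g t / 2)) \<partial>lborel) = \<infinity>"
    then have div: "(\<integral>\<^sup>+t\<in>{0<..1}. ennreal (1 / t * g1 t powr ?P * exp (- g1 t / 2)) \<partial>lborel) = \<infinity>"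
      unfolding int1 .
    \<comment> \<open>Integer levels suffice: the supremum is infinite iff it exceeds every natural
      number, so countably many almost sure events combine into one.\<close>
    have "measure M (?E (real m)) = 1" for m
      by (rule crossing_almost_sure_if_divergent[OF gm gc nonneg \<delta> dec lim _ div]) auto
    then have "AE \<omega> in M. \<omega> \<in> ?E (real m)" for m by (rule AE_prob_1)
    then have AE: "AE \<omega> in M. \<forall>m. \<omega> \<in> ?E (real m)" unfolding AE_all_countable by blast
    have inf: "(SUP t\<in>{0<..1}. ereal ((norm (W t \<omega>))\<^sup>2 / t - g t)) = \<infinity> \<longleftrightarrow>
        (\<forall>m. \<exists>t\<in>{0<..1}. crosses (\<lambda>t. g1 t + real m) (drifted 0 \<omega>) t)" for \<omega>
    proof -
      have "(SUP t\<in>{0<..1}. ereal ((norm (W t \<omega>))\<^sup>2 / t - g1 t)) = \<infinity> \<longleftrightarrow>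
          (\<forall>m. ereal (real m) < (SUP t\<in>{0<..1}. ereal ((norm (W t \<omega>))\<^sup>2 / t - g1 t)))" (is "?S = \<infinity> \<longleftrightarrow> _")
      proof
        assume *: "\<forall>m. ereal (real m) < ?S"
        show "?S = \<infinity>"
        proof (cases ?S)
          case (real r)
          obtain m where "r < real m" using reals_Archimedean2 by blast
          with *[rule_format, of m] real show ?thesis by simp
        next
          case MInf
          with *[rule_format, of 0] show ?thesis by simp
        qed
      qed simp
      then show ?thesis unfolding SUP less_SUP_iff_crosses .
    qed
    have "{\<omega>\<in>space M. (SUP t\<in>{0<..1}. ereal ((norm (W t \<omega>))\<^sup>2 / t - g t)) = \<infinity>} = (\<Inter>m. ?E (real m))"
      unfolding inf by auto
    moreover have "measure M (\<Inter>m. ?E (real m)) = 1"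
    proof (subst prob_eq_1)
      show "(\<Inter>m. ?E (real m)) \<in> sets M" using Em by blast
      show "AE \<omega> in M. \<omega> \<in> (\<Inter>m. ?E (real m))" using AE by eventually_elim blast
    qed
    ultimately show "measure M {\<omega>\<in>space M. (SUP t\<in>{0<..1}. ereal ((norm (W t \<omega>))\<^sup>2 / t - g t)) = \<infinity>} = 1"
      by simp
  qed
qed

end
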